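(* Let $M$ be a perfect matching, with vertex set in general position (no three collinear), all of whose segments are vertical or horizontal. Then $M$ has an extension $L$ such that the associated dual multigraph $G$ has an edge-partition into two trees, and for every segment $vw$ of $M$ the edge of $G$ corresponding to $v$ and the edge of $G$ corresponding to $w$ lie in different trees.
   Context: A perfect matching is a geometric graph with straight-segment edges, no two crossing (meeting other than at a common endpoint), in which every vertex has degree exactly one. Extension: let $C$ be a convex set (possibly the whole plane) containing all segments of $M$. For each endpoint $v$ of a segment $vw\in M$, consider the ray starting at $v$ continuing $vw$ beyond $v$. These rays are drawn one at a time in some order; each is drawn until it first hits a segment of $M$, a previously drawn ray portion, or the boundary of $C$ (or to infinity if unblocked). The resulting set $L$ is an extension of $M$; it subdivides $C$ into $|M|+1$ convex cells, and each vertex of $M$ lies on the boundary of exactly two cells. The dual multigraph $G$ of $L$ has the cells as vertices and, for each vertex $v$ of $M$, one edge (corresponding to $v$) joining the two cells whose boundaries contain $v$. *)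

theory Defs
  imports "HOL-Analysis.Analysis"
begin

section \<open>Perfect matchings in the plane\<close>

type_synonym point = "real \<times> real"

text \<open>An edge is the set of its two endpoints; the segment it is drawn as is its convex hull.\<close>

definition geometric_graph :: "point set \<Rightarrow> point set set \<Rightarrow> bool" where
  "geometric_graph P E \<longleftrightarrow>
     finite P \<and> (\<forall>e\<in>E. \<exists>v\<in>P. \<exists>w\<in>P. v \<noteq> w \<and> e = {v, w})"

definition noncrossing :: "point set set \<Rightarrow> bool" where
  "noncrossing E \<longleftrightarrow>
     (\<forall>e\<in>E. \<forall>f\<in>E. e \<noteq> f \<longrightarrow> convex hull e \<inter> convex hull f \<subseteq> e \<inter> f)"

definition perfect_matching :: "point set \<Rightarrow> point set set \<Rightarrow> bool" where
  "perfect_matching P M \<longleftrightarrow>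
     geometric_graph P M \<and> noncrossing M \<and> (\<forall>v\<in>P. card {e \<in> M. v \<in> e} = 1)"

definition general_position :: "point set \<Rightarrow> bool" where
  "general_position P \<longleftrightarrow>
     (\<forall>a\<in>P. \<forall>b\<in>P. \<forall>c\<in>P. a \<noteq> b \<and> a \<noteq> c \<and> b \<noteq> c \<longrightarrow> \<not> collinear {a, b, c})"

definition axis_parallel :: "point set set \<Rightarrow> bool" where
  "axis_parallel M \<longleftrightarrow> (\<forall>v w. {v, w} \<in> M \<longrightarrow> fst v = fst w \<or> snd v = snd w)"

definition partner :: "point set set \<Rightarrow> point \<Rightarrow> point" where
  "partner M v = (THE w. {v, w} \<in> M)"


section \<open>Extensions\<close>

text \<open>The portion of the ray from \<^term>\<open>v\<close> away from \<^term>\<open>w\<close> up to and including its first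
  point in \<^term>\<open>B\<close>. The obstacle sets used below are closed, so a first point exists whenever
  \<^term>\<open>B\<close> is hit at all; otherwise the portion is the whole ray.\<close>

definition drawn_ray :: "point set \<Rightarrow> point \<Rightarrow> point \<Rightarrow> point set" where
  "drawn_ray B v w =
     {v + t *\<^sub>R (v - w) | t. 0 \<le> t \<and> (\<forall>s. 0 \<le> s \<and> s < t \<longrightarrow> v + s *\<^sub>R (v - w) \<notin> B)}"

text \<open>\<^term>\<open>R\<close> is the union of the ray portions drawn so far. The segment at \<^term>\<open>v\<close> itself is
  not an obstacle, since it meets the ray only in the starting point \<^term>\<open>v\<close>. If \<^term>\<open>v\<close> lies
  on the boundary of \<^term>\<open>C\<close>, the drawn portion is just \<^term>\<open>{v}\<close>.\<close>

primrec draw_rays :: "point set \<Rightarrow> point set set \<Rightarrow> point set \<Rightarrow> point list \<Rightarrow> point set" where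
  "draw_rays C M R [] = R"
| "draw_rays C M R (v # vs) =
     draw_rays C M
       (R \<union> drawn_ray ((\<Union>e \<in> M - {{v, partner M v}}. convex hull e) \<union> R \<union> frontier C)
              v (partner M v))
       vs"

definition extension :: "point set \<Rightarrow> point set set \<Rightarrow> point set \<Rightarrow> bool" where
  "extension C M L \<longleftrightarrow>
     (\<exists>vs. distinct vs \<and> set vs = \<Union>M \<and> L = (\<Union>e\<in>M. convex hull e) \<union> draw_rays C M {} vs)"

definition cells :: "point set \<Rightarrow> point set \<Rightarrow> point set set" where
  "cells C L = components (C - L)"


section \<open>Multigraphs and trees\<close>

record ('v, 'e) multigraph =
  verts :: "'v set"
  edges :: "'e set"
  ends :: "'e \<Rightarrow> 'v set"

definition wf_multigraph :: "('v, 'e) multigraph \<Rightarrow> bool" where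
  "wf_multigraph G \<longleftrightarrow>
     finite (verts G) \<and> finite (edges G) \<and>
     (\<forall>e\<in>edges G. ends G e \<subseteq> verts G \<and> card (ends G e) \<in> {1, 2})"

definition subgraph :: "('v, 'e) multigraph \<Rightarrow> ('v, 'e) multigraph \<Rightarrow> bool" where
  "subgraph H G \<longleftrightarrow>
     verts H \<subseteq> verts G \<and> edges H \<subseteq> edges G \<and> (\<forall>e\<in>edges H. ends H e = ends G e)"

definition connected_graph :: "('v, 'e) multigraph \<Rightarrow> bool" where
  "connected_graph G \<longleftrightarrow>
     verts G \<noteq> {} \<and>
     (\<forall>u\<in>verts G. \<forall>v\<in>verts G. (u, v) \<in> {(x, y). \<exists>e\<in>edges G. ends G e = {x, y}}\<^sup>*)"

text \<open>Loops are cycles of length 1, pairs of parallel edges are cycles of length 2.\<close>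

definition is_cycle :: "('v, 'e) multigraph \<Rightarrow> 'v list \<Rightarrow> 'e list \<Rightarrow> bool" where
  "is_cycle G us es \<longleftrightarrow>
     es \<noteq> [] \<and> length us = length es \<and> distinct us \<and> distinct es \<and>
     set us \<subseteq> verts G \<and> set es \<subseteq> edges G \<and>
     (\<forall>i < length es. ends G (es ! i) = {us ! i, us ! (Suc i mod length us)})"

definition is_tree :: "('v, 'e) multigraph \<Rightarrow> bool" where
  "is_tree T \<longleftrightarrow>
     wf_multigraph T \<and> connected_graph T \<and> (\<nexists>us es. is_cycle T us es)"

definition edge_partition_into_two_trees ::
  "('v, 'e) multigraph \<Rightarrow> ('v, 'e) multigraph \<Rightarrow> ('v, 'e) multigraph \<Rightarrow> bool" where
  "edge_partition_into_two_trees G S T \<longleftrightarrow>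
     subgraph S G \<and> subgraph T G \<and> is_tree S \<and> is_tree T \<and>
     edges S \<union> edges T = edges G \<and> edges S \<inter> edges T = {}"

text \<open>The edge of the dual multigraph corresponding to a vertex \<^term>\<open>v\<close> of the matching is
  \<^term>\<open>v\<close> itself.\<close>

definition dual_multigraph ::
  "point set \<Rightarrow> point set set \<Rightarrow> point set \<Rightarrow> (point set, point) multigraph" where
  "dual_multigraph C M L =
     \<lparr>verts = cells C L, edges = \<Union>M, ends = (\<lambda>v. {c \<in> cells C L. v \<in> frontier c})\<rparr>"

end

theory Submission
  imports Defs
begin

text \<open>Draw all horizontal rays before all vertical ones. A horizontal ray then ends on a vertical
  segment of \<open>M\<close> or on the frontier, and a vertical ray ends on an extended horizontal segment or on
  the frontier. One tree consists of the left endpoints of horizontal and the lower endpoints of vertical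
  segments (the marked endpoints), the other one of the remaining endpoints; the rotation by 180 degrees
  exchanges the two, so only the first has to be treated.

  Cut every extended segment at its marked endpoint and orient both pieces away from it. Following a
  piece to its end and continuing on the piece hit there, one only moves left, right or up after the
  first step: a downward piece is never hit. Hence these downstream paths are strictly increasing in height
  along vertical pieces and leave the convex set.

  The two downstream paths starting at a marked endpoint \<open>s\<close> together separate the two cells at \<open>s\<close> and
  avoid all other marked endpoints, so the marked edges are acyclic. Conversely, a union of cells
  that has no jump at any marked endpoint has no jump anywhere, by induction from
  the sources of the flow: a point of an extended segment where such a union jumps would need another
  jump upstream. So the marked edges connect all cells.\<close>

section \<open>Cuts along downstream paths\<close>

text \<open>No downstream path is ever built as a curve, so no Jordan curve argument enters. A path
  is represented by the set of points above a horizontal line and to the right of the path, and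
  separation means that this set is locally constant at the points the path misses. The growth in
  height becomes two inductions on a finite count: cuts are built by induction on the number of
  horizontals above a level, and the absence of jumps spreads by induction on the number of
  horizontals below. A marked endpoint may lie on the frontier of the convex set. Local statements
  therefore look only at points of the interior \<open>I\<close>, and such an endpoint is reached as
  a limit of points of its own segment, whose relative interior lies in \<open>I\<close>. Cells,
  however, are components taken in the convex set itself, which may contain any part of its
  frontier. For this reason the tree property is first put topologically, in \<open>I\<close> alone,
  and transferred to cells afterwards.\<close>

definition near :: "point set \<Rightarrow> point \<Rightarrow> point filter" where
  "near I w = inf (nhds w) (principal I)"

lemma eventually_near:
  "eventually P (near I w) \<longleftrightarrow> (\<exists>e>0. \<forall>z\<in>I. dist z w < e \<longrightarrow> P z)"
  unfolding near_def eventually_inf_principal eventually_nhds_metric by blast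

lemma eventually_near_open:
  assumes "open A" "w \<in> A"
  shows "\<forall>\<^sub>F z in near I w. z \<in> A"
  using assms unfolding near_def eventually_inf_principal
  by (auto simp: eventually_nhds)

lemma near_fst_gt: "a < fst w \<Longrightarrow> \<forall>\<^sub>F z in near I w. a < fst z"
  using eventually_near_open[of "{z. a < fst z}" w I] by (simp add: open_Collect_less continuous_intros)

lemma near_fst_less: "fst w < a \<Longrightarrow> \<forall>\<^sub>F z in near I w. fst z < a"
  using eventually_near_open[of "{z. fst z < a}" w I] by (simp add: open_Collect_less continuous_intros)

lemma near_snd_gt: "a < snd w \<Longrightarrow> \<forall>\<^sub>F z in near I w. a < snd z"
  using eventually_near_open[of "{z. a < snd z}" w I] by (simp add: open_Collect_less continuous_intros)

lemma near_snd_less: "snd w < a \<Longrightarrow> \<forall>\<^sub>F z in near I w. snd z < a"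
  using eventually_near_open[of "{z. snd z < a}" w I] by (simp add: open_Collect_less continuous_intros)

lemma eventually_near_at:
  "eventually P (near I w) \<Longrightarrow> w \<in> I \<Longrightarrow> P w"
  by (auto simp: eventually_near)

text \<open>Halving the radius leaves room to move the centre. The set of points at which a local
  property holds is thus open, as the connectedness arguments require.\<close>

lemma eventually_eventually_near:
  assumes "eventually P (near I w)"
  shows "\<exists>e>0. \<forall>w'. dist w' w < e \<longrightarrow> eventually P (near I w')"
proof -
  obtain e where e: "e > 0" "\<forall>z\<in>I. dist z w < e \<longrightarrow> P z"
    using assms by (auto simp: eventually_near)
  have "eventually P (near I w')" if "dist w' w < e/2" for w'
    unfolding eventually_near
  proof (intro exI[of _ "e/2"] conjI ballI impI)
    fix z assume "z \<in> I" "dist z w' < e/2"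
    then show "P z" using e that dist_triangle[of z w w'] by force
  qed (use e in auto)
  then show ?thesis using e(1) by (intro exI[of _ "e/2"]) auto
qed

definition locally_const :: "point set \<Rightarrow> point set \<Rightarrow> point \<Rightarrow> bool" where
  "locally_const I U w \<longleftrightarrow> (\<forall>\<^sub>F z in near I w. z \<in> U) \<or> (\<forall>\<^sub>F z in near I w. z \<notin> U)"

text \<open>Points of \<open>L\<close> are ignored because a union of cells contains none of them.
  This is the precise form of having no jump at \<open>w\<close>.\<close>

definition locally_const_off :: "point set \<Rightarrow> point set \<Rightarrow> point set \<Rightarrow> point \<Rightarrow> bool" where
  "locally_const_off I L U w \<longleftrightarrow>
     (\<forall>\<^sub>F z in near I w. z \<notin> L \<longrightarrow> z \<in> U) \<or> (\<forall>\<^sub>F z in near I w. z \<notin> L \<longrightarrow> z \<notin> U)"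

lemma locally_const_imp_off:
  assumes "locally_const I U w"
  shows "locally_const_off I L U w"
proof -
  have "(\<forall>\<^sub>F z in near I w. z \<notin> L \<longrightarrow> z \<in> U)" if "\<forall>\<^sub>F z in near I w. z \<in> U"
    using that by eventually_elim auto
  moreover have "(\<forall>\<^sub>F z in near I w. z \<notin> L \<longrightarrow> z \<notin> U)" if "\<forall>\<^sub>F z in near I w. z \<notin> U"
    using that by eventually_elim auto
  ultimately show ?thesis using assms unfolding locally_const_def locally_const_off_def by blast
qed

lemma locally_const_cong:
  assumes "\<forall>\<^sub>F z in near I w. z \<in> U \<longleftrightarrow> z \<in> W"
  shows "locally_const I U w \<longleftrightarrow> locally_const I W w"
proof -
  have "\<forall>\<^sub>F z in near I w. z \<notin> U \<longleftrightarrow> z \<notin> W" using assms by simp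
  then show ?thesis
    unfolding locally_const_def using eventually_subst[OF assms]
      eventually_subst[of "\<lambda>z. z \<notin> U" "\<lambda>z. z \<notin> W" "near I w"] by simp
qed

lemma locally_const_Diff:
  assumes "locally_const I U w" "locally_const I W w"
  shows "locally_const I (U - W) w"
proof (cases "(\<forall>\<^sub>F z in near I w. z \<in> U) \<and> (\<forall>\<^sub>F z in near I w. z \<notin> W)")
  case True
  then have "\<forall>\<^sub>F z in near I w. z \<in> U - W" by (simp add: eventually_conj_iff)
  then show ?thesis unfolding locally_const_def by blast
next
  case False
  then have "(\<forall>\<^sub>F z in near I w. z \<notin> U) \<or> (\<forall>\<^sub>F z in near I w. z \<in> W)"
    using assms unfolding locally_const_def by blast
  then have "\<forall>\<^sub>F z in near I w. z \<notin> U - W" by (auto elim: eventually_mono)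
  then show ?thesis unfolding locally_const_def by blast
qed

text \<open>For an interval \<open>A\<close> this is membership in its topological interior. An
  extended segment that contains \<open>x\<close> without having it as an inner point ends at
  \<open>x\<close>.\<close>

definition inner :: "real set \<Rightarrow> real \<Rightarrow> bool" where
  "inner A x \<longleftrightarrow> (\<exists>a\<in>A. a < x) \<and> (\<exists>b\<in>A. x < b)"

lemma real_between_convex:
  fixes a b x :: real
  assumes "a \<le> x" "x \<le> b"
  obtains u where "0 \<le> u" "u \<le> 1" "x = (1 - u) * a + u * b"
proof -
  have "x \<in> closed_segment a b" using assms by (simp add: closed_segment_eq_real_ivl)
  then show ?thesis using that by (auto simp: closed_segment_def)
qed

lemma convex_between_h:
  fixes A :: "point set"
  assumes "convex A" "(a, y) \<in> A" "(b, y) \<in> A" "a \<le> x" "x \<le> b"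
  shows "(x, y) \<in> A"
proof -
  obtain u where u: "0 \<le> u" "u \<le> 1" "x = (1 - u) * a + u * b"
    using real_between_convex assms by metis
  have "(1 - u) *\<^sub>R (a, y) + u *\<^sub>R (b, y) \<in> A"
    using assms u by (intro convexD_alt) auto
  moreover have "(1 - u) * c + u * c = c" for c :: real by (simp add: algebra_simps)
  ultimately show ?thesis using u(3) by simp
qed

lemma convex_between_v:
  fixes A :: "point set"
  assumes "convex A" "(x, a) \<in> A" "(x, b) \<in> A" "a \<le> y" "y \<le> b"
  shows "(x, y) \<in> A"
proof -
  obtain u where u: "0 \<le> u" "u \<le> 1" "y = (1 - u) * a + u * b"
    using real_between_convex assms by metis
  have "(1 - u) *\<^sub>R (x, a) + u *\<^sub>R (x, b) \<in> A"
    using assms u by (intro convexD_alt) auto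
  moreover have "(1 - u) * c + u * c = c" for c :: real by (simp add: algebra_simps)
  ultimately show ?thesis using u(3) by simp
qed

section \<open>Abstract arrangements of extended axis-parallel segments\<close>

text \<open>The horizontal segment \<^term>\<open>k\<close> lies at height \<open>ht k\<close> over \<open>{xl k..xr k}\<close> and is extended to the
  interval \<open>hh k\<close>; the vertical segment \<^term>\<open>j\<close> lies at abscissa \<open>ab j\<close> over \<open>{yb j..yt j}\<close> and is extended
  to \<open>vv j\<close>. The assumptions are invariant under the rotation by 180 degrees.\<close>

locale axis_arrangement =
  fixes I :: "point set" and EH EV :: "'i set"
    and ht xl xr :: "'i \<Rightarrow> real" and hh :: "'i \<Rightarrow> real set"
    and ab yb yt :: "'i \<Rightarrow> real" and vv :: "'i \<Rightarrow> real set"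
  assumes open_I: "open I" and convex_I: "convex I"
    and finite_EH: "finite EH" and finite_EV: "finite EV"
    and closed_hh: "k \<in> EH \<Longrightarrow> closed (hh k)" and interval_hh: "k \<in> EH \<Longrightarrow> is_interval (hh k)"
    and closed_vv: "j \<in> EV \<Longrightarrow> closed (vv j)" and interval_vv: "j \<in> EV \<Longrightarrow> is_interval (vv j)"
    and inj_ht: "inj_on ht EH" and inj_ab: "inj_on ab EV"
    and xl_less_xr: "k \<in> EH \<Longrightarrow> xl k < xr k" and yb_less_yt: "j \<in> EV \<Longrightarrow> yb j < yt j"
    and xl_hh: "k \<in> EH \<Longrightarrow> xl k \<in> hh k" and xr_hh: "k \<in> EH \<Longrightarrow> xr k \<in> hh k"
    and yb_vv: "j \<in> EV \<Longrightarrow> yb j \<in> vv j" and yt_vv: "j \<in> EV \<Longrightarrow> yt j \<in> vv j"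
    and hseg_I: "k \<in> EH \<Longrightarrow> xl k < x \<Longrightarrow> x < xr k \<Longrightarrow> (x, ht k) \<in> I"
    and vseg_I: "j \<in> EV \<Longrightarrow> yb j < y \<Longrightarrow> y < yt j \<Longrightarrow> (ab j, y) \<in> I"
    and ab_neq: "k \<in> EH \<Longrightarrow> j \<in> EV \<Longrightarrow> ab j \<noteq> xl k \<and> ab j \<noteq> xr k"
    and ht_neq: "k \<in> EH \<Longrightarrow> j \<in> EV \<Longrightarrow> ht k \<noteq> yb j \<and> ht k \<noteq> yt j"
    and left_end: "k \<in> EH \<Longrightarrow> (\<forall>x<xl k. (x, ht k) \<in> I \<longrightarrow> x \<in> hh k) \<or>
      (\<exists>j\<in>EV. ab j \<in> hh k \<and> (\<forall>x\<in>hh k. ab j \<le> x) \<and> yb j < ht k \<and> ht k < yt j)"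
    and right_end: "k \<in> EH \<Longrightarrow> (\<forall>x>xr k. (x, ht k) \<in> I \<longrightarrow> x \<in> hh k) \<or>
      (\<exists>j\<in>EV. ab j \<in> hh k \<and> (\<forall>x\<in>hh k. x \<le> ab j) \<and> yb j < ht k \<and> ht k < yt j)"
    and bottom_end: "j \<in> EV \<Longrightarrow> (\<forall>y<yb j. (ab j, y) \<in> I \<longrightarrow> y \<in> vv j) \<or>
      (\<exists>k\<in>EH. ht k \<in> vv j \<and> (\<forall>y\<in>vv j. ht k \<le> y) \<and> (ab j, ht k) \<in> I \<and> ab j \<in> hh k \<and> inner (hh k) (ab j))"
    and top_end: "j \<in> EV \<Longrightarrow> (\<forall>y>yt j. (ab j, y) \<in> I \<longrightarrow> y \<in> vv j) \<or>
      (\<exists>k\<in>EH. ht k \<in> vv j \<and> (\<forall>y\<in>vv j. y \<le> ht k) \<and> (ab j, ht k) \<in> I \<and> ab j \<in> hh k \<and> inner (hh k) (ab j))"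
    and crossing_mid: "k \<in> EH \<Longrightarrow> j \<in> EV \<Longrightarrow> ab j \<in> hh k \<Longrightarrow> yb j < ht k \<Longrightarrow> ht k < yt j \<Longrightarrow>
      \<not> inner (hh k) (ab j)"
    and crossing_low: "k \<in> EH \<Longrightarrow> j \<in> EV \<Longrightarrow> ab j \<in> hh k \<Longrightarrow> ht k \<in> vv j \<Longrightarrow> ht k < yb j \<Longrightarrow>
      y \<in> vv j \<Longrightarrow> ht k \<le> y"
    and crossing_high: "k \<in> EH \<Longrightarrow> j \<in> EV \<Longrightarrow> ab j \<in> hh k \<Longrightarrow> ht k \<in> vv j \<Longrightarrow> yt j < ht k \<Longrightarrow>
      y \<in> vv j \<Longrightarrow> y \<le> ht k"
begin

definition S :: "point set" where
  "S = (\<lambda>k. (xl k, ht k)) ` EH \<union> (\<lambda>j. (ab j, yb j)) ` EV"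

definition L :: "point set" where
  "L = (\<Union>k\<in>EH. hh k \<times> {ht k}) \<union> (\<Union>j\<in>EV. {ab j} \<times> vv j)"

lemma neqs:
  assumes "k \<in> EH" "j \<in> EV"
  shows "ab j \<noteq> xl k" "xl k \<noteq> ab j" "ab j \<noteq> xr k" "xr k \<noteq> ab j"
    "ht k \<noteq> yb j" "yb j \<noteq> ht k" "ht k \<noteq> yt j" "yt j \<noteq> ht k"
  using ab_neq[OF assms] ht_neq[OF assms] by auto

lemma hh_between: "k \<in> EH \<Longrightarrow> a \<in> hh k \<Longrightarrow> b \<in> hh k \<Longrightarrow> a \<le> x \<Longrightarrow> x \<le> b \<Longrightarrow> x \<in> hh k"
  using interval_hh is_interval_1 by blast

lemma vv_between: "j \<in> EV \<Longrightarrow> a \<in> vv j \<Longrightarrow> b \<in> vv j \<Longrightarrow> a \<le> x \<Longrightarrow> x \<le> b \<Longrightarrow> x \<in> vv j"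
  using interval_vv is_interval_1 by blast

lemma I_between_h: "(a, y) \<in> I \<Longrightarrow> (b, y) \<in> I \<Longrightarrow> a \<le> x \<Longrightarrow> x \<le> b \<Longrightarrow> (x, y) \<in> I"
  by (rule convex_between_h[OF convex_I])

lemma I_between_v: "(x, a) \<in> I \<Longrightarrow> (x, b) \<in> I \<Longrightarrow> a \<le> y \<Longrightarrow> y \<le> b \<Longrightarrow> (x, y) \<in> I"
  by (rule convex_between_v[OF convex_I])

lemma closed_L: "closed L"
  unfolding L_def by (intro closed_Un closed_UN closed_Times closed_hh closed_vv finite_EH finite_EV ballI closed_singleton)

text \<open>Points that no downstream path meets after its start. The part of a vertical piece below its
  marked endpoint counts as free, since nothing is hit there.\<close>

definition free :: "point \<Rightarrow> bool" where
  "free w \<longleftrightarrow> w \<in> I \<union> S \<and> (\<forall>k\<in>EH. w \<in> hh k \<times> {ht k} \<longrightarrow> w = (xl k, ht k)) \<and>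
     (\<forall>j\<in>EV. w \<in> {ab j} \<times> (vv j \<inter> {yb j..}) \<longrightarrow> w = (ab j, yb j))"

lemma free_off_L: "w \<in> I - L \<Longrightarrow> free w"
  unfolding free_def L_def by auto

lemma free_S: "w \<in> S \<Longrightarrow> free w"
  unfolding free_def S_def using inj_ht inj_ab by (auto simp: neqs dest: inj_onD)

text \<open>On the line of \<open>j\<close>, the only free point of the upper piece is its start at
  height \<open>yb j\<close>. The last hypothesis is conditional because a free point outside
  \<open>I\<close> is a marked endpoint, which distinctness of coordinates settles.\<close>

lemma free_above_bottom_fst_neq:
  assumes "free w" "j \<in> EV" "yb j < snd w" "w \<in> I \<Longrightarrow> snd w \<in> vv j"
  shows "fst w \<noteq> ab j"
proof
  assume eq: "fst w = ab j"
  have "w \<in> S"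
    using assms eq unfolding free_def by (cases w) auto
  then show False
    using assms(2,3) eq inj_ab unfolding S_def by (auto simp: neqs dest: inj_onD)
qed

lemma free_at_height:
  assumes "free w" "k \<in> EH" "snd w = ht k"
  shows "w = (xl k, ht k) \<or> (w \<in> I \<and> fst w \<notin> hh k)"
  using assms inj_ht unfolding free_def S_def by (cases w) (auto simp: neqs dest: inj_onD)

text \<open>The region above height \<open>y\<close> and to the right of the downstream path
  climbing from \<open>(ab j, y)\<close>. The last two clauses fix its lower boundary, so that
  regions over successive levels can be glued.\<close>

definition up_cut :: "'i \<Rightarrow> real \<Rightarrow> point set \<Rightarrow> bool" where
  "up_cut j y U \<longleftrightarrow> (\<forall>z\<in>U. y < snd z) \<and> (\<forall>w. free w \<and> y < snd w \<longrightarrow> locally_const I U w) \<and>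
     (\<forall>x>ab j. \<forall>\<^sub>F z in near I (x, y). y < snd z \<longrightarrow> z \<in> U) \<and>
     (\<forall>x<ab j. \<forall>\<^sub>F z in near I (x, y). y < snd z \<longrightarrow> z \<notin> U)"

text \<open>The region to the right of the path that first runs left along \<open>k\<close> to its
  end. Points just above \<open>k\<close> lie inside, points just above the rest of the level
  further left lie outside.\<close>

definition left_cut :: "'i \<Rightarrow> point set \<Rightarrow> bool" where
  "left_cut k W \<longleftrightarrow> (\<forall>z\<in>W. ht k < snd z) \<and> (\<forall>w. free w \<and> ht k < snd w \<longrightarrow> locally_const I W w) \<and>
     (\<forall>x. (\<exists>q\<in>hh k. q < x) \<longrightarrow> (\<forall>\<^sub>F z in near I (x, ht k). ht k < snd z \<longrightarrow> z \<in> W)) \<and>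
     (\<forall>x. (x, ht k) \<in> I \<and> (\<forall>q\<in>hh k. x < q) \<longrightarrow>
        (\<forall>\<^sub>F z in near I (x, ht k). ht k < snd z \<longrightarrow> z \<notin> W))"

text \<open>Again the region to the right of a path, now of the one that first runs right along
  \<open>k\<close>; hence points just above \<open>k\<close> lie outside.\<close>

definition right_cut :: "'i \<Rightarrow> point set \<Rightarrow> bool" where
  "right_cut k W \<longleftrightarrow> (\<forall>z\<in>W. ht k < snd z) \<and> (\<forall>w. free w \<and> ht k < snd w \<longrightarrow> locally_const I W w) \<and>
     (\<forall>x. (\<exists>q\<in>hh k. x < q) \<longrightarrow> (\<forall>\<^sub>F z in near I (x, ht k). ht k < snd z \<longrightarrow> z \<notin> W)) \<and>
     (\<forall>x. (x, ht k) \<in> I \<and> (\<forall>q\<in>hh k. q < x) \<longrightarrow>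
        (\<forall>\<^sub>F z in near I (x, ht k). ht k < snd z \<longrightarrow> z \<in> W))"

lemma left_cut_in:
  assumes "left_cut k W" "snd w = ht k" "q \<in> hh k" "q < fst w"
  shows "\<forall>\<^sub>F z in near I w. ht k < snd z \<longrightarrow> z \<in> W"
  using assms by (cases w) (auto simp: left_cut_def)

lemma left_cut_out:
  assumes "left_cut k W" "snd w = ht k" "w \<in> I" "\<forall>q\<in>hh k. fst w < q"
  shows "\<forall>\<^sub>F z in near I w. ht k < snd z \<longrightarrow> z \<notin> W"
  using assms by (cases w) (auto simp: left_cut_def)

lemma right_cut_out:
  assumes "right_cut k W" "snd w = ht k" "q \<in> hh k" "fst w < q"
  shows "\<forall>\<^sub>F z in near I w. ht k < snd z \<longrightarrow> z \<notin> W"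
  using assms by (cases w) (auto simp: right_cut_def)

lemma right_cut_in:
  assumes "right_cut k W" "snd w = ht k" "w \<in> I" "\<forall>q\<in>hh k. q < fst w"
  shows "\<forall>\<^sub>F z in near I w. ht k < snd z \<longrightarrow> z \<in> W"
  using assms by (cases w) (auto simp: right_cut_def)

text \<open>If the left piece leaves \<open>I\<close>, no point of \<open>I\<close> at this height
  lies beyond it and the whole upper half-plane serves. Otherwise the path turns upwards at the
  segment that stops \<open>k\<close>, and the cut of that segment is also the cut of
  \<open>k\<close>.\<close>

lemma left_cut_exists:
  assumes k: "k \<in> EH"
    and up: "\<And>j. j \<in> EV \<Longrightarrow> yb j < ht k \<Longrightarrow> ht k < yt j \<Longrightarrow> \<exists>U. up_cut j (ht k) U"
  shows "\<exists>W. left_cut k W"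
proof (cases "\<forall>x<xl k. (x, ht k) \<in> I \<longrightarrow> x \<in> hh k")
  case True
  have "left_cut k {z. ht k < snd z}"
    unfolding left_cut_def locally_const_def
    using True xl_hh[OF k] by (auto simp: near_snd_gt)
  then show ?thesis ..
next
  case False
  then obtain j where j: "j \<in> EV" "ab j \<in> hh k" "\<forall>x\<in>hh k. ab j \<le> x" "yb j < ht k" "ht k < yt j"
    using left_end[OF k] by blast
  then obtain U where "up_cut j (ht k) U" using up by blast
  then have "left_cut k U"
    unfolding left_cut_def up_cut_def using j by (meson order_le_less_trans)
  then show ?thesis ..
qed

text \<open>A right piece that leaves \<open>I\<close> has nothing of \<open>I\<close> beyond it at
  this height, so here the empty set serves; otherwise the path again turns upwards.\<close>

lemma right_cut_exists:
  assumes k: "k \<in> EH"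
    and up: "\<And>j. j \<in> EV \<Longrightarrow> yb j < ht k \<Longrightarrow> ht k < yt j \<Longrightarrow> \<exists>U. up_cut j (ht k) U"
  shows "\<exists>W. right_cut k W"
proof (cases "\<forall>x>xr k. (x, ht k) \<in> I \<longrightarrow> x \<in> hh k")
  case True
  have "right_cut k {}"
    unfolding right_cut_def locally_const_def
    using True xr_hh[OF k] by auto
  then show ?thesis ..
next
  case False
  then obtain j where j: "j \<in> EV" "ab j \<in> hh k" "\<forall>x\<in>hh k. x \<le> ab j" "yb j < ht k" "ht k < yt j"
    using right_end[OF k] by blast
  then obtain U where "up_cut j (ht k) U" using up by blast
  then have "right_cut k U"
    unfolding right_cut_def up_cut_def using j by (meson order_less_le_trans)
  then show ?thesis ..
qed

text \<open>The path climbs along \<open>j\<close> to the horizontal that stops it, follows that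
  horizontal away from its marked endpoint, and continues at a height above which fewer horizontals
  remain.\<close>

lemma up_cut_exists:
  assumes "j \<in> EV" "yb j < y" "y < yt j"
  shows "\<exists>U. up_cut j y U"
  using assms
proof (induction "card {k\<in>EH. y < ht k}" arbitrary: j y rule: less_induct)
  case less
  note j = less.prems
  show ?case
  proof (cases "\<forall>y>yt j. (ab j, y) \<in> I \<longrightarrow> y \<in> vv j")
    case True
    let ?U = "{z. y < snd z \<and> ab j < fst z}"
    have "locally_const I ?U w" if w: "free w" "y < snd w" for w
    proof -
      have "snd w \<in> vv j" if "w \<in> I" "fst w = ab j"
        using True that w j vv_between[OF j(1) yb_vv yt_vv, of "snd w"] j(1)
        by (cases "snd w > yt j") (cases w, auto)
      then have "fst w \<noteq> ab j"
        using free_above_bottom_fst_neq[of w j] w j by fastforce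
      then consider "fst w < ab j" | "ab j < fst w" by linarith
      then show ?thesis
      proof cases
        case 1
        have "\<forall>\<^sub>F z in near I w. z \<notin> ?U"
          using near_fst_less[OF 1, of I] by eventually_elim auto
        then show ?thesis unfolding locally_const_def by blast
      next
        case 2
        have "\<forall>\<^sub>F z in near I w. z \<in> ?U"
          using near_fst_gt[OF 2, of I] near_snd_gt[OF w(2), of I] by eventually_elim auto
        then show ?thesis unfolding locally_const_def by blast
      qed
    qed
    moreover have "\<forall>\<^sub>F z in near I (x, y). y < snd z \<longrightarrow> z \<in> ?U" if "ab j < x" for x
      using near_fst_gt[of "ab j" "(x, y)" I] that by (simp add: eventually_mono)
    moreover have "\<forall>\<^sub>F z in near I (x, y). y < snd z \<longrightarrow> z \<notin> ?U" if "x < ab j" for x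
      using near_fst_less[of "(x, y)" "ab j" I] that by (auto simp: not_less elim: eventually_mono)
    ultimately have "up_cut j y ?U"
      unfolding up_cut_def by blast
    then show ?thesis ..
  next
    case False
    then obtain k where k: "k \<in> EH" "ht k \<in> vv j" "\<forall>y\<in>vv j. y \<le> ht k" "ab j \<in> hh k" "inner (hh k) (ab j)"
      using top_end[OF j(1)] by blast
    let ?t = "ht k"
    have yt: "yt j < ?t" using k yt_vv[OF j(1)] ht_neq[OF k(1) j(1)] by force
    then have yt': "y < ?t" using j by simp
    \<comment> \<open>\<open>k\<close> itself lies above \<open>y\<close> but not above its own
      height.\<close>
    have "card {k'\<in>EH. ?t < ht k'} < card {k'\<in>EH. y < ht k'}"
      using finite_EH k(1) yt' by (intro psubset_card_mono) auto
    then have IH: "\<exists>U. up_cut j' ?t U" if "j' \<in> EV" "yb j' < ?t" "?t < yt j'" for j'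
      using less.hyps that by blast
    have col: "fst w \<noteq> ab j" if "free w" "y < snd w" "snd w \<le> ?t" for w
      using free_above_bottom_fst_neq[of w j] that j
        vv_between[OF j(1) yb_vv k(2), of "snd w"] j(1) by auto
    \<comment> \<open>It remains to continue the cut along the horizontal, away from its marked endpoint.\<close>
    have step: "\<exists>U. up_cut j y U" if W: "\<forall>z\<in>W. ?t < snd z" "\<forall>w. free w \<and> ?t < snd w \<longrightarrow> locally_const I W w"
      and right: "\<And>w. free w \<Longrightarrow> snd w = ?t \<Longrightarrow> ab j < fst w \<Longrightarrow> \<forall>\<^sub>F z in near I w. ?t < snd z \<longrightarrow> z \<in> W"
      and left: "\<And>w. free w \<Longrightarrow> snd w = ?t \<Longrightarrow> fst w < ab j \<Longrightarrow> \<forall>\<^sub>F z in near I w. ?t < snd z \<longrightarrow> z \<notin> W"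
    for W
    proof
      let ?U = "{z. y < snd z \<and> snd z \<le> ?t \<and> ab j < fst z} \<union> W"
      have "locally_const I ?U w" if w: "free w" "y < snd w" for w
      proof -
        consider "?t < snd w" | "snd w \<le> ?t" "fst w < ab j" | "snd w \<le> ?t" "ab j < fst w"
          using col[OF w] by linarith
        then show ?thesis
        proof cases
          case 1
          have "\<forall>\<^sub>F z in near I w. z \<in> ?U \<longleftrightarrow> z \<in> W"
            using near_snd_gt[OF 1, of I] by eventually_elim auto
          moreover have "locally_const I W w" using W(2) w 1 by blast
          ultimately show ?thesis using locally_const_cong by blast
        next
          case 2
          have "\<forall>\<^sub>F z in near I w. ?t < snd z \<longrightarrow> z \<notin> W"
          proof (cases "snd w = ?t")
            case True then show ?thesis using left w 2 by auto
          next
            case False then show ?thesis using near_snd_less[of w ?t I] 2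
              by (auto elim!: eventually_mono)
          qed
          then have "\<forall>\<^sub>F z in near I w. z \<notin> ?U"
            using near_fst_less[OF 2(2), of I] by eventually_elim (use W in auto)
          then show ?thesis unfolding locally_const_def by blast
        next
          case 3
          have "\<forall>\<^sub>F z in near I w. ?t < snd z \<longrightarrow> z \<in> W"
          proof (cases "snd w = ?t")
            case True then show ?thesis using right w 3 by auto
          next
            case False then show ?thesis using near_snd_less[of w ?t I] 3
              by (auto elim!: eventually_mono)
          qed
          then have "\<forall>\<^sub>F z in near I w. z \<in> ?U"
            using near_fst_gt[OF 3(2), of I] near_snd_gt[OF w(2), of I]
            by eventually_elim (use W in auto)
          then show ?thesis unfolding locally_const_def by blast
        qed
      qed
      moreover have "\<forall>\<^sub>F z in near I (x, y). y < snd z \<longrightarrow> z \<in> ?U" if "ab j < x" for x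
      proof -
        have "\<forall>\<^sub>F z in near I (x, y). ab j < fst z" "\<forall>\<^sub>F z in near I (x, y). snd z < ?t"
          using near_fst_gt[of "ab j" "(x, y)" I] near_snd_less[of "(x, y)" ?t I] that yt' by auto
        then show ?thesis by eventually_elim auto
      qed
      moreover have "\<forall>\<^sub>F z in near I (x, y). y < snd z \<longrightarrow> z \<notin> ?U" if "x < ab j" for x
      proof -
        have "\<forall>\<^sub>F z in near I (x, y). fst z < ab j" "\<forall>\<^sub>F z in near I (x, y). snd z < ?t"
          using near_fst_less[of "(x, y)" "ab j" I] near_snd_less[of "(x, y)" ?t I] that yt' by auto
        then show ?thesis by eventually_elim (use W(1) in auto)
      qed
      ultimately show "up_cut j y ?U"
        unfolding up_cut_def using W(1) yt' by auto
    qed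
    show ?thesis
    \<comment> \<open>The flow on \<open>k\<close> leads away from \<open>xl k\<close>: a hit to the
      left of the marked endpoint continues to the left, any other hit to the right.\<close>
    proof (cases "ab j < xl k")
      case True
      obtain W where W: "left_cut k W" using left_cut_exists[OF k(1)] IH by blast
      show ?thesis
      proof (rule step)
        fix w assume w: "free w" "snd w = ?t" "ab j < fst w"
        show "\<forall>\<^sub>F z in near I w. ?t < snd z \<longrightarrow> z \<in> W" by (rule left_cut_in[OF W w(2) k(4) w(3)])
      next
        fix w assume w: "free w" "snd w = ?t" "fst w < ab j"
        \<comment> \<open>The marked endpoint, the only free point on \<open>k\<close>, is on the
          other side of the hit.\<close>
        then have "w \<in> I" "fst w \<notin> hh k"
          using free_at_height[OF w(1) k(1)] True by auto
        moreover have "\<forall>q\<in>hh k. fst w < q"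
          using calculation hh_between[OF k(1) _ k(4)] w by (meson less_le_not_le linorder_not_le)
        ultimately show "\<forall>\<^sub>F z in near I w. ?t < snd z \<longrightarrow> z \<notin> W"
          using left_cut_out[OF W w(2)] by blast
      qed (use W in \<open>auto simp: left_cut_def\<close>)
    next
      case False
      then have less: "xl k < ab j" using ab_neq[OF k(1) j(1)] by auto
      obtain W where W: "right_cut k W" using right_cut_exists[OF k(1)] IH by blast
      show ?thesis
      proof (rule step)
        fix w assume w: "free w" "snd w = ?t" "fst w < ab j"
        show "\<forall>\<^sub>F z in near I w. ?t < snd z \<longrightarrow> z \<notin> W" by (rule right_cut_out[OF W w(2) k(4) w(3)])
      next
        fix w assume w: "free w" "snd w = ?t" "ab j < fst w"
        then have "w \<in> I" "fst w \<notin> hh k"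
          using free_at_height[OF w(1) k(1)] less by auto
        moreover have "\<forall>q\<in>hh k. q < fst w"
          using calculation hh_between[OF k(1) k(4)] w by (meson less_le_not_le linorder_not_le)
        ultimately show "\<forall>\<^sub>F z in near I w. ?t < snd z \<longrightarrow> z \<in> W"
          using right_cut_in[OF W w(2)] by blast
      qed (use W in \<open>auto simp: right_cut_def\<close>)
    qed
  qed
qed

end

lemma dist_Pair_le: "dist (a, b) (c, d) \<le> \<bar>a - c\<bar> + \<bar>b - d\<bar>" for a b c d :: real
  unfolding dist_Pair_Pair dist_real_def using sqrt_sum_squares_le_sum_abs[of "a - c" "b - d"] by simp

lemma real_interval_avoids_finite:
  fixes a b :: real
  assumes "finite F" "a < b"
  obtains x where "a < x" "x < b" "x \<notin> F"
proof -
  have "infinite ({a<..<b} - F)" using assms by (simp add: infinite_Ioo)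
  then obtain x where "x \<in> {a<..<b} - F" by (metis finite.emptyI ex_in_conv)
  then show ?thesis using that by auto
qed

text \<open>Serves to reach an endpoint that may lie outside \<open>I\<close> from the open segment
  next to it.\<close>

lemma closed_segment_limit_left:
  fixes f :: "real \<Rightarrow> point"
  assumes "continuous_on UNIV f" "closed K" "a < b" "\<And>x. a < x \<Longrightarrow> x < b \<Longrightarrow> f x \<in> K"
  shows "f a \<in> K"
proof -
  have "closed (f -` K)" using assms by (simp add: continuous_closed_vimage continuous_on_eq_continuous_at)
  moreover have "{a<..<b} \<subseteq> f -` K" using assms by auto
  ultimately have "closure {a<..<b} \<subseteq> f -` K" by (rule closure_minimal[rotated])
  then show ?thesis using assms(3) by (simp add: subset_iff)
qed

lemma mem_closure_snd_gt: "w \<in> closure {z::point. snd w < snd z}"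
  and mem_closure_snd_less: "w \<in> closure {z::point. snd z < snd w}"
  and mem_closure_fst_gt: "w \<in> closure {z::point. fst w < fst z}"
  and mem_closure_fst_less: "w \<in> closure {z::point. fst z < fst w}"
proof -
  obtain x y where w: "w = (x, y)" by (cases w)
  have *: "w \<in> closure A" if "\<And>e. e > 0 \<Longrightarrow> (x + a * e, y + b * e) \<in> A" "\<bar>a\<bar> + \<bar>b\<bar> \<le> 1" for A and a b :: real
    unfolding closure_approachable
  proof (intro allI impI)
    fix e :: real assume e: "e > 0"
    have "dist (x + a * (e/2), y + b * (e/2)) (x, y) \<le> \<bar>a * (e/2)\<bar> + \<bar>b * (e/2)\<bar>"
      using dist_Pair_le[of "x + a * (e/2)" "y + b * (e/2)" x y] by simp
    also have "\<dots> = (\<bar>a\<bar> + \<bar>b\<bar>) * (e/2)" using e by (simp add: abs_mult algebra_simps)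
    also have "\<dots> \<le> 1 * (e/2)" using that(2) e by (intro mult_right_mono) auto
    also have "\<dots> < e" using e by simp
    finally show "\<exists>z\<in>A. dist z w < e" using that(1)[of "e/2"] e w by auto
  qed
  show "w \<in> closure {z. snd w < snd z}" by (rule *[of 0 1]) (auto simp: w)
  show "w \<in> closure {z. snd z < snd w}" by (rule *[of 0 "-1"]) (auto simp: w)
  show "w \<in> closure {z. fst w < fst z}" by (rule *[of 1 0]) (auto simp: w)
  show "w \<in> closure {z. fst z < fst w}" by (rule *[of "-1" 0]) (auto simp: w)
qed

section \<open>Separating sets at the marked endpoints\<close>

context axis_arrangement
begin

text \<open>\<open>L\<close> lies on finitely many axis-parallel lines, so both coordinates can be
  moved slightly off all of them.\<close>

lemma off_L_dense:
  assumes "open A" "A \<inter> I \<noteq> {}"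
  obtains x y where "(x, y) \<in> A" "(x, y) \<in> I" "x \<notin> ab ` EV" "y \<notin> ht ` EH"
proof -
  obtain a b where ab: "(a, b) \<in> A \<inter> I" using assms by auto
  then obtain e where e: "e > 0" "ball (a, b) e \<subseteq> A \<inter> I"
    using open_contains_ball open_Int[OF assms(1) open_I] by metis
  obtain x where x: "a < x" "x < a + e/2" "x \<notin> ab ` EV"
    using real_interval_avoids_finite[of "ab ` EV" a "a + e/2"] finite_EV e by auto
  obtain y where y: "b < y" "y < b + e/2" "y \<notin> ht ` EH"
    using real_interval_avoids_finite[of "ht ` EH" b "b + e/2"] finite_EH e by auto
  have "dist (a, b) (x, y) < e" using dist_Pair_le[of a b x y] x y by linarith
  then show ?thesis using that[of x y] x y e by (auto simp: subset_iff)
qed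

lemma off_grid_off_L: "x \<notin> ab ` EV \<Longrightarrow> y \<notin> ht ` EH \<Longrightarrow> (x, y) \<notin> L"
  unfolding L_def by auto

text \<open>Removing \<open>L\<close> does not affect which side of \<open>w\<close> is approached,
  since off-grid points are dense in the open side \<open>H\<close>.\<close>

lemma closure_from_side:
  assumes "w \<in> I" "open H" "w \<in> closure H" "\<forall>\<^sub>F z in near I w. z \<in> H \<longrightarrow> z \<in> U"
  shows "w \<in> closure ((I - L) \<inter> U)"
  unfolding closure_iff_nhds_not_empty
proof (intro allI impI)
  fix A V assume A: "V \<subseteq> A" "open V" "w \<in> V"
  obtain e where e: "e > 0" "\<forall>z\<in>I. dist z w < e \<longrightarrow> z \<in> H \<longrightarrow> z \<in> U"
    using assms(4) by (auto simp: eventually_near)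
  have "w \<in> (V \<inter> ball w e \<inter> I) \<inter> closure H" using assms A e by simp
  moreover have "open (V \<inter> ball w e \<inter> I)" using A open_I by auto
  ultimately have "(V \<inter> ball w e \<inter> I) \<inter> H \<noteq> {}" using open_Int_closure_eq_empty by blast
  then have "(V \<inter> ball w e \<inter> H) \<inter> I \<noteq> {}" by blast
  moreover have "open (V \<inter> ball w e \<inter> H)" using A assms(2) by auto
  ultimately obtain x y where "(x, y) \<in> V \<inter> ball w e \<inter> H" "(x, y) \<in> I" "x \<notin> ab ` EV" "y \<notin> ht ` EH"
    using off_L_dense by blast
  then have "(x, y) \<in> ((I - L) \<inter> U) \<inter> A" using off_grid_off_L e A by (auto simp: dist_commute)
  then show "((I - L) \<inter> U) \<inter> A \<noteq> {}" by blast
qed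

text \<open>The set is the region enclosed above \<open>k\<close> by the two downstream paths: right
  of the path starting to the left, minus right of the path starting to the right. It touches the
  segment from above only, and all of its complement near the segment is below.\<close>

lemma horizontal_cut:
  assumes k: "k \<in> EH"
  shows "\<exists>U. (\<forall>w. free w \<and> w \<noteq> (xl k, ht k) \<longrightarrow> locally_const I U w) \<and>
    (xl k, ht k) \<in> closure ((I - L) \<inter> U) \<and> (xl k, ht k) \<in> closure ((I - L) \<inter> - U)"
proof -
  obtain W V where W: "left_cut k W" and V: "right_cut k V"
    using left_cut_exists right_cut_exists up_cut_exists k by metis
  let ?U = "W - V"
  have lc: "locally_const I ?U w" if w: "free w" "w \<noteq> (xl k, ht k)" for w
  proof -
    consider "snd w < ht k" | "ht k < snd w" | "snd w = ht k" by linarith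
    then show ?thesis
    proof cases
      case 1
      have "\<forall>\<^sub>F z in near I w. z \<notin> ?U"
        using near_snd_less[OF 1, of I] by eventually_elim (use W in \<open>auto simp: left_cut_def\<close>)
      then show ?thesis unfolding locally_const_def by blast
    next
      case 2
      then show ?thesis using w W V unfolding left_cut_def right_cut_def
        by (intro locally_const_Diff) blast+
    next
      case 3
      then have w': "w \<in> I" "fst w \<notin> hh k" using free_at_height[OF w(1) k] w by auto
      consider "\<forall>q\<in>hh k. fst w < q" | "\<forall>q\<in>hh k. q < fst w"
        using w' hh_between[OF k] by (meson linorder_not_le order_less_imp_le)
      then have "\<forall>\<^sub>F z in near I w. ht k < snd z \<longrightarrow> z \<notin> ?U"
      proof cases
        case 1
        then have "\<forall>\<^sub>F z in near I w. ht k < snd z \<longrightarrow> z \<notin> W"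
          using left_cut_out[OF W 3 w'(1)] by blast
        then show ?thesis by eventually_elim auto
      next
        case 2
        then have "\<forall>\<^sub>F z in near I w. ht k < snd z \<longrightarrow> z \<in> V"
          using right_cut_in[OF V 3 w'(1)] by blast
        then show ?thesis by eventually_elim auto
      qed
      then have "\<forall>\<^sub>F z in near I w. z \<notin> ?U"
        by eventually_elim (use W in \<open>auto simp: left_cut_def\<close>)
      then show ?thesis unfolding locally_const_def by blast
    qed
  qed
  have seg: "(x, ht k) \<in> closure ((I - L) \<inter> ?U) \<and> (x, ht k) \<in> closure ((I - L) \<inter> - ?U)"
    if x: "xl k < x" "x < xr k" for x
  proof -
    have xI: "(x, ht k) \<in> I" using hseg_I k x by blast
    have "\<forall>\<^sub>F z in near I (x, ht k). ht k < snd z \<longrightarrow> z \<in> W"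
      "\<forall>\<^sub>F z in near I (x, ht k). ht k < snd z \<longrightarrow> z \<notin> V"
      using W V x xl_hh[OF k] xr_hh[OF k] unfolding left_cut_def right_cut_def by blast+
    then have "\<forall>\<^sub>F z in near I (x, ht k). z \<in> {z. ht k < snd z} \<longrightarrow> z \<in> ?U"
      by eventually_elim auto
    then have 1: "(x, ht k) \<in> closure ((I - L) \<inter> ?U)"
      using mem_closure_snd_gt[of "(x, ht k)"] xI
      by (intro closure_from_side[of _ "{z. ht k < snd z}"]) (auto intro!: open_Collect_less continuous_intros)
    have "\<forall>\<^sub>F z in near I (x, ht k). z \<in> {z. snd z < ht k} \<longrightarrow> z \<in> - ?U"
      using W by (intro always_eventually) (auto simp: left_cut_def)
    then have 2: "(x, ht k) \<in> closure ((I - L) \<inter> - ?U)"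
      using mem_closure_snd_less[of "(x, ht k)"] xI
      by (intro closure_from_side[of _ "{z. snd z < ht k}"]) (auto intro!: open_Collect_less continuous_intros)
    show ?thesis using 1 2 by blast
  qed
  \<comment> \<open>The marked endpoint may be on the frontier of \<open>I\<close>, where
    \<open>closure_from_side\<close> does not apply; it is a limit of points of the open
    segment.\<close>
  have "(xl k, ht k) \<in> closure ((I - L) \<inter> ?U)"
    by (rule closed_segment_limit_left[of "\<lambda>x. (x, ht k)", OF _ _ xl_less_xr[OF k]])
      (use seg in \<open>auto intro!: continuous_intros\<close>)
  moreover have "(xl k, ht k) \<in> closure ((I - L) \<inter> - ?U)"
    by (rule closed_segment_limit_left[of "\<lambda>x. (x, ht k)", OF _ _ xl_less_xr[OF k]])
      (use seg in \<open>auto intro!: continuous_intros\<close>)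
  ultimately show ?thesis using lc by blast
qed

lemma vertical_jump:
  assumes "(a, y) \<in> I" "\<forall>\<^sub>F z in near I (a, y). fst z \<noteq> a \<longrightarrow> (z \<in> U \<longleftrightarrow> a < fst z)"
  shows "(a, y) \<in> closure ((I - L) \<inter> U) \<and> (a, y) \<in> closure ((I - L) \<inter> - U)"
proof
  have "\<forall>\<^sub>F z in near I (a, y). z \<in> {z. a < fst z} \<longrightarrow> z \<in> U"
    using assms(2) by eventually_elim auto
  then show "(a, y) \<in> closure ((I - L) \<inter> U)"
    using mem_closure_fst_gt[of "(a, y)"] assms(1)
    by (intro closure_from_side[of _ "{z. a < fst z}"]) (auto intro!: open_Collect_less continuous_intros)
  have "\<forall>\<^sub>F z in near I (a, y). z \<in> {z. fst z < a} \<longrightarrow> z \<in> - U"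
    using assms(2) by eventually_elim auto
  then show "(a, y) \<in> closure ((I - L) \<inter> - U)"
    using mem_closure_fst_less[of "(a, y)"] assms(1)
    by (intro closure_from_side[of _ "{z. fst z < a}"]) (auto intro!: open_Collect_less continuous_intros)
qed

text \<open>\<open>R\<close> is the right side of the upper path, continued downwards along the line
  of \<open>j\<close>. It separates if the lower piece leaves \<open>I\<close>. If a horizontal
  stops the lower piece, the path continuing from there closes off a region on one side of
  \<open>j\<close>. Local constancy is not claimed at all free points here, because the free lower
  piece itself is part of the cut.\<close>

lemma vertical_cut:
  assumes j: "j \<in> EV"
  shows "\<exists>U. (\<forall>w \<in> (I - L) \<union> (S - {(ab j, yb j)}). locally_const I U w) \<and>
    (ab j, yb j) \<in> closure ((I - L) \<inter> U) \<and> (ab j, yb j) \<in> closure ((I - L) \<inter> - U)"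
proof -
  let ?E = "(I - L) \<union> (S - {(ab j, yb j)})"
  \<comment> \<open>\<open>up_cut_exists\<close> needs a height strictly inside the segment; at such
    a height the segment also lies in \<open>I\<close>.\<close>
  define m where "m = (yb j + yt j) / 2"
  have m: "yb j < m" "m < yt j" using yb_less_yt[OF j] by (auto simp: m_def)
  obtain V where V: "up_cut j m V" using up_cut_exists[OF j m] by blast
  define R where "R = V \<union> {z. snd z \<le> m \<and> ab j < fst z}"
  have R_right: "\<forall>\<^sub>F z in near I w. z \<in> R" if "snd w \<le> m" "ab j < fst w" for w
  proof (cases "snd w < m")
    case True
    show ?thesis using near_snd_less[OF True, of I] near_fst_gt[OF that(2), of I]
      by eventually_elim (auto simp: R_def)
  next
    case False
    then have "w = (fst w, m)" using that by (simp add: prod_eq_iff)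
    then have "\<forall>\<^sub>F z in near I w. m < snd z \<longrightarrow> z \<in> V"
      using V that unfolding up_cut_def by metis
    then show ?thesis using near_fst_gt[OF that(2), of I]
      by eventually_elim (auto simp: R_def)
  qed
  have R_left: "\<forall>\<^sub>F z in near I w. z \<notin> R" if "snd w \<le> m" "fst w < ab j" for w
  proof (cases "snd w < m")
    case True
    show ?thesis using near_snd_less[OF True, of I] near_fst_less[OF that(2), of I]
      by eventually_elim (use V in \<open>auto simp: R_def up_cut_def\<close>)
  next
    case False
    then have "w = (fst w, m)" using that by (simp add: prod_eq_iff)
    then have "\<forall>\<^sub>F z in near I w. m < snd z \<longrightarrow> z \<notin> V"
      using V that unfolding up_cut_def by metis
    then show ?thesis using near_fst_less[OF that(2), of I]
      by eventually_elim (use V in \<open>auto simp: R_def up_cut_def\<close>)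
  qed
  have R_lc: "locally_const I R w" if w: "free w" "fst w = ab j \<Longrightarrow> m < snd w" for w
  proof (cases "m < snd w")
    case True
    have "\<forall>\<^sub>F z in near I w. z \<in> R \<longleftrightarrow> z \<in> V"
      using near_snd_gt[OF True, of I] by eventually_elim (auto simp: R_def)
    moreover have "locally_const I V w" using V w True unfolding up_cut_def by blast
    ultimately show ?thesis using locally_const_cong by blast
  next
    case False
    then consider "fst w < ab j" | "ab j < fst w" using w by linarith
    then show ?thesis using R_left[of w] R_right[of w] False unfolding locally_const_def by cases auto
  qed
  have R_near: "\<forall>\<^sub>F z in near I w. z \<in> R \<longleftrightarrow> ab j < fst z" if "snd w < m" for w
    using near_snd_less[OF that, of I] by eventually_elim (use V in \<open>auto simp: R_def up_cut_def\<close>)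
  have S_col: "fst w \<noteq> ab j" if "w \<in> S" "w \<noteq> (ab j, yb j)" for w
    using that j inj_ab unfolding S_def by (auto simp: neqs dest: inj_onD)
  have col: "w \<in> I \<and> snd w \<notin> vv j \<and> snd w < yb j"
    if w: "w \<in> ?E" "fst w = ab j" "snd w \<le> m" for w
  proof -
    have "w \<in> I - L" using w S_col[of w] by blast
    moreover from this have "snd w \<notin> vv j" using w(2) j unfolding L_def by (cases w) auto
    moreover have "snd w < yb j"
      using calculation vv_between[OF j yb_vv[OF j] yt_vv[OF j], of "snd w"] w m by fastforce
    ultimately show ?thesis by blast
  qed
  have free: "free w" if "w \<in> ?E" for w
    using that free_off_L free_S by blast
  show ?thesis
  proof (cases "\<forall>y<yb j. (ab j, y) \<in> I \<longrightarrow> y \<in> vv j")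
    case True
    have "locally_const I R w" if w: "w \<in> ?E" for w
    proof (rule R_lc[OF free[OF w]])
      assume "fst w = ab j"
      then show "m < snd w" using True col[OF w] by (cases w) force
    qed
    moreover have seg: "(ab j, y) \<in> closure ((I - L) \<inter> R) \<and> (ab j, y) \<in> closure ((I - L) \<inter> - R)"
      if y: "yb j < y" "y < m" for y
    proof (rule vertical_jump)
      show "(ab j, y) \<in> I" using vseg_I[OF j] y m by auto
      show "\<forall>\<^sub>F z in near I (ab j, y). fst z \<noteq> ab j \<longrightarrow> (z \<in> R \<longleftrightarrow> ab j < fst z)"
        using R_near[of "(ab j, y)"] y by (auto elim: eventually_mono)
    qed
    moreover have "(ab j, yb j) \<in> closure ((I - L) \<inter> R)"
      by (rule closed_segment_limit_left[of "\<lambda>y. (ab j, y)", OF _ _ m(1)])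
        (use seg in \<open>auto intro!: continuous_intros\<close>)
    moreover have "(ab j, yb j) \<in> closure ((I - L) \<inter> - R)"
      by (rule closed_segment_limit_left[of "\<lambda>y. (ab j, y)", OF _ _ m(1)])
        (use seg in \<open>auto intro!: continuous_intros\<close>)
    ultimately show ?thesis by blast
  next
    case False
    then obtain k where k: "k \<in> EH" "ht k \<in> vv j" "\<forall>y\<in>vv j. ht k \<le> y" "(ab j, ht k) \<in> I"
        "ab j \<in> hh k" "inner (hh k) (ab j)"
      using bottom_end[OF j] by blast
    let ?t = "ht k"
    have t: "?t < yb j" using k(3) yb_vv[OF j] neqs[OF k(1) j] by force
    have midI: "(ab j, m) \<in> I" using vseg_I[OF j] m by auto
    have colI: "(ab j, y) \<in> I" if "?t < y" "y \<le> yb j" for y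
      using I_between_v[OF k(4) midI] that m by auto
    \<comment> \<open>By \<open>crossing_low\<close>, a horizontal meeting the lower piece marks its
      end, so none meets it strictly above \<open>k\<close>.\<close>
    have A_free: "free (ab j, y)" if y: "?t < y" "y \<le> yb j" for y
    proof -
      have yv: "y \<in> vv j" using vv_between[OF j k(2) yb_vv[OF j], of y] y by auto
      have "ab j \<notin> hh k'" if k': "k' \<in> EH" "ht k' = y" for k'
      proof
        assume "ab j \<in> hh k'"
        then have "ht k' \<le> ?t"
          using crossing_low[OF k'(1) j _ _ _ k(2)] k'(2) yv y neqs[OF k'(1) j] by force
        then show False using k'(2) y by simp
      qed
      then show ?thesis unfolding free_def using colI[OF y] y j inj_ab by (auto dest: inj_onD)
    qed
    have below: "snd w < ?t" if w: "w \<in> ?E" "fst w = ab j" "snd w \<le> m" for w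
      using col[OF w] vv_between[OF j k(2) yb_vv[OF j], of "snd w"] by fastforce
    \<comment> \<open>All points of the lower piece above \<open>k\<close> are free, so membership
      in \<open>Q\<close> is carried along it from just above \<open>k\<close> up to the marked
      endpoint. This is why lower pieces count as free.\<close>
    have column: "\<forall>\<^sub>F z in near I (ab j, yb j). z \<in> Q"
      if Q: "\<And>w. free w \<Longrightarrow> ?t < snd w \<Longrightarrow> locally_const I Q w"
        "\<forall>\<^sub>F z in near I (ab j, ?t). ?t < snd z \<longrightarrow> z \<in> Q" for Q
    proof -
      let ?P = "\<lambda>y. \<forall>\<^sub>F z in near I (ab j, y). z \<in> Q"
      obtain e where e: "e > 0" "\<forall>z\<in>I. dist z (ab j, ?t) < e \<longrightarrow> ?t < snd z \<longrightarrow> z \<in> Q"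
        using Q(2) by (auto simp: eventually_near)
      define a where "a = min (yb j) (?t + e/2)"
      have a: "?t < a" "a \<le> yb j" "a < ?t + e" using t e(1) by (auto simp: a_def)
      have "dist (ab j, a) (ab j, ?t) < e"
        using dist_Pair_le[of "ab j" a "ab j" ?t] a by linarith
      then have "(ab j, a) \<in> Q" using e(2) colI[OF a(1,2)] a by force
      then have Pa: "?P a"
        using Q(1)[OF A_free[OF a(1,2)]] a eventually_near_at[OF _ colI[OF a(1,2)], of "\<lambda>z. z \<notin> Q"]
        unfolding locally_const_def by auto
      show ?thesis
      proof (rule connected_induction_simple[of "{?t<..yb j}" a "yb j" ?P])
        fix b assume b: "b \<in> {?t<..yb j}"
        then have lc: "locally_const I Q (ab j, b)" using Q(1)[OF A_free] by auto
        have *: "\<exists>T. openin (top_of_set {?t<..yb j}) T \<and> b \<in> T \<and>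
            (\<forall>y\<in>T. \<forall>\<^sub>F z in near I (ab j, y). P z)" if P: "\<forall>\<^sub>F z in near I (ab j, b). P z" for P
        proof -
          obtain d where d: "d > 0" "\<forall>w'. dist w' (ab j, b) < d \<longrightarrow> eventually P (near I w')"
            using eventually_eventually_near[OF P] by blast
          have "dist (ab j, y) (ab j, b) < d" if "y \<in> ball b d" for y
            using dist_Pair_le[of "ab j" y "ab j" b] that by (auto simp: dist_real_def)
          then show ?thesis using d b
            by (intro exI[of _ "{?t<..yb j} \<inter> ball b d"]) (auto simp: openin_open_Int)
        qed
        consider "\<forall>\<^sub>F z in near I (ab j, b). z \<in> Q" | "\<forall>\<^sub>F z in near I (ab j, b). z \<notin> Q"
          using lc unfolding locally_const_def by blast
        then show "\<exists>T. openin (top_of_set {?t<..yb j}) T \<and> b \<in> T \<and> (\<forall>x\<in>T. \<forall>y\<in>T. ?P x \<longrightarrow> ?P y)"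
        proof cases
          case 1
          from *[OF 1] show ?thesis by blast
        next
          case 2
          from *[OF 2] obtain T where T: "openin (top_of_set {?t<..yb j}) T" "b \<in> T"
            "\<forall>y\<in>T. \<forall>\<^sub>F z in near I (ab j, y). z \<notin> Q" by blast
          have "\<not> ?P y" if "y \<in> T" for y
          proof -
            have "y \<in> {?t<..yb j}" using that T(1) openin_imp_subset by blast
            then have "(ab j, y) \<in> I" using colI by auto
            then show ?thesis using T(3) that eventually_near_at by blast
          qed
          then show ?thesis using T by blast
        qed
      qed (use a t Pa in auto)
    qed
    have near_s: "\<forall>\<^sub>F z in near I (ab j, yb j). (z \<in> R \<longleftrightarrow> ab j < fst z) \<and> ?t < snd z"
      using R_near[of "(ab j, yb j)"] near_snd_gt[of ?t "(ab j, yb j)" I] m t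
      by (simp add: eventually_conj_iff)
    have sI: "(ab j, yb j) \<in> I" using colI t by simp
    have t_m: "?t < m" using t m by simp
    have sides: "(\<forall>q\<in>hh k. fst w < q) \<and> fst w < ab j \<or> (\<forall>q\<in>hh k. q < fst w) \<and> ab j < fst w"
      if "fst w \<notin> hh k" for w :: point
      using that hh_between[OF k(1)] k(5) by (meson linorder_not_le order_less_imp_le)
    have level_lc: "locally_const I U w" if U: "?t < snd w \<Longrightarrow> locally_const I U w" "snd w = ?t \<Longrightarrow> \<forall>\<^sub>F z in near I w. z \<notin> U"
        "\<forall>z\<in>U. ?t < snd z" for U w
    proof (cases "?t < snd w")
      case False
      have "\<forall>\<^sub>F z in near I w. z \<notin> U"
      proof (cases "snd w = ?t")
        case False
        with \<open>\<not> ?t < snd w\<close> have "snd w < ?t" by simp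
        from near_snd_less[OF this, of I] show ?thesis by eventually_elim (use U(3) in auto)
      qed (rule U(2))
      then show ?thesis unfolding locally_const_def by blast
    qed (rule U(1))
    show ?thesis
    \<comment> \<open>In the first case the path continues to the left on \<open>k\<close>, and the
      enclosed region lies to the left of \<open>j\<close>; its complement then plays the role of
      the right side. In the second case the region lies to the right of \<open>j\<close>.\<close>
    proof (cases "ab j < xl k")
      case True
      obtain W where W: "left_cut k W"
        using left_cut_exists[OF k(1)] up_cut_exists by blast
      let ?U = "W - R"
      have "locally_const I ?U w" if w: "w \<in> ?E" for w
      proof (rule level_lc)
        assume ab: "?t < snd w"
        have "locally_const I W w" using W free[OF w] ab unfolding left_cut_def by blast
        moreover have "locally_const I R w"
          using R_lc[OF free[OF w]] below[OF w] ab by force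
        ultimately show "locally_const I ?U w" by (rule locally_const_Diff)
      next
        assume at: "snd w = ?t"
        show "\<forall>\<^sub>F z in near I w. z \<notin> ?U"
        proof (cases "ab j < fst w")
          case True
          then have "\<forall>\<^sub>F z in near I w. z \<in> R" using R_right[of w] at t_m by simp
          then show ?thesis by eventually_elim auto
        next
          case False
          then have "w \<noteq> (xl k, ?t)" using \<open>ab j < xl k\<close> by auto
          then have "w \<in> I" "fst w \<notin> hh k" using free_at_height[OF free[OF w] k(1) at] by auto
          then have "\<forall>\<^sub>F z in near I w. ?t < snd z \<longrightarrow> z \<notin> W"
            using left_cut_out[OF W at] sides[of w] False by blast
          then show ?thesis by eventually_elim (use W in \<open>auto simp: left_cut_def\<close>)
        qed
      qed (use W in \<open>auto simp: left_cut_def\<close>)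
      moreover have "(ab j, yb j) \<in> closure ((I - L) \<inter> - ?U) \<and> (ab j, yb j) \<in> closure ((I - L) \<inter> - (- ?U))"
      proof (rule vertical_jump[OF sI])
        have "\<forall>\<^sub>F z in near I (ab j, ?t). ?t < snd z \<longrightarrow> z \<in> W"
          using W k(6) unfolding left_cut_def inner_def by blast
        then have "\<forall>\<^sub>F z in near I (ab j, yb j). z \<in> W"
          using column[of W] W unfolding left_cut_def by blast
        then show "\<forall>\<^sub>F z in near I (ab j, yb j). fst z \<noteq> ab j \<longrightarrow> (z \<in> - ?U \<longleftrightarrow> ab j < fst z)"
          using near_s by eventually_elim auto
      qed
      ultimately show ?thesis by (metis double_compl)
    next
      case False
      then have xl: "xl k < ab j" using neqs[OF k(1) j] by auto
      obtain W where W: "right_cut k W"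
        using right_cut_exists[OF k(1)] up_cut_exists by blast
      \<comment> \<open>\<open>R\<close> extends below \<open>k\<close> and has to be cut off at its
        height; in the other case \<open>W\<close> already lies above \<open>k\<close>.\<close>
      let ?U = "(R \<inter> {z. ?t < snd z}) - W"
      have "locally_const I ?U w" if w: "w \<in> ?E" for w
      proof (rule level_lc)
        assume ab: "?t < snd w"
        have "locally_const I W w" using W free[OF w] ab unfolding right_cut_def by blast
        moreover have "locally_const I R w"
          using R_lc[OF free[OF w]] below[OF w] ab by force
        ultimately have "locally_const I (R - W) w" by (intro locally_const_Diff)
        moreover have "\<forall>\<^sub>F z in near I w. z \<in> ?U \<longleftrightarrow> z \<in> R - W"
          using near_snd_gt[OF ab, of I] by eventually_elim auto
        ultimately show "locally_const I ?U w" using locally_const_cong by blast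
      next
        assume at: "snd w = ?t"
        show "\<forall>\<^sub>F z in near I w. z \<notin> ?U"
        proof (cases "fst w < ab j")
          case True
          then have "\<forall>\<^sub>F z in near I w. z \<notin> R" using R_left[of w] at t_m by simp
          then show ?thesis by eventually_elim auto
        next
          case False
          then have "w \<noteq> (xl k, ?t)" using xl by auto
          then have "w \<in> I" "fst w \<notin> hh k" using free_at_height[OF free[OF w] k(1) at] by auto
          then have "\<forall>\<^sub>F z in near I w. ?t < snd z \<longrightarrow> z \<in> W"
            using right_cut_in[OF W at] sides[of w] False by blast
          then show ?thesis by eventually_elim auto
        qed
      qed auto
      moreover have "(ab j, yb j) \<in> closure ((I - L) \<inter> ?U) \<and> (ab j, yb j) \<in> closure ((I - L) \<inter> - ?U)"
      proof (rule vertical_jump[OF sI])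
        have "\<forall>\<^sub>F z in near I (ab j, ?t). ?t < snd z \<longrightarrow> z \<in> - W"
          using W k(6) unfolding right_cut_def inner_def by (simp add: Compl_iff)
        moreover have "locally_const I (- W) w" if "free w" "?t < snd w" for w
        proof -
          have "locally_const I W w" using W that unfolding right_cut_def by blast
          then show ?thesis unfolding locally_const_def by auto
        qed
        ultimately have "\<forall>\<^sub>F z in near I (ab j, yb j). z \<in> - W"
          using column[of "- W"] by blast
        then show "\<forall>\<^sub>F z in near I (ab j, yb j). fst z \<noteq> ab j \<longrightarrow> (z \<in> ?U \<longleftrightarrow> ab j < fst z)"
          using near_s by eventually_elim auto
      qed
      ultimately show ?thesis by blast
    qed
  qed
qed

text \<open>This is the acyclicity half: crossing \<open>L\<close> at all marked endpoints other
  than \<open>s\<close> still does not connect the two sides of \<open>s\<close>.\<close>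

theorem separating_set:
  assumes "s \<in> S"
  shows "\<exists>U. (\<forall>w \<in> (I - L) \<union> (S - {s}). locally_const_off I L U w) \<and>
    s \<in> closure ((I - L) \<inter> U) \<and> s \<in> closure ((I - L) \<inter> - U)"
proof -
  consider k where "k \<in> EH" "s = (xl k, ht k)" | j where "j \<in> EV" "s = (ab j, yb j)"
    using assms unfolding S_def by auto
  then show ?thesis
  proof cases
    case 1
    from horizontal_cut[OF 1(1)] obtain U where U: "\<And>w. free w \<and> w \<noteq> s \<Longrightarrow> locally_const I U w"
      "s \<in> closure ((I - L) \<inter> U)" "s \<in> closure ((I - L) \<inter> - U)" using 1(2) by auto
    have "s \<in> L" using 1 xl_hh unfolding L_def by auto
    then have "locally_const_off I L U w" if "w \<in> (I - L) \<union> (S - {s})" for w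
      using that U(1)[of w] free_off_L[of w] free_S[of w] locally_const_imp_off by blast
    then show ?thesis using U(2,3) by blast
  next
    case 2
    with vertical_cut[OF 2(1)] show ?thesis by (meson locally_const_imp_off)
  qed
qed

end

section \<open>Sets without jumps at the marked endpoints\<close>

lemma locally_const_offD:
  assumes "locally_const_off I L U w"
  shows "\<exists>e>0. \<forall>p\<in>I - L. \<forall>q\<in>I - L. dist p w < e \<longrightarrow> dist q w < e \<longrightarrow> (p \<in> U \<longleftrightarrow> q \<in> U)"
  using assms unfolding locally_const_off_def eventually_near by blast

lemma locally_const_off_connected:
  assumes "connected Q" "Q \<subseteq> I - L" "\<And>w. w \<in> Q \<Longrightarrow> locally_const_off I L U w" "p \<in> Q" "q \<in> Q"
  shows "p \<in> U \<longleftrightarrow> q \<in> U"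
proof (rule connected_induction_simple[OF assms(1,4,5), where P = "\<lambda>z. p \<in> U \<longleftrightarrow> z \<in> U"])
  fix a assume a: "a \<in> Q"
  then obtain e where e: "e > 0"
    "\<And>p q. p \<in> I - L \<Longrightarrow> q \<in> I - L \<Longrightarrow> dist p a < e \<Longrightarrow> dist q a < e \<Longrightarrow> p \<in> U \<longleftrightarrow> q \<in> U"
    using locally_const_offD[OF assms(3)] by blast
  show "\<exists>T. openin (top_of_set Q) T \<and> a \<in> T \<and> (\<forall>x\<in>T. \<forall>y\<in>T. (p \<in> U \<longleftrightarrow> x \<in> U) \<longrightarrow> (p \<in> U \<longleftrightarrow> y \<in> U))"
  proof (intro exI[of _ "Q \<inter> ball a e"] conjI ballI impI)
    fix x y assume "x \<in> Q \<inter> ball a e" "y \<in> Q \<inter> ball a e" "p \<in> U \<longleftrightarrow> x \<in> U"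
    then show "p \<in> U \<longleftrightarrow> y \<in> U" using e(2)[of x y] assms(2) by (auto simp: dist_commute)
  qed (use a e(1) in \<open>auto simp: openin_open_Int\<close>)
qed simp

context axis_arrangement
begin

lemma grid_box:
  assumes "(x, y) \<in> I"
  obtains e where "e > 0" "\<And>x' y'. \<bar>x' - x\<bar> < e \<Longrightarrow> \<bar>y' - y\<bar> < e \<Longrightarrow> (x', y') \<in> I"
    "\<And>j. j \<in> EV \<Longrightarrow> \<bar>ab j - x\<bar> < e \<Longrightarrow> ab j = x" "\<And>k. k \<in> EH \<Longrightarrow> \<bar>ht k - y\<bar> < e \<Longrightarrow> ht k = y"
proof -
  obtain r where r: "r > 0" "ball (x, y) r \<subseteq> I" using assms open_I open_contains_ball by metis
  obtain d1 where d1: "d1 > 0" "\<forall>a\<in>ab ` EV. a \<noteq> x \<longrightarrow> d1 \<le> dist x a"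
    using finite_set_avoid[of "ab ` EV" x] finite_EV by auto
  obtain d2 where d2: "d2 > 0" "\<forall>a\<in>ht ` EH. a \<noteq> y \<longrightarrow> d2 \<le> dist y a"
    using finite_set_avoid[of "ht ` EH" y] finite_EH by auto
  define e where "e = min (r/2) (min d1 d2)"
  have e: "e > 0" "e \<le> r/2" "e \<le> d1" "e \<le> d2" using r d1 d2 by (auto simp: e_def)
  show ?thesis
  proof (rule that[OF e(1)])
    fix x' y' assume "\<bar>x' - x\<bar> < e" "\<bar>y' - y\<bar> < e"
    then have "dist (x', y') (x, y) < r" using dist_Pair_le[of x' y' x y] e by linarith
    then show "(x', y') \<in> I" using r(2) by (auto simp: dist_commute subset_iff)
  next
    fix j assume "j \<in> EV" "\<bar>ab j - x\<bar> < e"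
    then show "ab j = x" using d1(2) e(3) by (force simp: dist_real_def)
  next
    fix k assume "k \<in> EH" "\<bar>ht k - y\<bar> < e"
    then show "ht k = y" using d2(2) e(4) by (force simp: dist_real_def)
  qed
qed

section \<open>Propagating the absence of jumps along extended segments\<close>

context
  fixes U :: "point set"
  assumes off: "\<And>w. w \<in> I - L \<Longrightarrow> locally_const_off I L U w"
begin

abbreviation good :: "point \<Rightarrow> bool" where
  "good \<equiv> locally_const_off I L U"

lemma good_open:
  assumes "good w"
  obtains e where "e > 0" "\<And>w'. dist w' w < e \<Longrightarrow> good w'"
proof -
  consider "\<forall>\<^sub>F z in near I w. z \<notin> L \<longrightarrow> z \<in> U" | "\<forall>\<^sub>F z in near I w. z \<notin> L \<longrightarrow> z \<notin> U"
    using assms unfolding locally_const_off_def by blast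
  then have "\<exists>e>0. \<forall>w'. dist w' w < e \<longrightarrow> good w'"
    by cases (use eventually_eventually_near locally_const_off_def in fast)+
  then show ?thesis using that by blast
qed

lemma const_on_connected:
  assumes "connected Q" "Q \<subseteq> I - L" "p \<in> Q" "q \<in> Q"
  shows "p \<in> U \<longleftrightarrow> q \<in> U"
  using locally_const_off_connected[OF assms(1,2) _ assms(3,4)] off assms(2) by blast

lemma good_joins:
  assumes "good w" "w \<in> closure Q" "w \<in> closure Q'" "connected Q" "connected Q'"
    "Q \<subseteq> I - L" "Q' \<subseteq> I - L" "p \<in> Q" "q \<in> Q'"
  shows "p \<in> U \<longleftrightarrow> q \<in> U"
proof -
  obtain e where e: "e > 0"
    "\<And>p q. p \<in> I - L \<Longrightarrow> q \<in> I - L \<Longrightarrow> dist p w < e \<Longrightarrow> dist q w < e \<Longrightarrow> p \<in> U \<longleftrightarrow> q \<in> U"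
    using locally_const_offD[OF assms(1)] by blast
  obtain p' where p': "p' \<in> Q" "dist p' w < e" using assms(2) e(1) by (meson closure_approachable)
  obtain q' where q': "q' \<in> Q'" "dist q' w < e" using assms(3) e(1) by (meson closure_approachable)
  have "p \<in> U \<longleftrightarrow> p' \<in> U" using const_on_connected assms p' by blast
  moreover have "q \<in> U \<longleftrightarrow> q' \<in> U" using const_on_connected assms q' by blast
  moreover have "p' \<in> U \<longleftrightarrow> q' \<in> U" using e(2) p' q' assms by blast
  ultimately show ?thesis by blast
qed

lemma good_closure:
  assumes "z \<in> I - L" "z \<in> closure Q" "connected Q" "Q \<subseteq> I - L" "p \<in> Q"
  shows "z \<in> U \<longleftrightarrow> p \<in> U"
  using good_joins[OF off[OF assms(1)], of "{z}" Q z p] assms by auto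

text \<open>Near \<^term>\<open>(x, y)\<close>, the set \<^term>\<open>L\<close> lies in the cross of the two axis-parallel lines through this
  point; crossing three of the four arms of the cross links all four quadrants.\<close>

lemma three_arms:
  assumes I: "(x, y) \<in> I"
    and arms: "up \<and> down \<and> (left \<or> right) \<or> left \<and> right \<and> (up \<or> down)"
    and up: "up \<Longrightarrow> \<forall>e>0. \<exists>d. 0 < d \<and> d < e \<and> good (x, y + d)"
    and down: "down \<Longrightarrow> \<forall>e>0. \<exists>d. 0 < d \<and> d < e \<and> good (x, y - d)"
    and right: "right \<Longrightarrow> \<forall>e>0. \<exists>d. 0 < d \<and> d < e \<and> good (x + d, y)"
    and left: "left \<Longrightarrow> \<forall>e>0. \<exists>d. 0 < d \<and> d < e \<and> good (x - d, y)"
  shows "good (x, y)"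
proof -
  obtain e where e: "e > 0" "\<And>x' y'. \<bar>x' - x\<bar> < e \<Longrightarrow> \<bar>y' - y\<bar> < e \<Longrightarrow> (x', y') \<in> I"
    "\<And>j. j \<in> EV \<Longrightarrow> \<bar>ab j - x\<bar> < e \<Longrightarrow> ab j = x" "\<And>k. k \<in> EH \<Longrightarrow> \<bar>ht k - y\<bar> < e \<Longrightarrow> ht k = y"
    using grid_box[OF I] by blast
  have offL: "(x', y') \<in> I - L" if "x' \<noteq> x" "y' \<noteq> y" "\<bar>x' - x\<bar> < e" "\<bar>y' - y\<bar> < e" for x' y'
    using that e(2)[of x' y'] e(3,4) unfolding L_def by auto
  let ?NE = "{x<..<x+e} \<times> {y<..<y+e}" and ?NW = "{x-e<..<x} \<times> {y<..<y+e}"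
  let ?SE = "{x<..<x+e} \<times> {y-e<..<y}" and ?SW = "{x-e<..<x} \<times> {y-e<..<y}"
  have conn: "connected ({a<..<b} \<times> {c<..<d})" for a b c d :: real
    by (intro convex_connected convex_Times) auto
  have sub: "?NE \<subseteq> I - L" "?NW \<subseteq> I - L" "?SE \<subseteq> I - L" "?SW \<subseteq> I - L"
    using offL by (auto simp: subset_iff)
  have cl: "closure ?NE = {x..x+e} \<times> {y..y+e}" "closure ?NW = {x-e..x} \<times> {y..y+e}"
    "closure ?SE = {x..x+e} \<times> {y-e..y}" "closure ?SW = {x-e..x} \<times> {y-e..y}"
    using e(1) by (simp_all add: closure_Times)
  let ?ne = "(x+e/2, y+e/2)" and ?nw = "(x-e/2, y+e/2)" and ?se = "(x+e/2, y-e/2)" and ?sw = "(x-e/2, y-e/2)"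
  have mem: "?ne \<in> ?NE" "?nw \<in> ?NW" "?se \<in> ?SE" "?sw \<in> ?SW" using e(1) by auto
  have "?ne \<in> U \<longleftrightarrow> ?nw \<in> U" if c: "up"
  proof -
    obtain d where d: "0 < d" "d < e" "good (x, y + d)" using up[OF c] e(1) by blast
    show ?thesis by (rule good_joins[OF d(3) _ _ conn conn sub(1,2) mem(1,2)]) (use d e cl in auto)
  qed
  moreover have "?se \<in> U \<longleftrightarrow> ?sw \<in> U" if c: "down"
  proof -
    obtain d where d: "0 < d" "d < e" "good (x, y - d)" using down[OF c] e(1) by blast
    show ?thesis by (rule good_joins[OF d(3) _ _ conn conn sub(3,4) mem(3,4)]) (use d e cl in auto)
  qed
  moreover have "?ne \<in> U \<longleftrightarrow> ?se \<in> U" if c: "right"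
  proof -
    obtain d where d: "0 < d" "d < e" "good (x + d, y)" using right[OF c] e(1) by blast
    show ?thesis by (rule good_joins[OF d(3) _ _ conn conn sub(1,3) mem(1,3)]) (use d e cl in auto)
  qed
  moreover have "?nw \<in> U \<longleftrightarrow> ?sw \<in> U" if c: "left"
  proof -
    obtain d where d: "0 < d" "d < e" "good (x - d, y)" using left[OF c] e(1) by blast
    show ?thesis by (rule good_joins[OF d(3) _ _ conn conn sub(2,4) mem(2,4)]) (use d e cl in auto)
  qed
  ultimately have eq: "?nw \<in> U \<longleftrightarrow> ?ne \<in> U" "?se \<in> U \<longleftrightarrow> ?ne \<in> U" "?sw \<in> U \<longleftrightarrow> ?ne \<in> U"
    using arms by blast+
  have agree: "z \<in> U \<longleftrightarrow> ?ne \<in> U" if z: "z \<in> I" "dist z (x, y) < e" "z \<notin> L" for z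
  proof -
    have "\<bar>fst z - x\<bar> < e" "\<bar>snd z - y\<bar> < e"
      using dist_fst_le[of z "(x, y)"] dist_snd_le[of z "(x, y)"] z(2) by (auto simp: dist_real_def)
    \<comment> \<open>A point off \<open>L\<close> may still lie on an axis of the cross, so closed
      quadrants are used and \<open>good_closure\<close> compares the point with an adjacent open
      one.\<close>
    then consider "z \<in> closure ?NE" | "z \<in> closure ?NW" | "z \<in> closure ?SE" | "z \<in> closure ?SW"
      unfolding cl by (cases z) fastforce
    then show ?thesis
    proof cases
      case 1 then show ?thesis using good_closure[OF _ 1 conn sub(1) mem(1)] z by blast
    next
      case 2 then show ?thesis using good_closure[OF _ 2 conn sub(2) mem(2)] z eq by blast
    next
      case 3 then show ?thesis using good_closure[OF _ 3 conn sub(3) mem(3)] z eq by blast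
    next
      case 4 then show ?thesis using good_closure[OF _ 4 conn sub(4) mem(4)] z eq by blast
    qed
  qed
  show ?thesis
  proof (cases "?ne \<in> U")
    case True
    then have "\<forall>\<^sub>F z in near I (x, y). z \<notin> L \<longrightarrow> z \<in> U"
      unfolding eventually_near using agree e(1) by blast
    then show ?thesis unfolding locally_const_off_def by blast
  next
    case False
    then have "\<forall>\<^sub>F z in near I (x, y). z \<notin> L \<longrightarrow> z \<notin> U"
      unfolding eventually_near using agree e(1) by blast
    then show ?thesis unfolding locally_const_off_def by blast
  qed
qed

text \<open>The good parameters form a relatively open and closed subset of \<open>Z\<close>:
  goodness is an open condition, and the contraposed \<open>step\<close> gives a bad parameter bad
  neighbours on both sides.\<close>

lemma line_induction:
  fixes f :: "real \<Rightarrow> point"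
  assumes Z: "is_interval Z" "a \<in> Z" "b \<in> Z" "good (f a)"
    and f: "\<And>s t. dist (f s) (f t) = \<bar>s - t\<bar>"
    and step: "\<And>t. t \<in> Z \<Longrightarrow> (\<forall>e>0. \<exists>d. 0 < d \<and> d < e \<and> good (f (t + d))) \<or>
      (\<forall>e>0. \<exists>d. 0 < d \<and> d < e \<and> good (f (t - d))) \<Longrightarrow> good (f t)"
  shows "good (f b)"
proof (rule connected_induction_simple[of Z a b "\<lambda>t. good (f t)"])
  show "connected Z" using Z(1) by (simp add: is_interval_connected)
  fix t assume t: "t \<in> Z"
  show "\<exists>T. openin (top_of_set Z) T \<and> t \<in> T \<and> (\<forall>x\<in>T. \<forall>y\<in>T. good (f x) \<longrightarrow> good (f y))"
  proof (cases "good (f t)")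
    case True
    then obtain e where e: "e > 0" "\<And>w'. dist w' (f t) < e \<Longrightarrow> good w'" using good_open by blast
    have "good (f y)" if "y \<in> Z \<inter> ball t e" for y
      using that e(2)[of "f y"] f[of y t] by (auto simp: dist_real_def abs_minus_commute)
    then show ?thesis using t e(1) by (intro exI[of _ "Z \<inter> ball t e"]) (auto simp: openin_open_Int)
  next
    case False
    then obtain e1 e2 where e: "e1 > 0" "e2 > 0" "\<And>d. 0 < d \<Longrightarrow> d < e1 \<Longrightarrow> \<not> good (f (t + d))"
      "\<And>d. 0 < d \<Longrightarrow> d < e2 \<Longrightarrow> \<not> good (f (t - d))" using step[OF t] by blast
    have "\<not> good (f y)" if "y \<in> ball t (min e1 e2)" for y
      using that e(3)[of "y - t"] e(4)[of "t - y"] False by (cases y t rule: linorder_cases) (auto simp: dist_real_def)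
    then show ?thesis using t e(1,2)
      by (intro exI[of _ "Z \<inter> ball t (min e1 e2)"]) (auto simp: openin_open_Int)
  qed
qed (use Z in auto)

text \<open>The ends of \<open>k\<close> are left out: an end inside \<open>I\<close> lies on a
  vertical segment and is treated with that column.\<close>

definition horizontal_good :: "'i \<Rightarrow> bool" where
  "horizontal_good k \<longleftrightarrow> (\<forall>x. inner (hh k) x \<and> (x, ht k) \<in> I \<longrightarrow> good (x, ht k))"

text \<open>A horizontal that touches \<open>j\<close> at this height ends there, so nearby points
  on the side selected by \<open>\<sigma>\<close> are either inner points of it, hence good, or off
  \<open>L\<close>.\<close>

lemma side_arm:
  assumes j: "j \<in> EV" and I: "(ab j, y) \<in> I"
    and touch: "\<And>k. k \<in> EH \<Longrightarrow> ht k = y \<Longrightarrow> ab j \<in> hh k \<Longrightarrow> \<not> inner (hh k) (ab j) \<and> horizontal_good k"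
    and \<sigma>: "\<sigma> = 1 \<or> \<sigma> = -1" and e: "e > 0"
  shows "\<exists>d. 0 < d \<and> d < e \<and> good (ab j + \<sigma> * d, y)"
proof -
  obtain r where r: "r > 0" "\<And>x' y'. \<bar>x' - ab j\<bar> < r \<Longrightarrow> \<bar>y' - y\<bar> < r \<Longrightarrow> (x', y') \<in> I"
    "\<And>i. i \<in> EV \<Longrightarrow> \<bar>ab i - ab j\<bar> < r \<Longrightarrow> ab i = ab j" "\<And>k. k \<in> EH \<Longrightarrow> \<bar>ht k - y\<bar> < r \<Longrightarrow> ht k = y"
    using grid_box[OF I] by blast
  have inI: "(ab j + \<sigma> * d, y) \<in> I" if "0 < d" "d < r" for d
    using r(1,2) \<sigma> that by auto
  have offL: "good (ab j + \<sigma> * d, y)"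
    if d: "0 < d" "d < r" "\<And>k. k \<in> EH \<Longrightarrow> ht k = y \<Longrightarrow> ab j + \<sigma> * d \<notin> hh k" for d
  proof -
    have "ab i \<noteq> ab j + \<sigma> * d" if "i \<in> EV" for i
      using r(3)[OF that] d \<sigma> by auto
    then have "(ab j + \<sigma> * d, y) \<notin> L" using d(3) unfolding L_def by fastforce
    then show ?thesis using off inI[OF d(1,2)] by blast
  qed
  show ?thesis
  proof (cases "\<exists>k\<in>EH. ht k = y")
    case False
    then show ?thesis using offL[of "min e r / 2"] e r(1) by (intro exI[of _ "min e r / 2"]) auto
  next
    case True
    then obtain k where k: "k \<in> EH" "ht k = y" by blast
    then have uniq: "k' = k" if "k' \<in> EH" "ht k' = y" for k' using that inj_ht by (auto dest: inj_onD)
    show ?thesis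
    proof (cases "ab j \<in> hh k")
      case False
      then have "open (- hh k)" "ab j \<in> - hh k" using closed_hh k by auto
      then obtain s where s: "s > 0" "ball (ab j) s \<subseteq> - hh k" by (meson openE)
      define d where "d = min e (min r s) / 2"
      have d: "0 < d" "d < e" "d < r" "d < s" using e r(1) s(1) by (auto simp: d_def)
      have "ab j + \<sigma> * d \<in> ball (ab j) s" using d \<sigma> by (auto simp: dist_real_def)
      then show ?thesis using offL[of d] d uniq s(2) by (intro exI[of _ d]) blast
    next
      case True
      then have t: "\<not> inner (hh k) (ab j)" "horizontal_good k" using touch k by auto
      show ?thesis
      proof (cases "\<exists>c>0. ab j + \<sigma> * c \<in> hh k")
        case True
        then obtain c where c: "c > 0" "ab j + \<sigma> * c \<in> hh k" by blast
        define d where "d = min e (min r c) / 2"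
        have d: "0 < d" "d < e" "d < r" "d < c" using e r(1) c(1) by (auto simp: d_def)
        have "inner (hh k) (ab j + \<sigma> * d)"
        proof (cases "\<sigma> = 1")
          case True
          then have "ab j < ab j + \<sigma> * d" "ab j + \<sigma> * d < ab j + \<sigma> * c" using d by auto
          then show ?thesis unfolding inner_def using \<open>ab j \<in> hh k\<close> c(2) by blast
        next
          case False
          then have "ab j + \<sigma> * d < ab j" "ab j + \<sigma> * c < ab j + \<sigma> * d" using d \<sigma> by auto
          then show ?thesis unfolding inner_def using \<open>ab j \<in> hh k\<close> c(2) by blast
        qed
        then have "good (ab j + \<sigma> * d, y)"
          using t(2) inI[OF d(1,3)] k(2) unfolding horizontal_good_def by simp
        then show ?thesis using d by blast
      next
        case False
        define d where "d = min e r / 2"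
        have d: "0 < d" "d < e" "d < r" using e r(1) by (auto simp: d_def)
        have "good (ab j + \<sigma> * d, y)"
          using offL[OF d(1,3)] uniq False d(1) by blast
        then show ?thesis using d by blast
      qed
    qed
  qed
qed

text \<open>Both side arms are available at every point of the column, so good points accumulating
  from above or from below supply the third arm.\<close>

lemma column_good:
  assumes j: "j \<in> EV" and Z: "is_interval Z" "\<And>y. y \<in> Z \<Longrightarrow> (ab j, y) \<in> I"
    and touch: "\<And>k. k \<in> EH \<Longrightarrow> ht k \<in> Z \<Longrightarrow> ab j \<in> hh k \<Longrightarrow> \<not> inner (hh k) (ab j) \<and> horizontal_good k"
    and start: "a \<in> Z" "good (ab j, a)" and y: "y \<in> Z"
  shows "good (ab j, y)"
proof (rule line_induction[of Z a y "\<lambda>t. (ab j, t)"])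
  show "dist (ab j, s) (ab j, t) = \<bar>s - t\<bar>" for s t by (simp add: dist_Pair_Pair dist_real_def)
  fix t assume t: "t \<in> Z" and *: "(\<forall>e>0. \<exists>d. 0 < d \<and> d < e \<and> good (ab j, t + d)) \<or>
      (\<forall>e>0. \<exists>d. 0 < d \<and> d < e \<and> good (ab j, t - d))"
  have arm: "\<exists>d. 0 < d \<and> d < e \<and> good (ab j + \<sigma> * d, t)" if "\<sigma> = 1 \<or> \<sigma> = -1" "e > 0" for \<sigma> e
    using side_arm[OF j Z(2)[OF t] _ that] touch t by blast
  show "good (ab j, t)"
    by (rule three_arms[OF Z(2)[OF t], of "\<forall>e>0. \<exists>d. 0 < d \<and> d < e \<and> good (ab j, t + d)"
        "\<forall>e>0. \<exists>d. 0 < d \<and> d < e \<and> good (ab j, t - d)" True True])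
      (use * arm[of 1] arm[of "-1"] in auto)
qed (use Z start y in auto)

context
  assumes good_S: "\<And>s. s \<in> S \<Longrightarrow> good s"
begin

text \<open>By \<open>crossing_low\<close>, a horizontal met on the way down from
  \<open>yb j\<close> can only be at height \<open>y\<close> itself, where the last hypothesis
  covers it.\<close>

lemma lower_ray_good:
  assumes j: "j \<in> EV" "y \<in> vv j" "(ab j, y) \<in> I" "y \<le> yb j"
    "\<And>k. k \<in> EH \<Longrightarrow> ht k = y \<Longrightarrow> ab j \<in> hh k \<Longrightarrow> \<not> inner (hh k) (ab j) \<and> horizontal_good k"
  shows "good (ab j, y)"
proof -
  have "(ab j, (yb j + yt j) / 2) \<in> I" using vseg_I[OF j(1)] yb_less_yt[OF j(1)] by simp
  then have I: "(ab j, t) \<in> I" if "t \<in> {y..yb j}" for t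
    using I_between_v[OF j(3), of "(yb j + yt j) / 2" t] that yb_less_yt[OF j(1)] by auto
  show ?thesis
  proof (rule column_good[OF j(1), of "{y..yb j}" "yb j" y])
    fix k assume k: "k \<in> EH" "ht k \<in> {y..yb j}" "ab j \<in> hh k"
    then have "ht k \<in> vv j" using vv_between[OF j(1,2) yb_vv[OF j(1)]] by auto
    then have "ht k \<le> y" using crossing_low[OF k(1) j(1) k(3) _ _ j(2)] k(2) neqs[OF k(1) j(1)] by force
    then show "\<not> inner (hh k) (ab j) \<and> horizontal_good k" using k j(5)[OF k(1)] by auto
  next
    show "good (ab j, yb j)" using good_S j unfolding S_def by auto
  qed (use I j in \<open>auto simp: is_interval_cc\<close>)
qed

text \<open>Horizontals met below \<open>yt j\<close> end on the segment by
  \<open>crossing_mid\<close>; one met above \<open>yt j\<close> is the top of the extension by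
  \<open>crossing_high\<close>, so it can only be at height \<open>y\<close>. The bound
  \<open>Y\<close> limits which horizontals must already be known to be good, as the induction over
  heights demands.\<close>

lemma upper_column_good:
  assumes j: "j \<in> EV" "y \<in> vv j" "(ab j, y) \<in> I" "yb j < y" "y < Y"
    and H: "\<And>k. k \<in> EH \<Longrightarrow> ht k < Y \<Longrightarrow> horizontal_good k"
    and not_inner: "\<And>k. k \<in> EH \<Longrightarrow> ht k = y \<Longrightarrow> ab j \<in> hh k \<Longrightarrow> \<not> inner (hh k) (ab j)"
  shows "good (ab j, y)"
proof -
  have "good (ab j, yb j)" using good_S j unfolding S_def by auto
  then obtain e where e: "e > 0" "\<And>w'. dist w' (ab j, yb j) < e \<Longrightarrow> good w'" using good_open by blast
  \<comment> \<open>A starting point that is good by openness and lies in \<open>I\<close>; the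
    marked endpoint need not lie in \<open>I\<close>.\<close>
  define a where "a = min (yb j + e/2) (min y ((yb j + yt j)/2))"
  have a: "yb j < a" "a \<le> y" "a < yt j" "a < yb j + e" using e(1) j yb_less_yt[OF j(1)] by (auto simp: a_def min_def)
  have aI: "(ab j, a) \<in> I" using vseg_I[OF j(1)] a by auto
  show ?thesis
  proof (rule column_good[OF j(1), of "{a..y}" a y])
    show "(ab j, t) \<in> I" if "t \<in> {a..y}" for t using I_between_v[OF aI j(3)] that by auto
  next
    fix k assume k: "k \<in> EH" "ht k \<in> {a..y}" "ab j \<in> hh k"
    have v: "ht k \<in> vv j" using vv_between[OF j(1) yb_vv[OF j(1)] j(2)] a k by auto
    have "\<not> inner (hh k) (ab j)"
    proof (cases "ht k < yt j")
      case True
      then show ?thesis using crossing_mid[OF k(1) j(1) k(3)] k a by auto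
    next
      case False
      then have "y \<le> ht k" using crossing_high[OF k(1) j(1) k(3) v _ j(2)] neqs[OF k(1) j(1)] by force
      then show ?thesis using k not_inner[OF k(1)] by auto
    qed
    then show "\<not> inner (hh k) (ab j) \<and> horizontal_good k" using H k j by auto
  next
    show "good (ab j, a)" using e(2)[of "(ab j, a)"] a by (simp add: dist_Pair_Pair dist_real_def)
  qed (use a in \<open>auto simp: is_interval_cc\<close>)
qed

text \<open>Upstream of inner points of \<open>k\<close> there are only vertical pieces that end on
  \<open>k\<close>: lower rays, which nothing touches before their end, and upper columns, touched
  only by horizontals of smaller height. So both vertical arms are good at every inner point, and
  goodness spreads along \<open>k\<close> from its marked endpoint.\<close>

lemma horizontals_good:
  assumes "k \<in> EH"
  shows "horizontal_good k"
  using assms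
proof (induction "card {k'\<in>EH. ht k' < ht k}" arbitrary: k rule: less_induct)
  case less
  note k = less.prems
  have IH: "horizontal_good k'" if "k' \<in> EH" "ht k' < ht k" for k'
    using that finite_EH by (intro less.hyps psubset_card_mono) auto
  define Z where "Z = {x. inner (hh k) x \<and> (x, ht k) \<in> I}"
  have arms: "\<exists>d. 0 < d \<and> d < e \<and> good (x, ht k + \<sigma> * d)"
    if x: "x \<in> Z" and \<sigma>: "\<sigma> = 1 \<or> \<sigma> = -1" and e: "e > 0" for x \<sigma> e
  proof -
    have xI: "(x, ht k) \<in> I" using x by (auto simp: Z_def)
    obtain a b where "a \<in> hh k" "b \<in> hh k" "a < x" "x < b" using x unfolding Z_def inner_def by blast
    then have xh: "x \<in> hh k" using hh_between[OF k, of a b x] by simp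
    obtain r where r: "r > 0" "\<And>x' y'. \<bar>x' - x\<bar> < r \<Longrightarrow> \<bar>y' - ht k\<bar> < r \<Longrightarrow> (x', y') \<in> I"
      "\<And>i. i \<in> EV \<Longrightarrow> \<bar>ab i - x\<bar> < r \<Longrightarrow> ab i = x" "\<And>k'. k' \<in> EH \<Longrightarrow> \<bar>ht k' - ht k\<bar> < r \<Longrightarrow> ht k' = ht k"
      using grid_box[OF xI] by blast
    have inI: "(x, ht k + \<sigma> * d) \<in> I" if "0 < d" "d < r" for d
      using r(1,2) \<sigma> that by auto
    have ht: "ht k' \<noteq> ht k + \<sigma> * d" if "k' \<in> EH" "0 < d" "d < r" for k' d
      using r(4)[OF that(1)] that \<sigma> by auto
    have offL: "good (x, ht k + \<sigma> * d)"
      if d: "0 < d" "d < r" "\<And>j. j \<in> EV \<Longrightarrow> ab j = x \<Longrightarrow> ht k + \<sigma> * d \<notin> vv j" for d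
    proof -
      have "(x, ht k + \<sigma> * d) \<notin> L" using d(3) ht[OF _ d(1,2)] unfolding L_def by fastforce
      then show ?thesis using off inI[OF d(1,2)] by blast
    qed
    show ?thesis
    proof (cases "\<exists>j\<in>EV. ab j = x")
      case False
      then show ?thesis using offL[of "min e r / 2"] e r(1) by (intro exI[of _ "min e r / 2"]) auto
    next
      case True
      then obtain j where j: "j \<in> EV" "ab j = x" by blast
      then have uniq: "j' = j" if "j' \<in> EV" "ab j' = x" for j' using that inj_ab by (auto dest: inj_onD)
      show ?thesis
      proof (cases "ht k \<in> vv j")
        case False
        then have "open (- vv j)" "ht k \<in> - vv j" using closed_vv j by auto
        then obtain s where s: "s > 0" "ball (ht k) s \<subseteq> - vv j" by (meson openE)
        define d where "d = min e (min r s) / 2"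
        have d: "0 < d" "d < e" "d < r" "d < s" using e r(1) s(1) by (auto simp: d_def)
        have "ht k + \<sigma> * d \<in> ball (ht k) s" using d \<sigma> by (auto simp: dist_real_def)
        then show ?thesis using offL[of d] d uniq s(2) by (intro exI[of _ d]) blast
      next
        case True
        \<comment> \<open>At an inner point of \<open>k\<close> the vertical is met on its extension
          and ends there. One arm runs along that extension, the opposite one is off
          \<open>L\<close>.\<close>
        have "\<not> (yb j < ht k \<and> ht k < yt j)"
          using crossing_mid[OF k j(1)] x xh j(2) by (auto simp: Z_def)
        then consider "ht k < yb j" | "yt j < ht k" using neqs[OF k j(1)] by linarith
        then show ?thesis
        proof cases
          case 1
          define d where "d = min e (min r (yb j - ht k)) / 2"
          have d: "0 < d" "d < e" "d < r" "d < yb j - ht k" using e r(1) 1 by (auto simp: d_def)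
          show ?thesis
          proof (cases "\<sigma> = 1")
            case True
            have "ht k + d \<in> vv j"
              using vv_between[OF j(1) \<open>ht k \<in> vv j\<close> yb_vv[OF j(1)]] d by auto
            moreover have "ht k' \<noteq> ht k + d" if "k' \<in> EH" for k' using ht[OF that d(1,3)] True by simp
            ultimately have "good (ab j, ht k + d)"
              using lower_ray_good[OF j(1), of "ht k + d"] inI[OF d(1,3)] d(4) True j(2) by auto
            then show ?thesis using d True j(2) by auto
          next
            case False
            then have "ht k + \<sigma> * d < ht k" using \<sigma> d(1) by auto
            then have "ht k + \<sigma> * d \<notin> vv j"
              using crossing_low[OF k j(1) _ \<open>ht k \<in> vv j\<close> 1, of "ht k + \<sigma> * d"] xh j(2) by (auto simp: not_le[symmetric])
            then show ?thesis using offL[of d] d uniq by blast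
          qed
        next
          case 2
          define d where "d = min e (min r (ht k - yt j)) / 2"
          have d: "0 < d" "d < e" "d < r" "d < ht k - yt j" using e r(1) 2 by (auto simp: d_def)
          show ?thesis
          proof (cases "\<sigma> = 1")
            case False
            then have \<sigma>: "\<sigma> = -1" using \<sigma> by simp
            have "ht k - d \<in> vv j"
              using vv_between[OF j(1) yt_vv[OF j(1)] \<open>ht k \<in> vv j\<close>] d by auto
            moreover have "ht k' \<noteq> ht k - d" if "k' \<in> EH" for k' using ht[OF that d(1,3)] \<sigma> by simp
            moreover have "yb j < ht k - d" using yb_less_yt[OF j(1)] d(4) by linarith
            ultimately have "good (ab j, ht k - d)"
              using upper_column_good[OF j(1), of "ht k - d" "ht k"] IH inI[OF d(1,3)] d(1) \<sigma> j(2) by auto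
            then show ?thesis using d \<sigma> j(2) by auto
          next
            case True
            then have "ht k < ht k + \<sigma> * d" using d(1) by auto
            then have "ht k + \<sigma> * d \<notin> vv j"
              using crossing_high[OF k j(1) _ \<open>ht k \<in> vv j\<close> 2, of "ht k + \<sigma> * d"] xh j(2) by (auto simp: not_le[symmetric])
            then show ?thesis using offL[of d] d uniq by blast
          qed
        qed
      qed
    qed
  qed
  have "good (xl k, ht k)" using good_S k unfolding S_def by auto
  then obtain e where e: "e > 0" "\<And>w'. dist w' (xl k, ht k) < e \<Longrightarrow> good w'" using good_open by blast
  define a where "a = min (xl k + e/2) ((xl k + xr k)/2)"
  have a: "xl k < a" "a < xr k" "a < xl k + e" using e(1) xl_less_xr[OF k] by (auto simp: a_def min_def)
  have aZ: "a \<in> Z" unfolding Z_def inner_def using hseg_I[OF k] a xl_hh[OF k] xr_hh[OF k] by blast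
  have "good (x, ht k)" if x: "x \<in> Z" for x
  proof (rule line_induction[of Z a x "\<lambda>t. (t, ht k)"])
    show "is_interval Z" unfolding is_interval_1 Z_def inner_def
      using I_between_h by (auto intro: order_less_le_trans order_le_less_trans)
    show "dist (s, ht k) (t, ht k) = \<bar>s - t\<bar>" for s t by (simp add: dist_Pair_Pair dist_real_def)
    show "good (a, ht k)" using e(2)[of "(a, ht k)"] a by (simp add: dist_Pair_Pair dist_real_def)
    fix t assume t: "t \<in> Z" and *: "(\<forall>e>0. \<exists>d. 0 < d \<and> d < e \<and> good (t + d, ht k)) \<or>
      (\<forall>e>0. \<exists>d. 0 < d \<and> d < e \<and> good (t - d, ht k))"
    have tI: "(t, ht k) \<in> I" using t by (auto simp: Z_def)
    show "good (t, ht k)"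
      by (rule three_arms[OF tI, of True True "\<forall>e>0. \<exists>d. 0 < d \<and> d < e \<and> good (t - d, ht k)"
          "\<forall>e>0. \<exists>d. 0 < d \<and> d < e \<and> good (t + d, ht k)"])
        (use * arms[OF t, of 1] arms[OF t, of "-1"] in auto)
  qed (use aZ x in auto)
  then show ?case unfolding horizontal_good_def Z_def by blast
qed

lemma columns_good:
  assumes j: "j \<in> EV" "y \<in> vv j" "(ab j, y) \<in> I"
  shows "good (ab j, y)"
proof (cases "\<exists>k\<in>EH. ht k = y \<and> inner (hh k) (ab j)")
  case True
  then show ?thesis using horizontals_good j unfolding horizontal_good_def by blast
next
  case False
  show ?thesis
  proof (cases "yb j < y")
    case True
    show ?thesis
      by (rule upper_column_good[OF j True, of "y + 1"]) (use horizontals_good False in auto)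
  next
    case False
    then show ?thesis
      using lower_ray_good[OF j] horizontals_good \<open>\<not> (\<exists>k\<in>EH. ht k = y \<and> inner (hh k) (ab j))\<close> by auto
  qed
qed

text \<open>Beyond columns and inner points of horizontals only ends of horizontals remain; an end
  inside \<open>I\<close> was stopped by a vertical segment and so belongs to a column.\<close>

lemma all_good:
  assumes "w \<in> I"
  shows "good w"
proof (cases "w \<in> L")
  case False
  then show ?thesis using off assms by blast
next
  case True
  then consider k x where "k \<in> EH" "x \<in> hh k" "w = (x, ht k)" | j y where "j \<in> EV" "y \<in> vv j" "w = (ab j, y)"
    unfolding L_def by auto
  then show ?thesis
  proof cases
    case 2
    then show ?thesis using columns_good assms by blast
  next
    case 1
    show ?thesis
    proof (cases "inner (hh k) x")
      case True
      then show ?thesis using horizontals_good 1 assms unfolding horizontal_good_def by blast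
    next
      case False
      obtain r where r: "r > 0" "\<And>x' y'. \<bar>x' - x\<bar> < r \<Longrightarrow> \<bar>y' - ht k\<bar> < r \<Longrightarrow> (x', y') \<in> I"
        using grid_box[of x "ht k"] assms 1 by metis
      have "\<exists>j\<in>EV. ab j = x \<and> yb j < ht k \<and> ht k < yt j"
      proof (cases "\<exists>a\<in>hh k. a < x")
        case True
        then have max: "\<forall>b\<in>hh k. b \<le> x" using False unfolding inner_def by force
        have "x + r/2 \<notin> hh k" using max r(1) by force
        moreover have "(x + r/2, ht k) \<in> I" "xr k < x + r/2"
          using r max xr_hh[OF 1(1)] by force+
        ultimately show ?thesis using right_end[OF 1(1)] max 1(2) by force
      next
        case nl: False
        then have min: "\<forall>b\<in>hh k. x \<le> b" by force
        have "x - r/2 \<notin> hh k" using min r(1) by force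
        moreover have "(x - r/2, ht k) \<in> I" "x - r/2 < xl k"
          using r min xl_hh[OF 1(1)] by force+
        ultimately show ?thesis using left_end[OF 1(1)] min 1(2) by force
      qed
      then obtain j where j: "j \<in> EV" "ab j = x" "yb j < ht k" "ht k < yt j" by blast
      then have "ht k \<in> vv j" using vv_between[OF j(1) yb_vv[OF j(1)] yt_vv[OF j(1)]] by auto
      then show ?thesis using columns_good[OF j(1)] j 1 assms by auto
    qed
  qed
qed

end

end

theorem locally_const_imp_trivial:
  assumes U: "\<And>w. w \<in> (I - L) \<union> S \<Longrightarrow> locally_const_off I L U w"
    and pq: "p \<in> I - L" "q \<in> I - L"
  shows "p \<in> U \<longleftrightarrow> q \<in> U"
proof -
  have good: "locally_const_off I L U w" if "w \<in> I" for w
    using all_good[of U w] U that by blast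
  \<comment> \<open>\<open>I - L\<close> is disconnected, so the value of \<open>U\<close> off
    \<open>L\<close> near a point is propagated through the connected set \<open>I\<close>, across
    points of \<open>L\<close> as well.\<close>
  let ?P = "\<lambda>w. \<forall>\<^sub>F z in near I w. z \<notin> L \<longrightarrow> (z \<in> U \<longleftrightarrow> p \<in> U)"
  have "?P q"
  proof (rule connected_induction_simple[of I p q ?P])
    show "connected I" using convex_I by (rule convex_connected)
    show "?P p" using good[of p] pq(1) unfolding locally_const_off_def eventually_near
      by (metis DiffE dist_self)
    fix a assume a: "a \<in> I"
    obtain e where e: "e > 0" "\<And>x y. x \<in> I - L \<Longrightarrow> y \<in> I - L \<Longrightarrow> dist x a < e \<Longrightarrow> dist y a < e \<Longrightarrow> x \<in> U \<longleftrightarrow> y \<in> U"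
      using locally_const_offD[OF good[OF a]] by blast
    show "\<exists>T. openin (top_of_set I) T \<and> a \<in> T \<and> (\<forall>x\<in>T. \<forall>y\<in>T. ?P x \<longrightarrow> ?P y)"
    proof (intro exI[of _ "I \<inter> ball a e"] conjI ballI impI)
      fix x y assume x: "x \<in> I \<inter> ball a e" and y: "y \<in> I \<inter> ball a e" and P: "?P x"
      obtain d where d: "d > 0" "\<forall>z\<in>I. dist z x < d \<longrightarrow> z \<notin> L \<longrightarrow> (z \<in> U \<longleftrightarrow> p \<in> U)"
        using P by (auto simp: eventually_near)
      have "open (ball x d \<inter> ball a e)" by auto
      moreover have "x \<in> (ball x d \<inter> ball a e) \<inter> I" using x d(1) by auto
      ultimately obtain u v where uv: "(u, v) \<in> ball x d \<inter> ball a e" "(u, v) \<in> I" "u \<notin> ab ` EV" "v \<notin> ht ` EH"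
        using off_L_dense by blast
      then have u: "(u, v) \<in> I - L" "(u, v) \<in> U \<longleftrightarrow> p \<in> U"
        using off_grid_off_L d(2) by (auto simp: dist_commute)
      have "\<forall>\<^sub>F z in near I y. z \<in> ball a e" using eventually_near_open[of "ball a e" y I] y by blast
      moreover have "\<forall>\<^sub>F z in near I y. z \<in> I" by (auto simp: near_def eventually_inf_principal)
      ultimately show "?P y"
        by eventually_elim (use e(2)[OF _ u(1)] u(2) uv(1) in \<open>auto simp: dist_commute\<close>)
    qed (use a e(1) in \<open>auto simp: openin_open_Int\<close>)
  qed (use pq in auto)
  then show ?thesis using eventually_near_at pq(2) by blast
qed

end

section \<open>Trees in topological terms\<close>

text \<open>Expresses that the dual edges \<^term>\<open>S\<close> form a spanning tree of the components of
  \<^term>\<open>I - L\<close>: an edge joins at most two components, a set of components closed under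
  adjacency is trivial, and removing an edge disconnects its two components.\<close>

definition tree_like :: "point set \<Rightarrow> point set \<Rightarrow> point set \<Rightarrow> bool" where
  "tree_like I L S \<longleftrightarrow>
     (\<forall>s\<in>S. \<exists>e>0. \<exists>N N'. connected N \<and> connected N' \<and> N \<union> N' \<subseteq> I - L \<and>
        (\<forall>z\<in>I - L. dist z s < e \<longrightarrow> z \<in> N \<union> N')) \<and>
     (\<forall>U. (\<forall>w \<in> (I - L) \<union> S. locally_const_off I L U w) \<longrightarrow>
        (\<forall>p\<in>I - L. \<forall>q\<in>I - L. p \<in> U \<longleftrightarrow> q \<in> U)) \<and>
     (\<forall>s\<in>S. \<exists>U. (\<forall>w \<in> (I - L) \<union> (S - {s}). locally_const_off I L U w) \<and>
        s \<in> closure ((I - L) \<inter> U) \<and> s \<in> closure ((I - L) \<inter> - U))"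

lemma convex_fst_gt: "convex {z::point. c < fst z}"
  and convex_fst_less: "convex {z::point. fst z < c}"
  and convex_snd_gt: "convex {z::point. c < snd z}"
  and convex_snd_less: "convex {z::point. snd z < c}"
proof -
  have "{z::point. c < fst z} = {c<..} \<times> UNIV" "{z::point. fst z < c} = {..<c} \<times> UNIV"
    "{z::point. c < snd z} = UNIV \<times> {c<..}" "{z::point. snd z < c} = UNIV \<times> {..<c}" by auto
  then show "convex {z::point. c < fst z}" "convex {z::point. fst z < c}"
    "convex {z::point. c < snd z}" "convex {z::point. snd z < c}" by (auto intro!: convex_Times)
qed

section \<open>Local shape at marked endpoints and a finite cover by grid boxes\<close>

context axis_arrangement
begin

lemma S_subset_L: "S \<subseteq> L"
  unfolding S_def L_def using xl_hh yb_vv by auto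

text \<open>Near a marked endpoint, \<open>L\<close> agrees inside \<open>I\<close> with the full
  line through it: the endpoint is not where an obstacle inside the arrangement stopped the
  extension, and no perpendicular extended segment has a matching coordinate. The sides of a line in
  a convex set are convex.\<close>

lemma two_sides:
  assumes s: "s \<in> S"
  shows "\<exists>e>0. \<exists>N N'. connected N \<and> connected N' \<and> N \<union> N' \<subseteq> I - L \<and>
    (\<forall>z\<in>I - L. dist z s < e \<longrightarrow> z \<in> N \<union> N')"
proof -
  obtain d1 where d1: "d1 > 0" "\<forall>a\<in>ab ` EV. a \<noteq> fst s \<longrightarrow> d1 \<le> dist (fst s) a"
    using finite_set_avoid[of "ab ` EV" "fst s"] finite_EV by auto
  obtain d2 where d2: "d2 > 0" "\<forall>a\<in>ht ` EH. a \<noteq> snd s \<longrightarrow> d2 \<le> dist (snd s) a"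
    using finite_set_avoid[of "ht ` EH" "snd s"] finite_EH by auto
  have near: "\<bar>fst z - fst s\<bar> < e" "\<bar>snd z - snd s\<bar> < e" if "dist z s < e" for z e
    using dist_fst_le[of z s] dist_snd_le[of z s] that by (auto simp: dist_real_def)
  have sides: ?thesis
    if e: "e > 0" and L: "\<And>z. z \<in> I \<Longrightarrow> dist z s < e \<Longrightarrow> z \<in> L \<longleftrightarrow> f z = c"
      and conv: "convex {z. c < f z}" "convex {z. f z < c}" for e c and f :: "point \<Rightarrow> real"
  proof -
    let ?N = "I \<inter> ball s e \<inter> {z. c < f z}" and ?N' = "I \<inter> ball s e \<inter> {z. f z < c}"
    have "connected ?N" "connected ?N'"
      using conv by (auto intro!: convex_connected convex_Int convex_I)
    moreover have "?N \<union> ?N' \<subseteq> I - L" using L by (force simp: dist_commute)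
    moreover have "\<forall>z\<in>I - L. dist z s < e \<longrightarrow> z \<in> ?N \<union> ?N'" using L by (force simp: dist_commute)
    ultimately show ?thesis using e by blast
  qed
  consider k where "k \<in> EH" "s = (xl k, ht k)" | j where "j \<in> EV" "s = (ab j, yb j)"
    using s unfolding S_def by auto
  then show ?thesis
  proof cases
    case 1
    have "\<exists>d>0. \<forall>x. \<bar>x - xl k\<bar> < d \<longrightarrow> (x, ht k) \<in> I \<longrightarrow> x \<in> hh k"
    proof (cases "\<forall>x<xl k. (x, ht k) \<in> I \<longrightarrow> x \<in> hh k")
      case True
      then show ?thesis using hh_between[OF 1(1) xl_hh[OF 1(1)] xr_hh[OF 1(1)]] xl_less_xr[OF 1(1)]
        by (intro exI[of _ "xr k - xl k"]) (auto simp: abs_if split: if_splits)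
    next
      case False
      then obtain j where j: "j \<in> EV" "ab j \<in> hh k" "\<forall>x\<in>hh k. ab j \<le> x" using left_end[OF 1(1)] by blast
      then have "ab j < xl k" using xl_hh[OF 1(1)] neqs[OF 1(1) j(1)] by force
      then show ?thesis using hh_between[OF 1(1) j(2) xr_hh[OF 1(1)]] xl_less_xr[OF 1(1)]
        by (intro exI[of _ "min (xl k - ab j) (xr k - xl k)"]) (auto simp: abs_if split: if_splits)
    qed
    then obtain d where d: "d > 0" "\<And>x. \<bar>x - xl k\<bar> < d \<Longrightarrow> (x, ht k) \<in> I \<Longrightarrow> x \<in> hh k" by blast
    define e where "e = min d (min d1 d2)"
    have e: "e > 0" "e \<le> d" "e \<le> d1" "e \<le> d2" using d d1 d2 by (auto simp: e_def)
    have L: "z \<in> L \<longleftrightarrow> snd z = ht k" if z: "z \<in> I" "dist z s < e" for z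
    proof
      assume "snd z = ht k"
      then have "z \<in> hh k \<times> {ht k}" using d(2)[of "fst z"] near[OF z(2)] z(1) e 1(2) by (cases z) auto
      then show "z \<in> L" using 1(1) unfolding L_def by blast
    next
      assume "z \<in> L"
      then consider k' where "k' \<in> EH" "snd z = ht k'" | j where "j \<in> EV" "fst z = ab j" unfolding L_def by auto
      then show "snd z = ht k"
      proof cases
        case a: 1
        then show ?thesis using d2(2) near[OF z(2)] e 1(2) by (force simp: dist_real_def)
      next
        case a: 2
        then have "fst z \<noteq> fst s" using neqs[OF 1(1) a(1)] 1(2) by auto
        then show ?thesis using a d1(2) near[OF z(2)] e by (force simp: dist_real_def)
      qed
    qed
    show ?thesis by (rule sides[OF e(1) L]) (auto simp: convex_snd_gt convex_snd_less)
  next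
    case 2
    have "\<exists>d>0. \<forall>y. \<bar>y - yb j\<bar> < d \<longrightarrow> (ab j, y) \<in> I \<longrightarrow> y \<in> vv j"
    proof (cases "\<forall>y<yb j. (ab j, y) \<in> I \<longrightarrow> y \<in> vv j")
      case True
      then show ?thesis using vv_between[OF 2(1) yb_vv[OF 2(1)] yt_vv[OF 2(1)]] yb_less_yt[OF 2(1)]
        by (intro exI[of _ "yt j - yb j"]) (auto simp: abs_if split: if_splits)
    next
      case False
      then obtain k where k: "k \<in> EH" "ht k \<in> vv j" "\<forall>y\<in>vv j. ht k \<le> y" using bottom_end[OF 2(1)] by blast
      then have "ht k < yb j" using yb_vv[OF 2(1)] neqs[OF k(1) 2(1)] by force
      then show ?thesis using vv_between[OF 2(1) k(2) yt_vv[OF 2(1)]] yb_less_yt[OF 2(1)]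
        by (intro exI[of _ "min (yb j - ht k) (yt j - yb j)"]) (auto simp: abs_if split: if_splits)
    qed
    then obtain d where d: "d > 0" "\<And>y. \<bar>y - yb j\<bar> < d \<Longrightarrow> (ab j, y) \<in> I \<Longrightarrow> y \<in> vv j" by blast
    define e where "e = min d (min d1 d2)"
    have e: "e > 0" "e \<le> d" "e \<le> d1" "e \<le> d2" using d d1 d2 by (auto simp: e_def)
    have L: "z \<in> L \<longleftrightarrow> fst z = ab j" if z: "z \<in> I" "dist z s < e" for z
    proof
      assume "fst z = ab j"
      then have "z \<in> {ab j} \<times> vv j" using d(2)[of "snd z"] near[OF z(2)] z(1) e 2(2) by (cases z) auto
      then show "z \<in> L" using 2(1) unfolding L_def by blast
    next
      assume "z \<in> L"
      then consider k where "k \<in> EH" "snd z = ht k" | j' where "j' \<in> EV" "fst z = ab j'" unfolding L_def by auto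
      then show "fst z = ab j"
      proof cases
        case a: 2
        then show ?thesis using d1(2) near[OF z(2)] e 2(2) by (force simp: dist_real_def)
      next
        case a: 1
        then have "snd z \<noteq> snd s" using neqs[OF a(1) 2(1)] 2(2) by auto
        then show ?thesis using a d2(2) near[OF z(2)] e by (force simp: dist_real_def)
      qed
    qed
    show ?thesis by (rule sides[OF e(1) L]) (auto simp: convex_fst_gt convex_fst_less)
  qed
qed

text \<open>The sets are the open boxes of the grid formed by all full lines; \<open>a\<close> and
  \<open>b\<close> choose for each line the side on which the box lies. This later bounds the number
  of cells.\<close>

lemma finite_connected_cover:
  "\<exists>\<N>. finite \<N> \<and> (\<forall>N\<in>\<N>. connected N \<and> N \<subseteq> I - L) \<and> I \<subseteq> closure (\<Union>\<N>)"
proof -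
  define N where "N = (\<lambda>(a, b). I \<inter> (\<Inter>t\<in>ab ` EV. if t \<in> a then {z. t < fst z} else {z. fst z < t}) \<inter>
    (\<Inter>t\<in>ht ` EH. if t \<in> b then {z. t < snd z} else {z. snd z < t}))"
  let ?\<N> = "N ` (Pow (ab ` EV) \<times> Pow (ht ` EH))"
  have "connected (N p)" for p
    unfolding N_def case_prod_unfold
    by (intro convex_connected convex_Int convex_INT convex_I)
      (auto simp: convex_fst_gt convex_fst_less convex_snd_gt convex_snd_less)
  moreover have "z \<in> I - L" if "z \<in> N p" for z p
  proof -
    obtain a b where p: "p = (a, b)" by (cases p)
    have "fst z \<noteq> t" if "t \<in> ab ` EV" for t
    proof -
      have "z \<in> (if t \<in> a then {z. t < fst z} else {z. fst z < t})"
        using \<open>z \<in> N p\<close> that unfolding N_def p by blast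
      then show ?thesis by (auto split: if_splits)
    qed
    moreover have "snd z \<noteq> t" if "t \<in> ht ` EH" for t
    proof -
      have "z \<in> (if t \<in> b then {z. t < snd z} else {z. snd z < t})"
        using \<open>z \<in> N p\<close> that unfolding N_def p by blast
      then show ?thesis by (auto split: if_splits)
    qed
    ultimately have "z \<notin> L" using off_grid_off_L[of "fst z" "snd z"] by auto
    then show ?thesis using that unfolding N_def p by auto
  qed
  moreover have "I \<subseteq> closure (\<Union>?\<N>)"
  proof
    fix w assume w: "w \<in> I"
    show "w \<in> closure (\<Union>?\<N>)"
      unfolding closure_approachable
    proof (intro allI impI)
      fix e :: real assume e: "e > 0"
      then have "open (ball w e)" "w \<in> ball w e \<inter> I" using w by auto
      then obtain x y where xy: "(x, y) \<in> ball w e" "(x, y) \<in> I" "x \<notin> ab ` EV" "y \<notin> ht ` EH"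
        using off_L_dense[of "ball w e"] by blast
      define a b where "a = {t\<in>ab ` EV. t < x}" and "b = {t\<in>ht ` EH. t < y}"
      have "x < t" if "t \<in> ab ` EV" "t \<notin> a" for t
        using that xy(3) unfolding a_def by (metis (mono_tags, lifting) linorder_neqE_linordered_idom mem_Collect_eq)
      moreover have "y < t" if "t \<in> ht ` EH" "t \<notin> b" for t
        using that xy(4) unfolding b_def by (metis (mono_tags, lifting) linorder_neqE_linordered_idom mem_Collect_eq)
      ultimately have "(x, y) \<in> N (a, b)"
        unfolding N_def using xy(2) by (auto simp: a_def b_def)
      moreover have "N (a, b) \<in> ?\<N>" unfolding a_def b_def by (intro imageI) auto
      ultimately show "\<exists>z\<in>\<Union>?\<N>. dist z w < e"
        using xy(1) by (metis UnionI dist_commute mem_ball)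
    qed
  qed
  ultimately show ?thesis using finite_EH finite_EV by (intro exI[of _ ?\<N>]) blast
qed

theorem tree_like_S: "tree_like I L S"
  unfolding tree_like_def using two_sides separating_set locally_const_imp_trivial by blast

end

section \<open>Invariance under rotation by 180 degrees\<close>

lemma eventually_near_uminus:
  "eventually P (near (uminus ` I) (- w)) \<longleftrightarrow> eventually (\<lambda>z. P (- z)) (near I w)"
  unfolding eventually_near by (simp add: dist_minus)

lemma locally_const_off_uminus:
  "locally_const_off (uminus ` I) (uminus ` L) (uminus ` U) (- w) \<longleftrightarrow> locally_const_off I L U w"
  unfolding locally_const_off_def eventually_near_uminus by (simp add: inj_image_mem_iff)

lemma tree_like_uminus:
  assumes "tree_like (uminus ` I) (uminus ` L) (uminus ` S)"
  shows "tree_like I L S"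
proof -
  have diff: "uminus ` I - uminus ` L = uminus ` (I - L)"
    by (simp add: image_set_diff)
  have cl: "closure (uminus ` A) = uminus ` closure A" for A :: "point set"
    using closure_scaleR[of "-1" A] by simp
  have conn: "connected (uminus ` A)" if "connected A" for A :: "point set"
    using that by (intro connected_continuous_image continuous_intros)
  note T = assms[unfolded tree_like_def diff]
  note T1 = T[THEN conjunct1, rule_format] and T2 = T[THEN conjunct2, THEN conjunct1, rule_format]
    and T3 = T[THEN conjunct2, THEN conjunct2, rule_format]
  have "\<exists>e>0. \<exists>N N'. connected N \<and> connected N' \<and> N \<union> N' \<subseteq> I - L \<and>
        (\<forall>z\<in>I - L. dist z s < e \<longrightarrow> z \<in> N \<union> N')" if s: "s \<in> S" for s
  proof -
    obtain e N N' where N: "e > 0" "connected N" "connected N'" "N \<union> N' \<subseteq> uminus ` (I - L)"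
      "\<forall>z\<in>uminus ` (I - L). dist z (- s) < e \<longrightarrow> z \<in> N \<union> N'"
      using T1[OF imageI[OF s]] by blast
    have "uminus ` N \<union> uminus ` N' \<subseteq> I - L" using N(4) by force
    moreover have "\<forall>z\<in>I - L. dist z s < e \<longrightarrow> z \<in> uminus ` N \<union> uminus ` N'"
    proof (intro ballI impI)
      fix z assume z: "z \<in> I - L" "dist z s < e"
      then have "- z \<in> N \<union> N'" using N(5) by (simp add: dist_minus)
      then show "z \<in> uminus ` N \<union> uminus ` N'" by (metis Un_iff image_eqI minus_minus)
    qed
    ultimately show ?thesis using N(1) conn[OF N(2)] conn[OF N(3)] by blast
  qed
  moreover have "p \<in> U \<longleftrightarrow> q \<in> U"
    if U: "\<forall>w \<in> (I - L) \<union> S. locally_const_off I L U w" and pq: "p \<in> I - L" "q \<in> I - L" for U p q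
  proof -
    have "\<forall>w\<in>uminus ` (I - L) \<union> uminus ` S. locally_const_off (uminus ` I) (uminus ` L) (uminus ` U) w"
      using U locally_const_off_uminus by blast
    then have "- p \<in> uminus ` U \<longleftrightarrow> - q \<in> uminus ` U" using T2[of "uminus ` U" "- p" "- q"] pq by blast
    then show ?thesis by (simp add: inj_image_mem_iff)
  qed
  moreover have "\<exists>U. (\<forall>w \<in> (I - L) \<union> (S - {s}). locally_const_off I L U w) \<and>
        s \<in> closure ((I - L) \<inter> U) \<and> s \<in> closure ((I - L) \<inter> - U)" if s: "s \<in> S" for s
  proof -
    obtain V where V: "\<forall>w \<in> uminus ` (I - L) \<union> (uminus ` S - {- s}). locally_const_off (uminus ` I) (uminus ` L) V w"
      "- s \<in> closure (uminus ` (I - L) \<inter> V)" "- s \<in> closure (uminus ` (I - L) \<inter> - V)"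
      using T3[OF imageI[OF s]] by blast
    define U where "U = uminus ` V"
    have VU: "V = uminus ` U" by (simp add: U_def image_image)
    have "uminus ` (I - L) \<inter> V = uminus ` ((I - L) \<inter> U)" "uminus ` (I - L) \<inter> - V = uminus ` ((I - L) \<inter> - U)"
      unfolding VU by (auto simp: inj_image_mem_iff)
    then have "s \<in> closure ((I - L) \<inter> U)" "s \<in> closure ((I - L) \<inter> - U)"
      using V(2,3) by (simp_all add: cl inj_image_mem_iff)
    moreover have "locally_const_off I L U w" if "w \<in> (I - L) \<union> (S - {s})" for w
    proof -
      have "- w \<in> uminus ` (I - L) \<union> (uminus ` S - {- s})" using that by auto
      then show ?thesis using V(1) locally_const_off_uminus VU by blast
    qed
    ultimately show ?thesis by blast
  qed
  ultimately show ?thesis unfolding tree_like_def by blast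
qed

lemma inner_uminus: "inner (uminus ` A) (- x) \<longleftrightarrow> inner A x"
  unfolding inner_def by auto

context axis_arrangement
begin

text \<open>The rotation exchanges left with right and lower with upper, so the marked endpoints of
  the rotated arrangement are the images of the unmarked ones.\<close>

lemma axis_arrangement_uminus:
  "axis_arrangement (uminus ` I) EH EV (\<lambda>k. - ht k) (\<lambda>k. - xr k) (\<lambda>k. - xl k) (\<lambda>k. uminus ` hh k)
     (\<lambda>j. - ab j) (\<lambda>j. - yt j) (\<lambda>j. - yb j) (\<lambda>j. uminus ` vv j)"
proof
  have I: "(x, y) \<in> uminus ` I \<longleftrightarrow> (- x, - y) \<in> I" for x y :: real
    by (metis (no_types, lifting) image_iff minus_minus uminus_Pair)
  have R: "x \<in> uminus ` A \<longleftrightarrow> - x \<in> A" for x :: real and A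
    by (metis image_iff minus_minus)
  show "open (uminus ` I)" using open_I by (simp add: open_negations)
  show "convex (uminus ` I)" using convex_I by (simp add: convex_negations)
  show "finite EH" "finite EV" by (rule finite_EH finite_EV)+
  show "closed (uminus ` hh k)" if "k \<in> EH" for k using closed_hh[OF that] by (simp add: closed_negations)
  show "is_interval (uminus ` hh k)" if "k \<in> EH" for k using interval_hh[OF that] by simp
  show "closed (uminus ` vv k)" if "k \<in> EV" for k using closed_vv[OF that] by (simp add: closed_negations)
  show "is_interval (uminus ` vv k)" if "k \<in> EV" for k using interval_vv[OF that] by simp
  show "inj_on (\<lambda>k. - ht k) EH" using inj_ht by (simp add: inj_on_def)
  show "inj_on (\<lambda>k. - ab k) EV" using inj_ab by (simp add: inj_on_def)
  show "- xr k < - xl k" "- xr k \<in> uminus ` hh k" "- xl k \<in> uminus ` hh k" if "k \<in> EH" for k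
    using that xl_less_xr xl_hh xr_hh by auto
  show "- yt k < - yb k" "- yt k \<in> uminus ` vv k" "- yb k \<in> uminus ` vv k" if "k \<in> EV" for k
    using that yb_less_yt yb_vv yt_vv by auto
  show "(x, - ht k) \<in> uminus ` I" if "k \<in> EH" "- xr k < x" "x < - xl k" for k x
    using hseg_I[OF that(1), of "- x"] that by (simp add: I)
  show "(- ab j, y) \<in> uminus ` I" if "j \<in> EV" "- yt j < y" "y < - yb j" for j y
    using vseg_I[OF that(1), of "- y"] that by (simp add: I)
  show "- ab j \<noteq> - xr k \<and> - ab j \<noteq> - xl k" "- ht k \<noteq> - yt j \<and> - ht k \<noteq> - yb j" if "k \<in> EH" "j \<in> EV" for j k
    using ab_neq[OF that] ht_neq[OF that] by auto
  have all_lt: "(\<forall>x< - c. P (- x)) \<longleftrightarrow> (\<forall>x>c. P x)" for c :: real and P by (metis minus_less_iff minus_minus)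
  have all_gt: "(\<forall>x> - c. P (- x)) \<longleftrightarrow> (\<forall>x<c. P x)" for c :: real and P by (metis less_minus_iff minus_minus)
  show "(\<forall>x< - xr k. (x, - ht k) \<in> uminus ` I \<longrightarrow> x \<in> uminus ` hh k) \<or>
      (\<exists>j\<in>EV. - ab j \<in> uminus ` hh k \<and> (\<forall>x\<in>uminus ` hh k. - ab j \<le> x) \<and> - yt j < - ht k \<and> - ht k < - yb j)"
    if "k \<in> EH" for k
    using right_end[OF that] unfolding I R all_lt[where P = "\<lambda>x. (x, - (- ht k)) \<in> I \<longrightarrow> x \<in> hh k"] by force
  show "(\<forall>x> - xl k. (x, - ht k) \<in> uminus ` I \<longrightarrow> x \<in> uminus ` hh k) \<or>
      (\<exists>j\<in>EV. - ab j \<in> uminus ` hh k \<and> (\<forall>x\<in>uminus ` hh k. x \<le> - ab j) \<and> - yt j < - ht k \<and> - ht k < - yb j)"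
    if "k \<in> EH" for k
    using left_end[OF that] unfolding I R all_gt[where P = "\<lambda>x. (x, - (- ht k)) \<in> I \<longrightarrow> x \<in> hh k"] by force
  show "(\<forall>y< - yt j. (- ab j, y) \<in> uminus ` I \<longrightarrow> y \<in> uminus ` vv j) \<or>
      (\<exists>k\<in>EH. - ht k \<in> uminus ` vv j \<and> (\<forall>y\<in>uminus ` vv j. - ht k \<le> y) \<and> (- ab j, - ht k) \<in> uminus ` I \<and>
         - ab j \<in> uminus ` hh k \<and> inner (uminus ` hh k) (- ab j))" if "j \<in> EV" for j
    using top_end[OF that] unfolding I R inner_uminus all_lt[where P = "\<lambda>y. (- (- ab j), y) \<in> I \<longrightarrow> y \<in> vv j"] by force
  show "(\<forall>y> - yb j. (- ab j, y) \<in> uminus ` I \<longrightarrow> y \<in> uminus ` vv j) \<or>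
      (\<exists>k\<in>EH. - ht k \<in> uminus ` vv j \<and> (\<forall>y\<in>uminus ` vv j. y \<le> - ht k) \<and> (- ab j, - ht k) \<in> uminus ` I \<and>
         - ab j \<in> uminus ` hh k \<and> inner (uminus ` hh k) (- ab j))" if "j \<in> EV" for j
    using bottom_end[OF that] unfolding I R inner_uminus all_gt[where P = "\<lambda>y. (- (- ab j), y) \<in> I \<longrightarrow> y \<in> vv j"] by force
  show "\<not> inner (uminus ` hh k) (- ab j)"
    if "k \<in> EH" "j \<in> EV" "- ab j \<in> uminus ` hh k" "- yt j < - ht k" "- ht k < - yb j" for j k
    using crossing_mid[OF that(1,2)] that unfolding inner_uminus R by simp
  show "- ht k \<le> y"
    if "k \<in> EH" "j \<in> EV" "- ab j \<in> uminus ` hh k" "- ht k \<in> uminus ` vv j" "- ht k < - yt j" "y \<in> uminus ` vv j" for j k y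
    using crossing_high[OF that(1,2), of "- y"] that unfolding R by simp
  show "y \<le> - ht k"
    if "k \<in> EH" "j \<in> EV" "- ab j \<in> uminus ` hh k" "- ht k \<in> uminus ` vv j" "- yb j < - ht k" "y \<in> uminus ` vv j" for j k y
    using crossing_low[OF that(1,2), of "- y"] that unfolding R by simp
qed

definition T :: "point set" where
  "T = (\<lambda>k. (xr k, ht k)) ` EH \<union> (\<lambda>j. (ab j, yt j)) ` EV"

lemma T_subset_L: "T \<subseteq> L"
  unfolding T_def L_def using xr_hh yt_vv by auto

theorem tree_like_T: "tree_like I L T"
proof (rule tree_like_uminus)
  interpret neg: axis_arrangement "uminus ` I" EH EV "\<lambda>k. - ht k" "\<lambda>k. - xr k" "\<lambda>k. - xl k" "\<lambda>k. uminus ` hh k"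
     "\<lambda>j. - ab j" "\<lambda>j. - yt j" "\<lambda>j. - yb j" "\<lambda>j. uminus ` vv j"
    by (rule axis_arrangement_uminus)
  have "neg.S = uminus ` T" unfolding neg.S_def T_def image_Un image_image by simp
  moreover have "neg.L = uminus ` L"
  proof -
    have "uminus ` (A \<times> B) = uminus ` A \<times> uminus ` B" for A B :: "real set"
      by (force simp: image_iff)
    then show ?thesis unfolding neg.L_def L_def image_Un image_UN by simp
  qed
  ultimately show "tree_like (uminus ` I) (uminus ` L) (uminus ` T)" using neg.tree_like_S by simp
qed

end

section \<open>The cells of a convex set\<close>

text \<open>\<open>C\<close> need be neither open nor closed, so a cell may contain points outside
  \<open>interior C\<close>, while \<open>cover\<close> speaks about the interior only.\<close>

locale convex_cells =
  fixes C L :: "point set"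
  assumes convex_C: "convex C" and interior_C: "interior C \<noteq> {}" and closed_L: "closed L"
    and cover: "\<exists>\<N>. finite \<N> \<and> (\<forall>N\<in>\<N>. connected N \<and> N \<subseteq> interior C - L) \<and> interior C \<subseteq> closure (\<Union>\<N>)"
begin

abbreviation "I \<equiv> interior C"

lemma C_closure_I: "C \<subseteq> closure I"
  using convex_closure_interior[OF convex_C interior_C] closure_subset by blast

lemma cell_disjoint: "c \<in> cells C L \<Longrightarrow> c' \<in> cells C L \<Longrightarrow> z \<in> c \<Longrightarrow> z \<in> c' \<Longrightarrow> c = c'"
  unfolding cells_def using components_eq by blast

lemma cell_exists: "z \<in> C - L \<Longrightarrow> \<exists>c\<in>cells C L. z \<in> c"
  unfolding cells_def using Union_components[of "C - L"] by blast

lemma cell_exists_I: "z \<in> I - L \<Longrightarrow> \<exists>c\<in>cells C L. z \<in> c"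
  using cell_exists interior_subset by blast

lemma cell_subset: "c \<in> cells C L \<Longrightarrow> c \<subseteq> C - L"
  unfolding cells_def by (rule in_components_subset)

lemma connected_subset_cell:
  "c \<in> cells C L \<Longrightarrow> connected N \<Longrightarrow> N \<subseteq> C - L \<Longrightarrow> N \<inter> c \<noteq> {} \<Longrightarrow> N \<subseteq> c"
  unfolding cells_def using components_maximal by blast

text \<open>Cells are relatively open in \<open>C\<close>, because a ball meets the convex set
  \<open>C\<close> in a connected set.\<close>

lemma cell_ball:
  assumes "c \<in> cells C L" "z \<in> c"
  shows "\<exists>e>0. ball z e \<inter> L = {} \<and> ball z e \<inter> C \<subseteq> c"
proof -
  have "z \<in> C" "z \<in> - L" using assms cell_subset by auto
  moreover have "open (- L)" using closed_L by (rule open_Compl)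
  ultimately obtain e where e: "e > 0" "ball z e \<subseteq> - L" by (meson openE)
  have "connected (ball z e \<inter> C)" by (intro convex_connected convex_Int convex_ball convex_C)
  moreover have "z \<in> (ball z e \<inter> C) \<inter> c" using assms(2) \<open>z \<in> C\<close> e(1) by simp
  moreover have "ball z e \<inter> C \<subseteq> C - L" using e(2) by blast
  ultimately have "ball z e \<inter> C \<subseteq> c"
    using connected_subset_cell[OF assms(1), of "ball z e \<inter> C"] by blast
  then show ?thesis using e by blast
qed

text \<open>A cell is relatively open in \<open>C\<close> and \<open>C\<close> lies in the closure
  of its interior, so every approach to a point through the cell can be moved into
  \<open>I\<close>.\<close>

lemma cell_interior_approx:
  assumes "c \<in> cells C L" "w \<in> closure c" "e > 0"
  shows "\<exists>z\<in>c \<inter> I. dist z w < e"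
proof -
  obtain z where z: "z \<in> c" "dist z w < e/2" using assms(2,3) by (meson closure_approachable half_gt_zero)
  obtain r where r: "r > 0" "ball z r \<inter> C \<subseteq> c" using cell_ball[OF assms(1) z(1)] by blast
  have "z \<in> closure I" using C_closure_I z(1) assms(1) cell_subset by blast
  then obtain z' where z': "z' \<in> I" "dist z' z < min r (e/2)"
    using r(1) assms(3) by (metis closure_approachable half_gt_zero min_less_iff_conj)
  then have "z' \<in> c" using r(2) interior_subset[of C] by (auto simp: dist_commute)
  moreover have "dist z' w < e" using z' z(2) dist_triangle[of z' w z] by simp
  ultimately show ?thesis using z' by blast
qed

lemma cell_nonempty: "c \<in> cells C L \<Longrightarrow> c \<noteq> {}"
  unfolding cells_def by (rule in_components_nonempty)

lemma cell_meets_I: "c \<in> cells C L \<Longrightarrow> c \<inter> I \<noteq> {}"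
  using cell_interior_approx[of c _ 1] cell_nonempty[of c] closure_subset[of c] by fastforce

text \<open>Every cell contains an entire nonempty member of the finite cover, and distinct cells
  are disjoint.\<close>

lemma finite_cells: "finite (cells C L)"
proof -
  obtain \<N> where N: "finite \<N>" "\<And>N. N \<in> \<N> \<Longrightarrow> connected N \<and> N \<subseteq> I - L" "I \<subseteq> closure (\<Union>\<N>)"
    using cover by blast
  have "\<exists>N\<in>\<N>. N \<noteq> {} \<and> N \<subseteq> c" if c: "c \<in> cells C L" for c
  proof -
    obtain z where z: "z \<in> c" "z \<in> I" using cell_meets_I[OF c] by blast
    obtain r where r: "r > 0" "ball z r \<inter> C \<subseteq> c" using cell_ball[OF c z(1)] by blast
    have "z \<in> closure (\<Union>\<N>)" using N(3) z by blast
    then obtain z' where z': "z' \<in> \<Union>\<N>" "dist z' z < r" using r(1) by (meson closure_approachable)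
    then obtain N' where N': "N' \<in> \<N>" "z' \<in> N'" by blast
    have sub: "N' \<subseteq> C - L" "connected N'" using N(2)[OF N'(1)] interior_subset[of C] by auto
    then have "z' \<in> c" using r(2) z'(2) N'(2) by (auto simp: dist_commute)
    then have "N' \<subseteq> c" using connected_subset_cell[OF c sub(2,1)] N'(2) by blast
    then show ?thesis using N' by blast
  qed
  then obtain f where f: "\<And>c. c \<in> cells C L \<Longrightarrow> f c \<in> \<N> \<and> f c \<noteq> {} \<and> f c \<subseteq> c" by metis
  have "inj_on f (cells C L)"
  proof
    fix c c' assume c: "c \<in> cells C L" "c' \<in> cells C L" "f c = f c'"
    then obtain z where "z \<in> f c" using f by blast
    then show "c = c'" using cell_disjoint[OF c(1,2)] f c by blast
  qed
  moreover have "f ` cells C L \<subseteq> \<N>" using f by blast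
  ultimately show ?thesis using N(1) by (meson finite_imageD finite_subset)
qed

text \<open>Connectedness is known for \<open>c\<close> but not for \<open>c \<inter> I\<close>. The
  induction therefore runs over \<open>c\<close>, frontier points included, and carries the value of
  \<open>U\<close> on the part of a small ball inside \<open>I\<close>.\<close>

lemma cell_constant:
  assumes U: "\<And>w. w \<in> I - L \<Longrightarrow> locally_const_off I L U w"
    and c: "c \<in> cells C L" and pq: "p \<in> c \<inter> I" "q \<in> c \<inter> I"
  shows "p \<in> U \<longleftrightarrow> q \<in> U"
proof -
  have ball: "\<exists>e>0. ball z e \<inter> C \<subseteq> c \<and> (\<forall>x\<in>ball z e \<inter> I. \<forall>y\<in>ball z e \<inter> I. x \<in> U \<longleftrightarrow> y \<in> U)"
    if z: "z \<in> c" for z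
  proof -
    obtain e where e: "e > 0" "ball z e \<inter> L = {}" "ball z e \<inter> C \<subseteq> c" using cell_ball[OF c z] by blast
    have "connected (ball z e \<inter> I)"
      by (intro convex_connected convex_Int convex_ball convex_interior convex_C)
    moreover have "ball z e \<inter> I \<subseteq> I - L" using e(2) by blast
    ultimately have "\<forall>x\<in>ball z e \<inter> I. \<forall>y\<in>ball z e \<inter> I. x \<in> U \<longleftrightarrow> y \<in> U"
      using locally_const_off_connected[of "ball z e \<inter> I" I L U] U by blast
    then show ?thesis using e by blast
  qed
  let ?P = "\<lambda>z. \<exists>e>0. \<forall>x\<in>ball z e \<inter> I. x \<in> U \<longleftrightarrow> p \<in> U"
  have "?P q"
  proof (rule connected_induction_simple[of c p q ?P])
    show "connected c" using c unfolding cells_def by (rule in_components_connected)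
    show "p \<in> c" "q \<in> c" using pq by auto
    obtain e where "e > 0" "\<forall>x\<in>ball p e \<inter> I. \<forall>y\<in>ball p e \<inter> I. x \<in> U \<longleftrightarrow> y \<in> U"
      using ball[of p] pq by blast
    then show "?P p" using pq by (metis IntD2 IntI centre_in_ball)
    fix a assume a: "a \<in> c"
    obtain e where e: "e > 0" "\<And>x y. x \<in> ball a e \<inter> I \<Longrightarrow> y \<in> ball a e \<inter> I \<Longrightarrow> x \<in> U \<longleftrightarrow> y \<in> U"
      using ball[OF a] by metis
    show "\<exists>T. openin (top_of_set c) T \<and> a \<in> T \<and> (\<forall>x\<in>T. \<forall>y\<in>T. ?P x \<longrightarrow> ?P y)"
    proof (intro exI[of _ "c \<inter> ball a e"] conjI ballI impI)
      fix x y assume x: "x \<in> c \<inter> ball a e" and y: "y \<in> c \<inter> ball a e" and P: "?P x"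
      from P obtain d where d: "d > 0" "\<forall>z\<in>ball x d \<inter> I. z \<in> U \<longleftrightarrow> p \<in> U" by blast
      have "x \<in> closure c" using x closure_subset by blast
      moreover have "min d (e - dist a x) > 0" using d(1) x by simp
      ultimately obtain z where z: "z \<in> c \<inter> I" "dist z x < min d (e - dist a x)"
        using cell_interior_approx[OF c] by blast
      have "dist a z < e" using z(2) dist_triangle[of a z x] by (simp add: dist_commute)
      then have zU: "z \<in> ball a e \<inter> I" "z \<in> U \<longleftrightarrow> p \<in> U"
        using z d(2) by (auto simp: dist_commute)
      have "ball y (e - dist a y) \<subseteq> ball a e"
        by (auto simp: subset_iff) (smt (verit) dist_triangle)
      then have "\<forall>x\<in>ball y (e - dist a y) \<inter> I. x \<in> U \<longleftrightarrow> p \<in> U"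
        using e(2)[OF _ zU(1)] zU(2) by blast
      moreover have "e - dist a y > 0" using y by simp
      ultimately show "?P y" by blast
    qed (use a e(1) in \<open>auto simp: openin_open_Int\<close>)
  qed
  then show ?thesis using pq by force
qed

section \<open>The dual graph restricted to one of the two edge sets\<close>

context
  fixes S :: "point set"
  assumes S: "finite S" "S \<subseteq> L" "tree_like I L S"
begin

abbreviation ends_at :: "point \<Rightarrow> point set set" where
  "ends_at v \<equiv> {c \<in> cells C L. v \<in> frontier c}"

lemma S_frontier_iff: "s \<in> S \<Longrightarrow> c \<in> cells C L \<Longrightarrow> s \<in> frontier c \<longleftrightarrow> s \<in> closure c"
  using S(2) cell_subset interior_subset[of c] unfolding frontier_def by blast

lemma ends_at_two:
  assumes s: "s \<in> S"
  shows "\<exists>a b. ends_at s \<subseteq> {a, b}"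
proof -
  obtain e N N' where N: "e > 0" "connected N" "connected N'" "N \<union> N' \<subseteq> I - L"
    "\<forall>z\<in>I - L. dist z s < e \<longrightarrow> z \<in> N \<union> N'"
    using S(3) s unfolding tree_like_def by meson
  have one: "\<exists>a. \<forall>c\<in>cells C L. Q \<inter> c \<noteq> {} \<longrightarrow> c = a" if Q: "connected Q" "Q \<subseteq> I - L" for Q
  proof -
    have sub: "Q \<subseteq> C - L" using Q(2) interior_subset[of C] by blast
    have "c = c'" if c: "c \<in> cells C L" "c' \<in> cells C L" "Q \<inter> c \<noteq> {}" "Q \<inter> c' \<noteq> {}" for c c'
      using connected_subset_cell[OF c(2) Q(1) sub c(4)] c(3) cell_disjoint[OF c(1,2)] by blast
    then show ?thesis by metis
  qed
  obtain a where a: "\<forall>c\<in>cells C L. N \<inter> c \<noteq> {} \<longrightarrow> c = a" using one[OF N(2)] N(4) by blast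
  obtain b where b: "\<forall>c\<in>cells C L. N' \<inter> c \<noteq> {} \<longrightarrow> c = b" using one[OF N(3)] N(4) by blast
  have "c \<in> {a, b}" if c: "c \<in> ends_at s" for c
  proof -
    have "s \<in> closure c" using S_frontier_iff s c by blast
    then obtain z where "z \<in> c \<inter> I" "dist z s < e" using cell_interior_approx[of c] c N(1) by blast
    moreover from this have "z \<in> I - L" using cell_subset[of c] c by blast
    ultimately show ?thesis using N(5) a b c by blast
  qed
  then show ?thesis by blast
qed

text \<open>\<open>f\<close> is a cut of the dual graph that only the edge \<open>s\<close> crosses,
  so \<open>s\<close> lies on no cycle.\<close>

lemma ends_at_separated:
  assumes s: "s \<in> S"
  shows "\<exists>f :: point set \<Rightarrow> bool. (\<exists>c\<in>ends_at s. f c) \<and> (\<exists>c\<in>ends_at s. \<not> f c) \<and>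
    (\<forall>s'\<in>S - {s}. \<forall>c\<in>ends_at s'. \<forall>c'\<in>ends_at s'. f c = f c')"
proof -
  obtain U where U: "\<forall>w \<in> (I - L) \<union> (S - {s}). locally_const_off I L U w"
    "s \<in> closure ((I - L) \<inter> U)" "s \<in> closure ((I - L) \<inter> - U)"
    using S(3) s unfolding tree_like_def by meson
  define f where "f c \<longleftrightarrow> c \<inter> I \<inter> U \<noteq> {}" for c
  have f: "z \<in> U \<longleftrightarrow> f c" if "c \<in> cells C L" "z \<in> c \<inter> I" for c z
    using cell_constant[of U c z] U(1) that unfolding f_def by blast
  have ex: "\<exists>c\<in>ends_at s. c \<inter> I \<inter> V \<noteq> {}" if "s \<in> closure ((I - L) \<inter> V)" for V
  proof -
    have "(I - L) \<inter> V \<subseteq> \<Union>{c\<in>cells C L. c \<inter> I \<inter> V \<noteq> {}}" using cell_exists_I by blast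
    also have "\<dots> \<subseteq> \<Union>(closure ` {c\<in>cells C L. c \<inter> I \<inter> V \<noteq> {}})" using closure_subset by blast
    \<comment> \<open>There are finitely many cells, so a limit of points from the cells meeting
      \<open>V\<close> lies in the closure of a single one of them.\<close>
    finally have "closure ((I - L) \<inter> V) \<subseteq> \<Union>(closure ` {c\<in>cells C L. c \<inter> I \<inter> V \<noteq> {}})"
      using finite_cells by (intro closure_minimal closed_Union) auto
    then show ?thesis using that S_frontier_iff[OF s] by blast
  qed
  have "f c = f c'" if s': "s' \<in> S - {s}" and c: "c \<in> ends_at s'" "c' \<in> ends_at s'" for s' c c'
  proof -
    obtain e where e: "e > 0" "\<forall>p\<in>I - L. \<forall>q\<in>I - L. dist p s' < e \<longrightarrow> dist q s' < e \<longrightarrow> (p \<in> U \<longleftrightarrow> q \<in> U)"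
      using locally_const_offD U(1) s' by blast
    have cl: "s' \<in> closure c" "s' \<in> closure c'" using S_frontier_iff s' c by blast+
    obtain p where p: "p \<in> c \<inter> I" "dist p s' < e" using cell_interior_approx[of c s' e] cl c e(1) by blast
    obtain q where q: "q \<in> c' \<inter> I" "dist q s' < e" using cell_interior_approx[of c' s' e] cl c e(1) by blast
    have "p \<in> I - L" "q \<in> I - L" using p q cell_subset[of c] cell_subset[of c'] c by blast+
    then have "p \<in> U \<longleftrightarrow> q \<in> U" using e(2) p(2) q(2) by blast
    then show ?thesis using f p(1) q(1) c by blast
  qed
  moreover have "\<exists>c\<in>ends_at s. f c" using ex[OF U(2)] unfolding f_def .
  moreover have "\<exists>c\<in>ends_at s. \<not> f c" using ex[OF U(3)] f by fastforce
  ultimately show ?thesis by blast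
qed

text \<open>The closures of the finitely many cells that stay away from \<open>s\<close> have a
  closed union, which misses a ball about \<open>s\<close>.\<close>

lemma cells_near:
  "\<exists>e>0. \<forall>c\<in>cells C L. \<forall>z\<in>c. dist z s < e \<longrightarrow> s \<in> closure c"
proof -
  have "closed (\<Union>(closure ` {c\<in>cells C L. s \<notin> closure c}))"
    using finite_cells by (intro closed_Union) auto
  moreover have "s \<notin> \<Union>(closure ` {c\<in>cells C L. s \<notin> closure c})" by blast
  ultimately obtain e where e: "e > 0" "ball s e \<subseteq> - \<Union>(closure ` {c\<in>cells C L. s \<notin> closure c})"
    using open_contains_ball[of "- \<Union>(closure ` {c\<in>cells C L. s \<notin> closure c})"] by (meson ComplI open_Compl)
  have "s \<in> closure c" if "c \<in> cells C L" "z \<in> c" "dist z s < e" for c z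
  proof (rule ccontr)
    assume "s \<notin> closure c"
    then have "z \<in> \<Union>(closure ` {c\<in>cells C L. s \<notin> closure c})" using that closure_subset[of c] by blast
    moreover have "z \<in> ball s e" using that(3) by (simp add: dist_commute)
    ultimately show False using e(2) by blast
  qed
  then show ?thesis using e(1) by blast
qed

abbreviation dual_part :: "(point set, point) multigraph" where
  "dual_part \<equiv> \<lparr>verts = cells C L, edges = S, ends = ends_at\<rparr>"

text \<open>The union of the cells reachable from \<open>c0\<close> has no jump inside cells, and
  none at an edge of \<open>S\<close>, since the cells there are reachable together. By
  \<open>tree_like\<close> it is trivial, hence contains every cell.\<close>

lemma dual_part_connected: "connected_graph dual_part"
proof -
  let ?R = "{(x, y). \<exists>s\<in>S. ends_at s = {x, y}}"
  have "(c0, c1) \<in> ?R\<^sup>*" if c: "c0 \<in> cells C L" "c1 \<in> cells C L" for c0 c1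
  proof -
    define U where "U = \<Union>{c\<in>cells C L. (c0, c) \<in> ?R\<^sup>*}"
    have U: "z \<in> U \<longleftrightarrow> (c0, c) \<in> ?R\<^sup>*" if "c \<in> cells C L" "z \<in> c" for c z
      using that cell_disjoint unfolding U_def by blast
    have "locally_const_off I L U w" if w: "w \<in> I - L" for w
    proof -
      obtain c where c: "c \<in> cells C L" "w \<in> c" using cell_exists_I[OF w] by blast
      obtain e where e: "e > 0" "ball w e \<inter> C \<subseteq> c" using cell_ball[OF c] by blast
      have "z \<in> U \<longleftrightarrow> (c0, c) \<in> ?R\<^sup>*" if "z \<in> I" "dist z w < e" for z
      proof -
        have "z \<in> c" using e(2) that interior_subset[of C] by (auto simp: dist_commute)
        then show ?thesis using U[OF c(1)] by blast
      qed
      then show ?thesis unfolding locally_const_off_def eventually_near using e(1) by meson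
    qed
    moreover have "locally_const_off I L U s" if s: "s \<in> S" for s
    proof -
      obtain e where e: "e > 0" "\<forall>c\<in>cells C L. \<forall>z\<in>c. dist z s < e \<longrightarrow> s \<in> closure c"
        using cells_near by blast
      have step: "(c0, c') \<in> ?R\<^sup>*" if "c \<in> ends_at s" "c' \<in> ends_at s" "(c0, c) \<in> ?R\<^sup>*" for c c'
      proof (cases "c = c'")
        case False
        \<comment> \<open>At most two cells meet at \<open>s\<close>, so two distinct ones are all
          of its ends.\<close>
        then have "ends_at s = {c, c'}" using ends_at_two[OF s] that(1,2) by blast
        then have "(c, c') \<in> ?R" using s by blast
        then show ?thesis using that(3) by (rule rtrancl_into_rtrancl[rotated])
      qed (use that in simp)
      have ends: "\<exists>c\<in>ends_at s. z \<in> c" if "z \<in> I" "dist z s < e" "z \<notin> L" for z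
      proof -
        have "\<exists>c\<in>cells C L. z \<in> c" using cell_exists_I that by blast
        then show ?thesis using e(2) that(2) S_frontier_iff[OF s] by blast
      qed
      show ?thesis
      proof (cases "\<exists>c\<in>ends_at s. (c0, c) \<in> ?R\<^sup>*")
        case True
        then have "z \<in> U" if "z \<in> I" "dist z s < e" "z \<notin> L" for z
          using ends[OF that] step U by blast
        then show ?thesis unfolding locally_const_off_def eventually_near using e(1) by blast
      next
        case False
        then have "z \<notin> U" if "z \<in> I" "dist z s < e" "z \<notin> L" for z
          using ends[OF that] U by blast
        then show ?thesis unfolding locally_const_off_def eventually_near using e(1) by blast
      qed
    qed
    ultimately have triv: "p \<in> U \<longleftrightarrow> q \<in> U" if "p \<in> I - L" "q \<in> I - L" for p q
      using S(3)[unfolded tree_like_def, THEN conjunct2, THEN conjunct1, rule_format, of U p q] that by blast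
    obtain p q where p: "p \<in> c0 \<inter> I" and q: "q \<in> c1 \<inter> I" using cell_meets_I c by blast
    then have "p \<in> U" using U[OF c(1)] by blast
    then have "q \<in> U" using triv[of p q] p q cell_subset c by blast
    then show ?thesis using U[OF c(2)] q by blast
  qed
  moreover have "cells C L \<noteq> {}"
  proof -
    obtain \<N> where N: "finite \<N>" "\<And>N. N \<in> \<N> \<Longrightarrow> connected N \<and> N \<subseteq> I - L" "I \<subseteq> closure (\<Union>\<N>)"
      using cover by blast
    then have "\<Union>\<N> \<noteq> {}" using interior_C by (metis closure_empty subset_empty)
    then show ?thesis using N(2) cell_exists_I by blast
  qed
  ultimately show ?thesis unfolding connected_graph_def by simp
qed

text \<open>The cut \<open>f\<close> of the first edge does not change along the remaining edges of
  the cycle, yet these lead from one end of the first edge back to the other.\<close>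

lemma dual_part_acyclic: "\<not> is_cycle dual_part us es"
proof
  assume cyc: "is_cycle dual_part us es"
  define n where "n = length es"
  have n: "n > 0" "length us = n" "distinct es" "set es \<subseteq> S"
    and ends: "\<And>i. i < n \<Longrightarrow> ends_at (es ! i) = {us ! i, us ! (Suc i mod n)}"
    using cyc unfolding is_cycle_def n_def by auto
  have "es ! 0 \<in> S" using n n_def by auto
  from ends_at_separated[OF this] obtain f where f: "\<exists>c\<in>ends_at (es ! 0). f c" "\<exists>c\<in>ends_at (es ! 0). \<not> f c"
    "\<forall>s'\<in>S - {es ! 0}. \<forall>c\<in>ends_at s'. \<forall>c'\<in>ends_at s'. f c = f c'"
    by (elim exE conjE)
  have step: "f (us ! i) = f (us ! (Suc i mod n))" if "0 < i" "i < n" for i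
  proof -
    have "es ! i \<in> S - {es ! 0}" using n that n_def nth_eq_iff_index_eq[of es i 0] by auto
    then have "\<forall>c\<in>ends_at (es ! i). \<forall>c'\<in>ends_at (es ! i). f c = f c'" using f(3) by (rule bspec[rotated])
    then show ?thesis unfolding ends[OF that(2)] by blast
  qed
  \<comment> \<open>For a loop \<open>n = 1\<close> and \<open>1 mod n = 0\<close>; the final
    contradiction then says that a single cell cannot carry both values.\<close>
  have "f (us ! (Suc t mod n)) = f (us ! (1 mod n))" if "t < n" for t
    using that
  proof (induction t)
    case (Suc t)
    then show ?case using step[of "Suc t"] by simp
  qed simp
  from this[of "n - 1"] have "f (us ! 0) = f (us ! (1 mod n))" using n(1) by simp
  then show False using f(1,2) ends[OF n(1)] by auto
qed

theorem dual_part_tree: "is_tree dual_part"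
proof -
  have "card (ends_at s) \<in> {1, 2}" if s: "s \<in> S" for s
  proof -
    obtain a b where ab: "ends_at s \<subseteq> {a, b}" using ends_at_two[OF s] by blast
    have "card (ends_at s) \<le> card {a, b}" using ab by (intro card_mono) auto
    also have "\<dots> \<le> 2" by (simp add: card_insert_if)
    finally have "card (ends_at s) \<le> 2" .
    moreover have "ends_at s \<noteq> {}" using ends_at_separated[OF s] by blast
    then have "card (ends_at s) \<noteq> 0" using finite_cells by auto
    ultimately show ?thesis by auto
  qed
  then show ?thesis
    unfolding is_tree_def wf_multigraph_def
    using finite_cells S(1) dual_part_connected dual_part_acyclic by auto
qed

end
end

section \<open>Drawing axis-parallel rays\<close>

text \<open>The segment \<open>{a..b}\<close> with its two rays on a line with obstacles
  \<open>D\<close>. The strict bound on the far side keeps the first obstacle in the set, and an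
  obstacle at \<open>a\<close> or \<open>b\<close> stops the ray at once.\<close>

definition prolong :: "real set \<Rightarrow> real \<Rightarrow> real \<Rightarrow> real set" where
  "prolong D a b = {a..b} \<union> {x. b \<le> x \<and> (\<forall>t. b \<le> t \<and> t < x \<longrightarrow> t \<notin> D)} \<union>
     {x. x \<le> a \<and> (\<forall>t. x < t \<and> t \<le> a \<longrightarrow> t \<notin> D)}"

lemma prolong_uminus: "prolong (uminus ` D) (- b) (- a) = uminus ` prolong D a b"
proof -
  have R: "x \<in> uminus ` A \<longleftrightarrow> - x \<in> A" for x :: real and A
    by (metis image_iff minus_minus)
  have 1: "(\<forall>t. - a \<le> t \<and> t < x \<longrightarrow> - t \<notin> D) \<longleftrightarrow> (\<forall>t. - x < t \<and> t \<le> a \<longrightarrow> t \<notin> D)" for x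
    by (metis minus_le_iff minus_less_iff minus_minus)
  have 2: "(\<forall>t. x < t \<and> t \<le> - b \<longrightarrow> - t \<notin> D) \<longleftrightarrow> (\<forall>t. b \<le> t \<and> t < - x \<longrightarrow> t \<notin> D)" for x
    by (metis le_minus_iff less_minus_iff minus_minus)
  show ?thesis
    unfolding set_eq_iff R prolong_def Un_iff mem_Collect_eq R 1 2 atLeastAtMost_iff
    by (auto simp: minus_le_iff le_minus_iff)
qed

lemma prolong_segment: "x \<in> {a..b} \<Longrightarrow> x \<in> prolong D a b"
  unfolding prolong_def by auto

lemma prolong_right_iff: "a < b \<Longrightarrow> b \<le> x \<Longrightarrow> x \<in> prolong D a b \<longleftrightarrow> (\<forall>t. b \<le> t \<and> t < x \<longrightarrow> t \<notin> D)"
  unfolding prolong_def by auto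

lemma prolong_left_iff: "a < b \<Longrightarrow> x \<le> a \<Longrightarrow> x \<in> prolong D a b \<longleftrightarrow> (\<forall>t. x < t \<and> t \<le> a \<longrightarrow> t \<notin> D)"
  unfolding prolong_def by auto

lemma prolong_interval:
  assumes "a < b"
  shows "is_interval (prolong D a b)"
  unfolding is_interval_1
proof (intro ballI allI impI, elim conjE)
  fix u v x assume u: "u \<in> prolong D a b" and v: "v \<in> prolong D a b" and x: "u \<le> x" "x \<le> v"
  consider "x \<in> {a..b}" | "b \<le> x" | "x \<le> a" by fastforce
  then show "x \<in> prolong D a b"
  proof cases
    case 1 then show ?thesis by (rule prolong_segment)
  next
    case 2 then show ?thesis using v x assms by (auto simp: prolong_right_iff)
  next
    case 3 then show ?thesis using u x assms by (auto simp: prolong_left_iff)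
  qed
qed

lemma prolong_right_end:
  assumes "closed D" "a < b"
  shows "(\<forall>x\<ge>b. x \<in> prolong D a b) \<or> (\<exists>d\<in>D. b \<le> d \<and> d \<in> prolong D a b \<and> (\<forall>x\<in>prolong D a b. x \<le> d))"
proof (cases "D \<inter> {b..} = {}")
  case True
  then show ?thesis using assms(2) by (auto simp: prolong_right_iff)
next
  case False
  define d where "d = Inf (D \<inter> {b..})"
  have "d \<in> D \<inter> {b..}"
    unfolding d_def using assms(1) False by (intro closed_contains_Inf closed_Int) (auto intro: bdd_belowI[of _ b])
  moreover have "d \<le> t" if "t \<in> D" "b \<le> t" for t
    unfolding d_def using that by (intro cInf_lower) (auto intro: bdd_belowI[of _ b])
  ultimately have d: "d \<in> D" "b \<le> d" "\<And>t. t \<in> D \<Longrightarrow> b \<le> t \<Longrightarrow> d \<le> t" by auto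
  have "d \<in> prolong D a b" using d assms(2) by (force simp: prolong_right_iff)
  moreover have "x \<le> d" if "x \<in> prolong D a b" for x
    using that d assms(2) prolong_right_iff[of a b x D] by force
  ultimately show ?thesis using d by blast
qed

lemma prolong_left_end:
  assumes "closed D" "a < b"
  shows "(\<forall>x\<le>a. x \<in> prolong D a b) \<or> (\<exists>d\<in>D. d \<le> a \<and> d \<in> prolong D a b \<and> (\<forall>x\<in>prolong D a b. d \<le> x))"
proof -
  have "closed (uminus ` D)" using assms by (simp add: closed_negations)
  from prolong_right_end[OF this, of "- b" "- a"] assms(2)
  have "(\<forall>x\<ge>- a. x \<in> uminus ` prolong D a b) \<or>
    (\<exists>d\<in>uminus ` D. - a \<le> d \<and> d \<in> uminus ` prolong D a b \<and> (\<forall>x\<in>uminus ` prolong D a b. x \<le> d))"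
    unfolding prolong_uminus by simp
  then show ?thesis
  proof
    assume *: "\<forall>x\<ge>- a. x \<in> uminus ` prolong D a b"
    have "x \<in> prolong D a b" if "x \<le> a" for x
      using *[rule_format, of "- x"] that by auto
    then show ?thesis by blast
  qed auto
qed

lemma prolong_hit_max: "a < b \<Longrightarrow> t \<in> D \<Longrightarrow> b \<le> t \<Longrightarrow> x \<in> prolong D a b \<Longrightarrow> x \<le> t"
  using prolong_right_iff[of a b x D] by force

lemma prolong_hit_min: "a < b \<Longrightarrow> t \<in> D \<Longrightarrow> t \<le> a \<Longrightarrow> x \<in> prolong D a b \<Longrightarrow> t \<le> x"
  using prolong_left_iff[of a b x D] by force

text \<open>To be read with \<open>A\<close> the part of the line in the interior of the convex set
  and \<open>F\<close> its frontier points. A stop in \<open>F\<close> lies outside the interval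
  \<open>A\<close>, which therefore does not continue beyond it, so such a stop counts as
  leaving.\<close>

lemma prolong_right_cases:
  assumes "closed D" "a < b" "is_interval A" "{a<..<b} \<subseteq> A" "F \<inter> A = {}"
  shows "(\<forall>x>b. x \<in> A \<longrightarrow> x \<in> prolong D a b) \<or>
    (\<exists>d\<in>D - F. b \<le> d \<and> d \<in> prolong D a b \<and> (\<forall>x\<in>prolong D a b. x \<le> d))"
proof -
  have "x \<in> prolong D a b" if d: "d \<notin> A" "b \<le> d" "d \<in> prolong D a b" and x: "b < x" "x \<in> A" for d x
  proof -
    obtain m where m: "m \<in> A" "a < m" "m < b"
      using dense[OF assms(2)] assms(4) by (auto simp: subset_iff)
    then have "x \<le> d"
      using d x assms(3) unfolding is_interval_1 by (meson less_imp_le linorder_not_le order_trans)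
    then show ?thesis using d x assms(2) prolong_right_iff[of a b d D] prolong_right_iff[of a b x D] by auto
  qed
  then show ?thesis using prolong_right_end[OF assms(1,2)] assms(5) less_imp_le by blast
qed

lemma prolong_left_cases:
  assumes "closed D" "a < b" "is_interval A" "{a<..<b} \<subseteq> A" "F \<inter> A = {}"
  shows "(\<forall>x<a. x \<in> A \<longrightarrow> x \<in> prolong D a b) \<or>
    (\<exists>d\<in>D - F. d \<le> a \<and> d \<in> prolong D a b \<and> (\<forall>x\<in>prolong D a b. d \<le> x))"
proof -
  have "x \<in> prolong D a b" if d: "d \<notin> A" "d \<le> a" "d \<in> prolong D a b" and x: "x < a" "x \<in> A" for d x
  proof -
    obtain m where m: "m \<in> A" "a < m" "m < b"
      using dense[OF assms(2)] assms(4) by (auto simp: subset_iff)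
    then have "d \<le> x"
      using d x assms(3) unfolding is_interval_1 by (meson less_imp_le linorder_not_le order_trans)
    then show ?thesis using d x assms(2) prolong_left_iff[of a b d D] prolong_left_iff[of a b x D] by auto
  qed
  then show ?thesis using prolong_left_end[OF assms(1,2)] assms(5) less_imp_le by blast
qed

lemma prolong_closed:
  assumes "closed D" "a < b"
  shows "closed (prolong D a b)"
proof -
  let ?A = "prolong D a b"
  have mem: "a \<in> ?A" "b \<in> ?A" using assms(2) by (auto intro: prolong_segment)
  have between: "u \<in> ?A \<Longrightarrow> v \<in> ?A \<Longrightarrow> u \<le> x \<Longrightarrow> x \<le> v \<Longrightarrow> x \<in> ?A" for u v x
    using prolong_interval[OF assms(2), of D] unfolding is_interval_1 by blast
  consider (1) "\<forall>x\<ge>b. x \<in> ?A" "\<forall>x\<le>a. x \<in> ?A" |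
    (2) d where "\<forall>x\<ge>b. x \<in> ?A" "d \<in> ?A" "\<forall>x\<in>?A. d \<le> x" |
    (3) d where "\<forall>x\<le>a. x \<in> ?A" "d \<in> ?A" "\<forall>x\<in>?A. x \<le> d" |
    (4) c d where "c \<in> ?A" "d \<in> ?A" "\<forall>x\<in>?A. c \<le> x" "\<forall>x\<in>?A. x \<le> d"
    using prolong_right_end[OF assms] prolong_left_end[OF assms] by blast
  then show ?thesis
  proof cases
    case 1
    then have "x \<in> ?A" for x using between[OF mem, of x] by (cases "b \<le> x"; cases "x \<le> a") auto
    then have "?A = UNIV" by blast
    then show ?thesis by simp
  next
    case 2
    then have "x \<in> ?A" if "d \<le> x" for x using between[OF 2(2) mem(2) that] by (cases "b \<le> x") auto
    then have "?A = {d..}" using 2(3) by auto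
    then show ?thesis by simp
  next
    case 3
    then have "x \<in> ?A" if "x \<le> d" for x using between[OF mem(1) 3(2) _ that] by (cases "x \<le> a") auto
    then have "?A = {..d}" using 3(3) by auto
    then show ?thesis by simp
  next
    case 4
    have "x \<in> ?A \<longleftrightarrow> x \<in> {c..d}" for x using between[OF 4(1,2), of x] 4(3,4) by fastforce
    then have "?A = {c..d}" by blast
    then show ?thesis by simp
  qed
qed

text \<open>Since \<open>D\<close> is closed, the stretch free of obstacles continues a little past
  \<open>x\<close>.\<close>

lemma prolong_not_hit_larger:
  assumes "closed D" "a < b" "x \<in> prolong D a b" "x \<notin> D" "b < x"
  shows "inner (prolong D a b) x"
proof -
  obtain e where e: "e > 0" "ball x e \<subseteq> - D"
    using assms(1,4) by (meson ComplI open_Compl openE)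
  have "t \<notin> D" if "b \<le> t" "t < x + e/2" for t
  proof (cases "t < x")
    case True
    then show ?thesis using assms that by (auto simp: prolong_right_iff)
  next
    case False
    then have "t \<in> ball x e" using that e(1) by (auto simp: dist_real_def)
    then show ?thesis using e(2) by blast
  qed
  then have "x + e/2 \<in> prolong D a b" using assms(2,5) e(1) by (auto simp: prolong_right_iff)
  moreover have "b \<in> prolong D a b" using assms(2) by (auto intro: prolong_segment)
  ultimately show ?thesis unfolding inner_def using assms(5) e(1) by (meson half_gt_zero less_add_same_cancel1)
qed

lemma prolong_not_hit_inner:
  assumes "closed D" "a < b" "x \<in> prolong D a b" "x \<notin> D" "x \<noteq> a" "x \<noteq> b"
  shows "inner (prolong D a b) x"
proof -
  consider "a < x \<and> x < b" | "b < x" | "x < a" using assms(5,6) by linarith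
  then show ?thesis
  proof cases
    case 1
    moreover have "a \<in> prolong D a b" "b \<in> prolong D a b" using assms(2) by (auto intro: prolong_segment)
    ultimately show ?thesis unfolding inner_def by blast
  next
    case 2 then show ?thesis using prolong_not_hit_larger assms by blast
  next
    case 3
    have "inner (prolong (uminus ` D) (- b) (- a)) (- x)"
      using assms 3 by (intro prolong_not_hit_larger) (auto simp: closed_negations prolong_uminus)
    then show ?thesis by (simp add: prolong_uminus inner_uminus)
  qed
qed

section \<open>Drawn rays in one coordinate\<close>

lemma drawn_ray_scaled:
  assumes "l > 0" "v - w = l *\<^sub>R u"
  shows "drawn_ray B v w = {v + t *\<^sub>R u | t. 0 \<le> t \<and> (\<forall>s. 0 \<le> s \<and> s < t \<longrightarrow> v + s *\<^sub>R u \<notin> B)}"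
proof -
  have "v + t *\<^sub>R u \<in> drawn_ray B v w"
    if t: "0 \<le> t" "\<forall>s. 0 \<le> s \<and> s < t \<longrightarrow> v + s *\<^sub>R u \<notin> B" for t
  proof -
    have "v + (t / l) *\<^sub>R (v - w) = v + t *\<^sub>R u" using assms by simp
    moreover have "v + s *\<^sub>R (v - w) \<notin> B" if s: "0 \<le> s" "s < t / l" for s
    proof -
      have "s * l < t" using s assms(1) by (simp add: pos_less_divide_eq)
      then show ?thesis using t(2)[rule_format, of "s * l"] s assms by simp
    qed
    ultimately show ?thesis unfolding drawn_ray_def using t(1) assms(1)
      by (intro CollectI exI[of _ "t / l"]) auto
  qed
  moreover have "\<exists>t'\<ge>0. v + t *\<^sub>R (v - w) = v + t' *\<^sub>R u \<and> (\<forall>s. 0 \<le> s \<and> s < t' \<longrightarrow> v + s *\<^sub>R u \<notin> B)"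
    if t: "0 \<le> t" "\<forall>s. 0 \<le> s \<and> s < t \<longrightarrow> v + s *\<^sub>R (v - w) \<notin> B" for t
  proof (intro exI[of _ "t * l"] conjI allI impI)
    fix s assume s: "0 \<le> s \<and> s < t * l"
    then have "s / l < t" using assms(1) by (simp add: pos_divide_less_eq)
    then show "v + s *\<^sub>R u \<notin> B" using t(2)[rule_format, of "s / l"] s assms by simp
  qed (use t assms in auto)
  ultimately show ?thesis unfolding drawn_ray_def by blast
qed

text \<open>\<open>f\<close> parametrises the line by a coordinate with value \<open>c\<close> at
  the start, and \<open>\<sigma>\<close>, which is 1 or -1, tells whether this coordinate grows
  along the ray. All four directions are instances.\<close>

lemma drawn_ray_image:
  fixes f :: "real \<Rightarrow> point" and \<sigma> :: real
  assumes "l > 0" "v - w = l *\<^sub>R u" "\<sigma> * \<sigma> = 1" "\<And>t. f (c + \<sigma> * t) = v + t *\<^sub>R u"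
  shows "drawn_ray B v w =
    f ` {x. 0 \<le> \<sigma> * (x - c) \<and> (\<forall>t. 0 \<le> \<sigma> * (t - c) \<and> \<sigma> * (t - c) < \<sigma> * (x - c) \<longrightarrow> f t \<notin> B)}"
proof -
  have f: "f x = v + (\<sigma> * (x - c)) *\<^sub>R u" for x
    using assms(4)[of "\<sigma> * (x - c)"] assms(3) by (simp add: mult.assoc[symmetric])
  have inv: "\<sigma> * ((c + \<sigma> * t) - c) = t" for t using assms(3) by (simp add: mult.assoc[symmetric])
  have all: "(\<forall>t. P (\<sigma> * (t - c))) \<longleftrightarrow> (\<forall>s. P s)" for P by (metis inv)
  have "drawn_ray B v w = {v + t *\<^sub>R u | t. 0 \<le> t \<and> (\<forall>s. 0 \<le> s \<and> s < t \<longrightarrow> v + s *\<^sub>R u \<notin> B)}"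
    by (rule drawn_ray_scaled[OF assms(1,2)])
  also have "\<dots> = f ` {x. 0 \<le> \<sigma> * (x - c) \<and> (\<forall>s. 0 \<le> s \<and> s < \<sigma> * (x - c) \<longrightarrow> v + s *\<^sub>R u \<notin> B)}"
    (is "?A = f ` ?X")
  proof
    show "f ` ?X \<subseteq> ?A" unfolding f by blast
    show "?A \<subseteq> f ` ?X"
    proof
      fix z assume "z \<in> ?A"
      then obtain t where t: "z = v + t *\<^sub>R u" "0 \<le> t" "\<forall>s. 0 \<le> s \<and> s < t \<longrightarrow> v + s *\<^sub>R u \<notin> B" by blast
      then have "c + \<sigma> * t \<in> ?X" unfolding mem_Collect_eq inv by blast
      then show "z \<in> f ` ?X" using assms(4)[of t] t(1) by (intro image_eqI[of _ f "c + \<sigma> * t"]) auto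
    qed
  qed
  also have "\<dots> = f ` {x. 0 \<le> \<sigma> * (x - c) \<and> (\<forall>t. 0 \<le> \<sigma> * (t - c) \<and> \<sigma> * (t - c) < \<sigma> * (x - c) \<longrightarrow> f t \<notin> B)}"
    unfolding f all[where P = "\<lambda>s. 0 \<le> s \<and> s < \<sigma> * (_ - c) \<longrightarrow> v + s *\<^sub>R u \<notin> B"] ..
  finally show ?thesis .
qed

lemma drawn_ray_right:
  assumes "a < b"
  shows "drawn_ray B (b, y) (a, y) = {x. b \<le> x \<and> (\<forall>t. b \<le> t \<and> t < x \<longrightarrow> (t, y) \<notin> B)} \<times> {y}"
  using assms by (subst drawn_ray_image[of "b - a" _ _ "(1, 0)" 1 "\<lambda>x. (x, y)" b]) auto

lemma drawn_ray_left:
  assumes "a < b"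
  shows "drawn_ray B (a, y) (b, y) = {x. x \<le> a \<and> (\<forall>t. x < t \<and> t \<le> a \<longrightarrow> (t, y) \<notin> B)} \<times> {y}"
  using assms by (subst drawn_ray_image[of "b - a" _ _ "(-1, 0)" "-1" "\<lambda>x. (x, y)" a]) auto

lemma drawn_ray_up:
  assumes "a < b"
  shows "drawn_ray B (x, b) (x, a) = {x} \<times> {y. b \<le> y \<and> (\<forall>t. b \<le> t \<and> t < y \<longrightarrow> (x, t) \<notin> B)}"
  using assms by (subst drawn_ray_image[of "b - a" _ _ "(0, 1)" 1 "\<lambda>y. (x, y)" b]) auto

lemma drawn_ray_down:
  assumes "a < b"
  shows "drawn_ray B (x, a) (x, b) = {x} \<times> {y. y \<le> a \<and> (\<forall>t. y < t \<and> t \<le> a \<longrightarrow> (x, t) \<notin> B)}"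
  using assms by (subst drawn_ray_image[of "b - a" _ _ "(0, -1)" "-1" "\<lambda>y. (x, y)" a]) auto

lemma prolong_eq_drawn_h:
  assumes "a < b"
  shows "prolong {x. (x, y) \<in> B} a b \<times> {y} =
    {a..b} \<times> {y} \<union> drawn_ray B (b, y) (a, y) \<union> drawn_ray B (a, y) (b, y)"
  unfolding prolong_def drawn_ray_right[OF assms] drawn_ray_left[OF assms] by auto

lemma prolong_eq_drawn_v:
  assumes "a < b"
  shows "{x} \<times> prolong {y. (x, y) \<in> B} a b =
    {x} \<times> {a..b} \<union> drawn_ray B (x, b) (x, a) \<union> drawn_ray B (x, a) (x, b)"
  unfolding prolong_def drawn_ray_up[OF assms] drawn_ray_down[OF assms] by auto

text \<open>The portion \<open>drawn_ray {} v w\<close> is the full ray, and only obstacles on it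
  can matter.\<close>

lemma drawn_ray_cong:
  assumes "\<And>z. z \<in> drawn_ray {} v w \<Longrightarrow> z \<in> B \<longleftrightarrow> z \<in> B'"
  shows "drawn_ray B v w = drawn_ray B' v w"
proof -
  have "v + s *\<^sub>R (v - w) \<in> B \<longleftrightarrow> v + s *\<^sub>R (v - w) \<in> B'" if "0 \<le> s" for s
    using assms[of "v + s *\<^sub>R (v - w)"] that unfolding drawn_ray_def by auto
  then have "(\<forall>s. 0 \<le> s \<and> s < t \<longrightarrow> v + s *\<^sub>R (v - w) \<notin> B) \<longleftrightarrow>
      (\<forall>s. 0 \<le> s \<and> s < t \<longrightarrow> v + s *\<^sub>R (v - w) \<notin> B')" for t by blast
  then show ?thesis unfolding drawn_ray_def by simp
qed

lemma drawn_ray_subset: "drawn_ray B v w \<subseteq> drawn_ray {} v w"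
  unfolding drawn_ray_def by auto

lemma draw_rays_append: "draw_rays C M R (us @ vs) = draw_rays C M (draw_rays C M R us) vs"
  by (induction us arbitrary: R) auto

text \<open>Pairwise disjoint full rays do not block each other, so their order is irrelevant.\<close>

lemma draw_rays_disjoint:
  assumes "distinct vs"
    and "\<And>u v. u \<in> set vs \<Longrightarrow> v \<in> set vs \<Longrightarrow> u \<noteq> v \<Longrightarrow>
      drawn_ray {} u (partner M u) \<inter> drawn_ray {} v (partner M v) = {}"
  shows "draw_rays C M R vs = R \<union> (\<Union>v\<in>set vs.
    drawn_ray ((\<Union>e \<in> M - {{v, partner M v}}. convex hull e) \<union> R \<union> frontier C) v (partner M v))"
  using assms
proof (induction vs arbitrary: R)
  case (Cons v vs)
  let ?B = "\<lambda>u. \<Union>e \<in> M - {{u, partner M u}}. convex hull e"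
  let ?D = "drawn_ray (?B v \<union> R \<union> frontier C) v (partner M v)"
  have "drawn_ray (?B u \<union> (R \<union> ?D) \<union> frontier C) u (partner M u) =
      drawn_ray (?B u \<union> R \<union> frontier C) u (partner M u)" if u: "u \<in> set vs" for u
  proof (rule drawn_ray_cong)
    fix z assume z: "z \<in> drawn_ray {} u (partner M u)"
    have "z \<notin> ?D"
      using Cons.prems(2)[of u v] Cons.prems(1) u z drawn_ray_subset[of _ v "partner M v"] by auto
    then show "z \<in> ?B u \<union> (R \<union> ?D) \<union> frontier C \<longleftrightarrow> z \<in> ?B u \<union> R \<union> frontier C" by blast
  qed
  then show ?case using Cons.IH[of "R \<union> ?D"] Cons.prems by auto
qed simp

section \<open>The arrangement of an axis-parallel matching\<close>

lemma convex_hull_horizontal: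
  fixes a b y :: real
  assumes "a \<le> b"
  shows "convex hull {(a, y), (b, y)} = {a..b} \<times> {y}"
proof
  have "{(a, y), (b, y)} \<subseteq> {a..b} \<times> {y}" using assms by auto
  then show "convex hull {(a, y), (b, y)} \<subseteq> {a..b} \<times> {y}"
    by (intro hull_minimal convex_Times) auto
  have "(x, y) \<in> convex hull {(a, y), (b, y)}" if "x \<in> {a..b}" for x
    using that by (intro convex_between_h[of "convex hull {(a, y), (b, y)}" a y b x] convex_convex_hull hull_inc) auto
  then show "{a..b} \<times> {y} \<subseteq> convex hull {(a, y), (b, y)}" by auto
qed

lemma convex_hull_vertical:
  fixes a b x :: real
  assumes "a \<le> b"
  shows "convex hull {(x, a), (x, b)} = {x} \<times> {a..b}"
proof
  have "{(x, a), (x, b)} \<subseteq> {x} \<times> {a..b}" using assms by auto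
  then show "convex hull {(x, a), (x, b)} \<subseteq> {x} \<times> {a..b}"
    by (intro hull_minimal convex_Times) auto
  have "(x, y) \<in> convex hull {(x, a), (x, b)}" if "y \<in> {a..b}" for y
    using that by (intro convex_between_v[of "convex hull {(x, a), (x, b)}" x a b y] convex_convex_hull hull_inc) auto
  then show "{x} \<times> {a..b} \<subseteq> convex hull {(x, a), (x, b)}" by auto
qed

lemma collinear_same_snd:
  fixes A :: "point set"
  assumes "\<And>p. p \<in> A \<Longrightarrow> snd p = y"
  shows "collinear A"
  unfolding collinear_def
proof (intro exI[of _ "(1, 0)"] ballI)
  fix p q assume "p \<in> A" "q \<in> A"
  then show "\<exists>c. p - q = c *\<^sub>R (1, 0)"
    using assms by (intro exI[of _ "fst p - fst q"]) (auto simp: prod_eq_iff)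
qed

lemma collinear_same_fst:
  fixes A :: "point set"
  assumes "\<And>p. p \<in> A \<Longrightarrow> fst p = x"
  shows "collinear A"
  unfolding collinear_def
proof (intro exI[of _ "(0, 1)"] ballI)
  fix p q assume "p \<in> A" "q \<in> A"
  then show "\<exists>c. p - q = c *\<^sub>R (0, 1)"
    using assms by (intro exI[of _ "snd p - snd q"]) (auto simp: prod_eq_iff)
qed

definition left_x :: "point set \<Rightarrow> real" where "left_x e = Min (fst ` e)"
definition right_x :: "point set \<Rightarrow> real" where "right_x e = Max (fst ` e)"
definition low_y :: "point set \<Rightarrow> real" where "low_y e = Min (snd ` e)"
definition high_y :: "point set \<Rightarrow> real" where "high_y e = Max (snd ` e)"

lemmas coord_defs = left_x_def right_x_def low_y_def high_y_def

locale axis_matching =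
  fixes P :: "point set" and M :: "point set set" and C :: "point set"
  assumes matching: "perfect_matching P M"
    and position: "general_position P"
    and parallel: "axis_parallel M"
    and convex_C: "convex C"
    and hull_C: "\<And>e. e \<in> M \<Longrightarrow> convex hull e \<subseteq> C"
    and hull_frontier: "\<And>e. e \<in> M \<Longrightarrow> \<not> convex hull e \<subseteq> frontier C"
begin

lemma finite_P: "finite P"
  using matching unfolding perfect_matching_def geometric_graph_def by blast

lemma edge_pair: "e \<in> M \<Longrightarrow> \<exists>v\<in>P. \<exists>w\<in>P. v \<noteq> w \<and> e = {v, w}"
  using matching unfolding perfect_matching_def geometric_graph_def by blast

lemma edge_subset: "e \<in> M \<Longrightarrow> e \<subseteq> P"
  using edge_pair by blast

lemma finite_M: "finite M"
  using finite_subset[of M "Pow P"] finite_P edge_subset by auto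

lemma edges_disjoint:
  assumes "e \<in> M" "f \<in> M" "v \<in> e" "v \<in> f"
  shows "e = f"
proof -
  have "v \<in> P" using assms edge_subset by blast
  then have "card {e \<in> M. v \<in> e} = 1" using matching unfolding perfect_matching_def by blast
  then obtain g where "{e \<in> M. v \<in> e} = {g}" by (rule card_1_singletonE)
  moreover have "e \<in> {e \<in> M. v \<in> e}" "f \<in> {e \<in> M. v \<in> e}" using assms by auto
  ultimately show ?thesis by simp
qed

lemma hulls_disjoint:
  assumes "e \<in> M" "f \<in> M" "e \<noteq> f"
  shows "convex hull e \<inter> convex hull f = {}"
proof -
  have "convex hull e \<inter> convex hull f \<subseteq> e \<inter> f"
    using matching assms unfolding perfect_matching_def noncrossing_def by simp
  moreover have "e \<inter> f = {}" using edges_disjoint[OF assms(1,2)] assms(3) by blast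
  ultimately show ?thesis by simp
qed

lemma partner_eq:
  assumes "{v, w} \<in> M"
  shows "partner M v = w"
  unfolding partner_def
proof (rule the_equality[where P = "\<lambda>w. {v, w} \<in> M", OF assms])
  fix u assume "{v, u} \<in> M"
  then have "{v, u} = {v, w}" using edges_disjoint assms by blast
  then show "u = w" by (auto simp: doubleton_eq_iff)
qed

definition EH :: "point set set" where "EH = {e \<in> M. low_y e = high_y e}"
definition EV :: "point set set" where "EV = {e \<in> M. left_x e = right_x e}"

lemma edge_form:
  assumes "e \<in> M"
  shows "e \<in> EH \<and> e \<notin> EV \<and> left_x e < right_x e \<and> high_y e = low_y e \<and> e = {(left_x e, low_y e), (right_x e, low_y e)} \<or>
    e \<in> EV \<and> e \<notin> EH \<and> low_y e < high_y e \<and> right_x e = left_x e \<and> e = {(left_x e, low_y e), (left_x e, high_y e)}"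
proof -
  obtain v w where vw: "v \<noteq> w" "e = {v, w}" using edge_pair assms by blast
  then have "fst v = fst w \<or> snd v = snd w" using parallel assms unfolding axis_parallel_def by blast
  then show ?thesis
    using vw assms unfolding EH_def EV_def coord_defs
    by (cases v; cases w) (auto simp: min_def max_def)
qed

lemma EH_M: "k \<in> EH \<Longrightarrow> k \<in> M" and EV_M: "j \<in> EV \<Longrightarrow> j \<in> M"
  unfolding EH_def EV_def by auto

lemma M_split: "M = EH \<union> EV" "EH \<inter> EV = {}"
  using edge_form EH_M EV_M by blast+

lemma EH_form: "k \<in> EH \<Longrightarrow> left_x k < right_x k" "k \<in> EH \<Longrightarrow> k = {(left_x k, low_y k), (right_x k, low_y k)}"
    "k \<in> EH \<Longrightarrow> high_y k = low_y k"
  using edge_form EH_M by blast+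

lemma EV_form: "j \<in> EV \<Longrightarrow> low_y j < high_y j" "j \<in> EV \<Longrightarrow> j = {(left_x j, low_y j), (left_x j, high_y j)}"
    "j \<in> EV \<Longrightarrow> right_x j = left_x j"
  using edge_form EV_M by blast+

lemma EH_P: "k \<in> EH \<Longrightarrow> (left_x k, low_y k) \<in> P \<and> (right_x k, low_y k) \<in> P"
  using EH_form(2) EH_M edge_subset by blast

lemma EV_P: "j \<in> EV \<Longrightarrow> (left_x j, low_y j) \<in> P \<and> (left_x j, high_y j) \<in> P"
  using EV_form(2) EV_M edge_subset by blast

lemma EH_hull: "k \<in> EH \<Longrightarrow> convex hull k = {left_x k..right_x k} \<times> {low_y k}"
  using convex_hull_horizontal[of "left_x k" "right_x k" "low_y k"] EH_form(1,2)[of k] by simp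

lemma EV_hull: "j \<in> EV \<Longrightarrow> convex hull j = {left_x j} \<times> {low_y j..high_y j}"
  using convex_hull_vertical[of "low_y j" "high_y j" "left_x j"] EV_form(1,2)[of j] by simp

lemma no_three_same_snd:
  assumes "a \<in> P" "b \<in> P" "c \<in> P" "snd a = y" "snd b = y" "snd c = y" "a \<noteq> b"
  shows "c = a \<or> c = b"
proof (rule ccontr)
  assume "\<not> (c = a \<or> c = b)"
  moreover have "collinear {a, b, c}" by (rule collinear_same_snd[of _ y]) (use assms in auto)
  ultimately show False using position assms(1,2,3,7) unfolding general_position_def by metis
qed

lemma no_three_same_fst:
  assumes "a \<in> P" "b \<in> P" "c \<in> P" "fst a = x" "fst b = x" "fst c = x" "a \<noteq> b"
  shows "c = a \<or> c = b"
proof (rule ccontr)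
  assume "\<not> (c = a \<or> c = b)"
  moreover have "collinear {a, b, c}" by (rule collinear_same_fst[of _ x]) (use assms in auto)
  ultimately show False using position assms(1,2,3,7) unfolding general_position_def by metis
qed

text \<open>The two ends of \<open>k\<close> already share this height; a third vertex there would
  be collinear with them. Distinctness of all coordinates in the arrangement rests on this.\<close>

lemma EH_same_height:
  assumes "k \<in> EH" "c \<in> P" "snd c = low_y k"
  shows "c \<in> k"
proof -
  have "c = (left_x k, low_y k) \<or> c = (right_x k, low_y k)"
    using EH_P[OF assms(1)] EH_form(1)[OF assms(1)] assms
    by (intro no_three_same_snd[of _ _ c "low_y k"]) auto
  then show ?thesis using EH_form(2)[OF assms(1)] by blast
qed

lemma EV_same_abscissa:
  assumes "j \<in> EV" "c \<in> P" "fst c = left_x j"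
  shows "c \<in> j"
proof -
  have "c = (left_x j, low_y j) \<or> c = (left_x j, high_y j)"
    using EV_P[OF assms(1)] EV_form(1)[OF assms(1)] assms
    by (intro no_three_same_fst[of _ _ c "left_x j"]) auto
  then show ?thesis using EV_form(2)[OF assms(1)] by blast
qed

lemma inj_low: "inj_on low_y EH"
proof
  fix k k' assume k: "k \<in> EH" "k' \<in> EH" "low_y k = low_y k'"
  then have "(left_x k', low_y k') \<in> k" using EH_same_height[OF k(1)] EH_P[OF k(2)] by simp
  moreover have "(left_x k', low_y k') \<in> k'" using EH_form(2)[OF k(2)] by blast
  ultimately show "k = k'" using edges_disjoint EH_M k by blast
qed

lemma inj_left: "inj_on left_x EV"
proof
  fix k k' assume k: "k \<in> EV" "k' \<in> EV" "left_x k = left_x k'"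
  then have "(left_x k', low_y k') \<in> k" using EV_same_abscissa[OF k(1)] EV_P[OF k(2)] by simp
  moreover have "(left_x k', low_y k') \<in> k'" using EV_form(2)[OF k(2)] by blast
  ultimately show "k = k'" using edges_disjoint EV_M k by blast
qed

lemma EH_EV_neq:
  assumes "k \<in> EH" "j \<in> EV"
  shows "left_x j \<noteq> left_x k" "left_x j \<noteq> right_x k" "low_y k \<noteq> low_y j" "low_y k \<noteq> high_y j"
proof -
  have disj: "v \<notin> j" if "v \<in> k" for v
    using edges_disjoint[of k j v] that assms EH_M EV_M M_split(2) by blast
  have k: "(left_x k, low_y k) \<in> k" "(right_x k, low_y k) \<in> k" using EH_form(2)[OF assms(1)] by blast+
  have j: "(left_x j, low_y j) \<in> j" "(left_x j, high_y j) \<in> j" using EV_form(2)[OF assms(2)] by blast+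
  show "left_x j \<noteq> left_x k" using EV_same_abscissa[OF assms(2), of "(left_x k, low_y k)"] EH_P[OF assms(1)] disj[OF k(1)] by auto
  show "left_x j \<noteq> right_x k" using EV_same_abscissa[OF assms(2), of "(right_x k, low_y k)"] EH_P[OF assms(1)] disj[OF k(2)] by auto
  show "low_y k \<noteq> low_y j" using EH_same_height[OF assms(1), of "(left_x j, low_y j)"] EV_P[OF assms(2)] disj j(1) by auto
  show "low_y k \<noteq> high_y j" using EH_same_height[OF assms(1), of "(left_x j, high_y j)"] EV_P[OF assms(2)] disj j(2) by auto
qed

section \<open>The extended segments as prolonged intervals\<close>

definition SV :: "point set" where "SV = (\<Union>j\<in>EV. convex hull j)"

text \<open>Other horizontal segments lie at other heights and no vertical ray has been drawn yet,
  so vertical segments and the frontier are the only obstacles.\<close>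

definition hh :: "point set \<Rightarrow> real set" where
  "hh k = prolong {x. (x, low_y k) \<in> SV \<union> frontier C} (left_x k) (right_x k)"

definition HX :: "point set" where "HX = (\<Union>k\<in>EH. hh k \<times> {low_y k})"

text \<open>Other vertical segments have other abscissae, and \<open>HX\<close> already includes the
  horizontal segments together with their rays.\<close>

definition vv :: "point set \<Rightarrow> real set" where
  "vv j = prolong {y. (left_x j, y) \<in> HX \<union> frontier C} (low_y j) (high_y j)"

definition VX :: "point set" where "VX = (\<Union>j\<in>EV. {left_x j} \<times> vv j)"

lemma closed_line_h: "closed B \<Longrightarrow> closed {x. (x, y) \<in> B}" for B :: "point set" and y :: real
  using continuous_closed_vimage[of B "\<lambda>x. (x, y)"] by (simp add: vimage_def)

lemma closed_line_v: "closed B \<Longrightarrow> closed {y. (x, y) \<in> B}" for B :: "point set" and x :: real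
  using continuous_closed_vimage[of B "\<lambda>y. (x, y)"] by (simp add: vimage_def)

lemma finite_EH: "finite EH" and finite_EV: "finite EV"
  using finite_M unfolding EH_def EV_def by auto

lemma closed_SV: "closed (SV \<union> frontier C)"
  unfolding SV_def using finite_EV by (auto intro!: closed_Un closed_UN closed_Times simp: EV_hull)

lemma closed_hh: "k \<in> EH \<Longrightarrow> closed (hh k)"
  unfolding hh_def by (intro prolong_closed closed_line_h closed_SV EH_form(1))

lemma closed_HX: "closed (HX \<union> frontier C)"
  unfolding HX_def using finite_EH by (auto intro!: closed_Un closed_UN closed_Times closed_hh)

lemma mem_SV: "(x, y) \<in> SV \<longleftrightarrow> (\<exists>j\<in>EV. x = left_x j \<and> low_y j \<le> y \<and> y \<le> high_y j)"
  unfolding SV_def by (auto simp: EV_hull)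

lemma mem_HX: "(x, y) \<in> HX \<longleftrightarrow> (\<exists>k\<in>EH. y = low_y k \<and> x \<in> hh k)"
  unfolding HX_def by auto

lemma hull_interior:
  assumes "e \<in> M"
  obtains p where "p \<in> convex hull e" "p \<in> interior C"
  using hull_C[OF assms] hull_frontier[OF assms] closure_subset[of C] unfolding frontier_def by blast

text \<open>Some point of the segment is interior to \<open>C\<close>, and an open segment from an
  interior point to a point of the closure stays in the interior.\<close>

lemma hseg_interior:
  assumes k: "k \<in> EH" and x: "left_x k < x" "x < right_x k"
  shows "(x, low_y k) \<in> interior C"
proof -
  obtain p where "p \<in> convex hull k" and pI: "p \<in> interior C" using hull_interior EH_M k by blast
  then obtain u where u: "p = (u, low_y k)" "left_x k \<le> u" "u \<le> right_x k" using EH_hull[OF k] by auto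
  have "{left_x k..right_x k} \<times> {low_y k} \<subseteq> closure C"
    using hull_C[OF EH_M[OF k]] closure_subset[of C] unfolding EH_hull[OF k] by blast
  then have C: "(left_x k, low_y k) \<in> closure C" "(right_x k, low_y k) \<in> closure C"
    using EH_form(1)[OF k] by (auto simp: subset_iff)
  have seg: "(x, low_y k) \<in> interior C"
    if w: "(w, low_y k) \<in> closure C" and "w < x \<and> x < u \<or> u < x \<and> x < w" for w
  proof -
    have "open_segment p (w, low_y k) \<subseteq> interior C"
      by (rule in_interior_closure_convex_segment[OF convex_C pI w])
    moreover have "(x, low_y k) \<in> closed_segment p (w, low_y k)"
    proof (cases "u \<le> w")
      case True
      then show ?thesis using that(2) unfolding u(1) segment_convex_hull convex_hull_horizontal[OF True] by auto
    next
      case False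
      then have "w \<le> u" by simp
      then show ?thesis using that(2) convex_hull_horizontal[OF \<open>w \<le> u\<close>, of "low_y k"]
        unfolding u(1) segment_convex_hull insert_commute[of "(u, low_y k)"] by auto
    qed
    ultimately show ?thesis using that(2) unfolding open_segment_def u(1) by auto
  qed
  show ?thesis
    using seg[OF C(1)] seg[OF C(2)] x pI u(1) by (cases x u rule: linorder_cases) auto
qed

lemma vseg_interior:
  assumes j: "j \<in> EV" and y: "low_y j < y" "y < high_y j"
  shows "(left_x j, y) \<in> interior C"
proof -
  obtain p where "p \<in> convex hull j" and pI: "p \<in> interior C" using hull_interior EV_M j by blast
  then obtain u where u: "p = (left_x j, u)" "low_y j \<le> u" "u \<le> high_y j" using EV_hull[OF j] by auto
  have "{left_x j} \<times> {low_y j..high_y j} \<subseteq> closure C"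
    using hull_C[OF EV_M[OF j]] closure_subset[of C] unfolding EV_hull[OF j] by blast
  then have C: "(left_x j, low_y j) \<in> closure C" "(left_x j, high_y j) \<in> closure C"
    using EV_form(1)[OF j] by (auto simp: subset_iff)
  have seg: "(left_x j, y) \<in> interior C"
    if w: "(left_x j, w) \<in> closure C" and "w < y \<and> y < u \<or> u < y \<and> y < w" for w
  proof -
    have "open_segment p (left_x j, w) \<subseteq> interior C"
      by (rule in_interior_closure_convex_segment[OF convex_C pI w])
    moreover have "(left_x j, y) \<in> closed_segment p (left_x j, w)"
    proof (cases "u \<le> w")
      case True
      then show ?thesis using that(2) unfolding u(1) segment_convex_hull convex_hull_vertical[OF True] by auto
    next
      case False
      then have "w \<le> u" by simp
      then show ?thesis using that(2) convex_hull_vertical[OF \<open>w \<le> u\<close>, of "left_x j"]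
        unfolding u(1) segment_convex_hull insert_commute[of "(left_x j, u)"] by auto
    qed
    ultimately show ?thesis using that(2) unfolding open_segment_def u(1) by auto
  qed
  show ?thesis
    using seg[OF C(1)] seg[OF C(2)] y pI u(1) by (cases y u rule: linorder_cases) auto
qed

lemma not_interior_frontier: "p \<in> frontier C \<Longrightarrow> p \<notin> interior C"
  unfolding frontier_def by blast

lemma row_interval: "is_interval {x. (x, y) \<in> interior C}"
  unfolding is_interval_1 using convex_between_h[OF convex_interior[OF convex_C]] by blast

lemma column_interval: "is_interval {y. (x, y) \<in> interior C}"
  unfolding is_interval_1 using convex_between_v[OF convex_interior[OF convex_C]] by blast

lemma row_frontier: "{x. (x, y) \<in> frontier C} \<inter> {x. (x, y) \<in> interior C} = {}"
  and column_frontier: "{y. (x, y) \<in> frontier C} \<inter> {y. (x, y) \<in> interior C} = {}"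
  using not_interior_frontier by blast+

lemma left_end:
  assumes k: "k \<in> EH"
  shows "(\<forall>x<left_x k. (x, low_y k) \<in> interior C \<longrightarrow> x \<in> hh k) \<or>
      (\<exists>j\<in>EV. left_x j \<in> hh k \<and> (\<forall>x\<in>hh k. left_x j \<le> x) \<and> low_y j < low_y k \<and> low_y k < high_y j)"
proof -
  have "{left_x k<..<right_x k} \<subseteq> {x. (x, low_y k) \<in> interior C}" using hseg_interior[OF k] by auto
  then consider "\<forall>x<left_x k. (x, low_y k) \<in> interior C \<longrightarrow> x \<in> hh k" |
    d where "(d, low_y k) \<in> SV" "d \<in> hh k" "\<forall>x\<in>hh k. d \<le> x"
    using prolong_left_cases[OF closed_line_h[OF closed_SV] EH_form(1)[OF k] row_interval _ row_frontier, of "low_y k"]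
    unfolding hh_def by blast
  then show ?thesis
  proof cases
    case 2
    then obtain j where j: "j \<in> EV" "d = left_x j" "low_y j \<le> low_y k" "low_y k \<le> high_y j"
      using mem_SV by auto
    then have "low_y j < low_y k" "low_y k < high_y j" using EH_EV_neq[OF k j(1)] by auto
    then show ?thesis using j 2 by blast
  qed blast
qed

lemma right_end:
  assumes k: "k \<in> EH"
  shows "(\<forall>x>right_x k. (x, low_y k) \<in> interior C \<longrightarrow> x \<in> hh k) \<or>
      (\<exists>j\<in>EV. left_x j \<in> hh k \<and> (\<forall>x\<in>hh k. x \<le> left_x j) \<and> low_y j < low_y k \<and> low_y k < high_y j)"
proof -
  have "{left_x k<..<right_x k} \<subseteq> {x. (x, low_y k) \<in> interior C}" using hseg_interior[OF k] by auto
  then consider "\<forall>x>right_x k. (x, low_y k) \<in> interior C \<longrightarrow> x \<in> hh k" |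
    d where "(d, low_y k) \<in> SV" "d \<in> hh k" "\<forall>x\<in>hh k. x \<le> d"
    using prolong_right_cases[OF closed_line_h[OF closed_SV] EH_form(1)[OF k] row_interval _ row_frontier, of "low_y k"]
    unfolding hh_def by blast
  then show ?thesis
  proof cases
    case 2
    then obtain j where j: "j \<in> EV" "d = left_x j" "low_y j \<le> low_y k" "low_y k \<le> high_y j"
      using mem_SV by auto
    then have "low_y j < low_y k" "low_y k < high_y j" using EH_EV_neq[OF k j(1)] by auto
    then show ?thesis using j 2 by blast
  qed blast
qed

text \<open>A connected set that meets \<open>C\<close> without meeting its frontier cannot leave
  \<open>C\<close>.\<close>

lemma column_interior:
  assumes "(x, a) \<in> interior C" "\<And>t. t \<in> closed_segment a b \<Longrightarrow> (x, t) \<notin> frontier C"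
  shows "(x, b) \<in> interior C"
proof -
  let ?A = "(\<lambda>t. (x, t)) ` closed_segment a b"
  have "connected ?A" by (intro connected_continuous_image continuous_intros) auto
  moreover have "(x, a) \<in> ?A \<inter> C" using assms(1) interior_subset by auto
  moreover have "?A \<inter> frontier C = {}" using assms(2) by auto
  ultimately have "?A - C = {}" using connected_Int_frontier[of ?A C] by blast
  then have "(x, b) \<in> C" by auto
  then show ?thesis using assms(2)[of b] closure_subset[of C] unfolding frontier_def by auto
qed

text \<open>The only vertical segment on this line is \<open>j\<close> itself, and it does not
  contain the hit. So nothing stops \<open>k\<close> at the hit, and \<open>k\<close> passes through
  it.\<close>

lemma hit_inner:
  assumes j: "j \<in> EV" and k: "k \<in> EH" "left_x j \<in> hh k" "(left_x j, low_y k) \<notin> frontier C"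
    "low_y k \<le> low_y j \<or> high_y j \<le> low_y k"
  shows "inner (hh k) (left_x j)"
proof -
  have "(left_x j, low_y k) \<notin> SV"
  proof
    assume "(left_x j, low_y k) \<in> SV"
    then obtain i where i: "i \<in> EV" "left_x j = left_x i" "low_y i \<le> low_y k" "low_y k \<le> high_y i"
      using mem_SV by auto
    then have "i = j" using inj_left j by (auto dest: inj_onD)
    then show False using i k(4) EH_EV_neq[OF k(1) j] by auto
  qed
  then show ?thesis
    using k EH_EV_neq[OF k(1) j] closed_line_h[OF closed_SV] EH_form(1)[OF k(1)]
    unfolding hh_def by (intro prolong_not_hit_inner) auto
qed

lemma top_end:
  assumes j: "j \<in> EV"
  shows "(\<forall>y>high_y j. (left_x j, y) \<in> interior C \<longrightarrow> y \<in> vv j) \<or>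
      (\<exists>k\<in>EH. low_y k \<in> vv j \<and> (\<forall>y\<in>vv j. y \<le> low_y k) \<and> (left_x j, low_y k) \<in> interior C \<and>
         left_x j \<in> hh k \<and> inner (hh k) (left_x j))"
proof -
  have "{low_y j<..<high_y j} \<subseteq> {y. (left_x j, y) \<in> interior C}" using vseg_interior[OF j] by auto
  then consider "\<forall>y>high_y j. (left_x j, y) \<in> interior C \<longrightarrow> y \<in> vv j" |
    d where "(left_x j, d) \<in> HX" "(left_x j, d) \<notin> frontier C" "high_y j \<le> d" "d \<in> vv j" "\<forall>y\<in>vv j. y \<le> d"
    using prolong_right_cases[OF closed_line_v[OF closed_HX] EV_form(1)[OF j] column_interval _ column_frontier, of "left_x j"]
    unfolding vv_def by blast
  then show ?thesis
  proof cases
    case 2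
    then obtain k where k: "k \<in> EH" "d = low_y k" "left_x j \<in> hh k" using mem_HX by auto
    \<comment> \<open>The stopping point \<open>d\<close> is so far only known to avoid the
      frontier. The column from the interior point at height \<open>m\<close> to \<open>d\<close>
      avoids it too, which places \<open>d\<close> in the interior.\<close>
    define m where "m = (low_y j + high_y j) / 2"
    have m: "low_y j < m" "m < high_y j" using EV_form(1)[OF j] by (auto simp: m_def)
    have "(left_x j, t) \<notin> frontier C" if "t \<in> closed_segment m d" for t
    proof -
      have t: "m \<le> t" "t \<le> d" using that m 2(3) by (auto simp: closed_segment_eq_real_ivl split: if_splits)
      consider "t < high_y j" | "t = d" | "high_y j \<le> t" "t < d" using t by linarith
      then show ?thesis
      proof cases
        case 1
        then show ?thesis using vseg_interior[OF j, of t] t m not_interior_frontier by auto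
      next
        case 3
        then show ?thesis using 2(3,4) prolong_right_iff[OF EV_form(1)[OF j], of d] unfolding vv_def by auto
      qed (use 2(2) in simp)
    qed
    then have "(left_x j, d) \<in> interior C" using column_interior[OF vseg_interior[OF j m]] by blast
    moreover have "inner (hh k) (left_x j)" using hit_inner[OF j k(1,3)] k(2) 2(2,3) by auto
    ultimately show ?thesis using k 2(4,5) by blast
  qed blast
qed

lemma bottom_end:
  assumes j: "j \<in> EV"
  shows "(\<forall>y<low_y j. (left_x j, y) \<in> interior C \<longrightarrow> y \<in> vv j) \<or>
      (\<exists>k\<in>EH. low_y k \<in> vv j \<and> (\<forall>y\<in>vv j. low_y k \<le> y) \<and> (left_x j, low_y k) \<in> interior C \<and>
         left_x j \<in> hh k \<and> inner (hh k) (left_x j))"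
proof -
  have "{low_y j<..<high_y j} \<subseteq> {y. (left_x j, y) \<in> interior C}" using vseg_interior[OF j] by auto
  then consider "\<forall>y<low_y j. (left_x j, y) \<in> interior C \<longrightarrow> y \<in> vv j" |
    d where "(left_x j, d) \<in> HX" "(left_x j, d) \<notin> frontier C" "d \<le> low_y j" "d \<in> vv j" "\<forall>y\<in>vv j. d \<le> y"
    using prolong_left_cases[OF closed_line_v[OF closed_HX] EV_form(1)[OF j] column_interval _ column_frontier, of "left_x j"]
    unfolding vv_def by blast
  then show ?thesis
  proof cases
    case 2
    then obtain k where k: "k \<in> EH" "d = low_y k" "left_x j \<in> hh k" using mem_HX by auto
    define m where "m = (low_y j + high_y j) / 2"
    have m: "low_y j < m" "m < high_y j" using EV_form(1)[OF j] by (auto simp: m_def)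
    have "(left_x j, t) \<notin> frontier C" if "t \<in> closed_segment m d" for t
    proof -
      have t: "t \<le> m" "d \<le> t" using that m 2(3) by (auto simp: closed_segment_eq_real_ivl split: if_splits)
      consider "low_y j < t" | "t = d" | "t \<le> low_y j" "d < t" using t by linarith
      then show ?thesis
      proof cases
        case 1
        then show ?thesis using vseg_interior[OF j, of t] t m not_interior_frontier by auto
      next
        case 3
        then show ?thesis using 2(3,4) prolong_left_iff[OF EV_form(1)[OF j], of d] unfolding vv_def by auto
      qed (use 2(2) in simp)
    qed
    then have "(left_x j, d) \<in> interior C" using column_interior[OF vseg_interior[OF j m]] by blast
    moreover have "inner (hh k) (left_x j)" using hit_inner[OF j k(1,3)] k(2) 2(2,3) by auto
    ultimately show ?thesis using k 2(4,5) by blast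
  qed blast
qed

sublocale arr: axis_arrangement "interior C" EH EV low_y left_x right_x hh left_x low_y high_y vv
proof
  show "open (interior C)" "convex (interior C)" using convex_C by (auto intro: convex_interior)
  fix k assume k: "k \<in> EH"
  show "is_interval (hh k)" unfolding hh_def by (rule prolong_interval[OF EH_form(1)[OF k]])
  show "left_x k \<in> hh k" "right_x k \<in> hh k" unfolding hh_def using EH_form(1)[OF k] by (auto intro: prolong_segment)
next
  fix j assume j: "j \<in> EV"
  show "closed (vv j)" unfolding vv_def by (intro prolong_closed closed_line_v closed_HX EV_form(1) j)
  show "is_interval (vv j)" unfolding vv_def by (rule prolong_interval[OF EV_form(1)[OF j]])
  show "low_y j \<in> vv j" "high_y j \<in> vv j" unfolding vv_def using EV_form(1)[OF j] by (auto intro: prolong_segment)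
next
  fix k j assume kj: "k \<in> EH" "j \<in> EV"
  show "left_x j \<noteq> left_x k \<and> left_x j \<noteq> right_x k" "low_y k \<noteq> low_y j \<and> low_y k \<noteq> high_y j"
    using EH_EV_neq[OF kj] by auto
  assume h: "left_x j \<in> hh k"
  show "\<not> inner (hh k) (left_x j)" if y: "low_y j < low_y k" "low_y k < high_y j"
  proof -
    \<comment> \<open>The crossing lies on an obstacle of \<open>k\<close>, and outside the segment
      \<open>k\<close> because matching segments are disjoint; so \<open>hh k\<close> cannot extend
      beyond it.\<close>
    have hit: "(left_x j, low_y k) \<in> SV" using kj y mem_SV by force
    have "(left_x j, low_y k) \<in> convex hull j" using y EV_hull[OF kj(2)] by auto
    moreover have "convex hull k \<inter> convex hull j = {}"
      using hulls_disjoint EH_M EV_M kj M_split(2) by blast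
    ultimately have "(left_x j, low_y k) \<notin> convex hull k" by blast
    then have "left_x j \<notin> {left_x k..right_x k}" using EH_hull[OF kj(1)] by auto
    then consider "left_x j \<le> left_x k" | "right_x k \<le> left_x j" by fastforce
    then show ?thesis
    proof cases
      case 1
      then have "\<forall>x\<in>hh k. left_x j \<le> x"
        using prolong_hit_min[OF EH_form(1)[OF kj(1)], of "left_x j" "{x. (x, low_y k) \<in> SV \<union> frontier C}"]
          hit unfolding hh_def by simp
      then show ?thesis unfolding inner_def by force
    next
      case 2
      then have "\<forall>x\<in>hh k. x \<le> left_x j"
        using prolong_hit_max[OF EH_form(1)[OF kj(1)], of "left_x j" "{x. (x, low_y k) \<in> SV \<union> frontier C}"]
          hit unfolding hh_def by simp
      then show ?thesis unfolding inner_def by force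
    qed
  qed
  have hit: "(left_x j, low_y k) \<in> HX" using h kj mem_HX by blast
  fix y assume y: "y \<in> vv j"
  show "low_y k \<le> y" if "low_y k < low_y j"
    using prolong_hit_min[OF EV_form(1)[OF kj(2)], of "low_y k" "{y. (left_x j, y) \<in> HX \<union> frontier C}"]
      hit y that unfolding vv_def by simp
  show "y \<le> low_y k" if "high_y j < low_y k"
    using prolong_hit_max[OF EV_form(1)[OF kj(2)], of "low_y k" "{y. (left_x j, y) \<in> HX \<union> frontier C}"]
      hit y that unfolding vv_def by simp
qed (rule finite_EH finite_EV inj_low inj_left closed_hh EH_form(1) EV_form(1) hseg_interior vseg_interior
    left_end right_end top_end bottom_end; assumption)+

end

section \<open>The extension obtained by drawing all horizontal rays first\<close>

context axis_matching
begin

lemma partners_h: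
  assumes "k \<in> EH"
  shows "partner M (left_x k, low_y k) = (right_x k, low_y k)" "partner M (right_x k, low_y k) = (left_x k, low_y k)"
  using EH_form(2)[OF assms] EH_M[OF assms] by (auto intro!: partner_eq simp: insert_commute)

lemma partners_v:
  assumes "j \<in> EV"
  shows "partner M (left_x j, low_y j) = (left_x j, high_y j)" "partner M (left_x j, high_y j) = (left_x j, low_y j)"
  using EV_form(2)[OF assms] EV_M[OF assms] by (auto intro!: partner_eq simp: insert_commute)

abbreviation ray :: "point \<Rightarrow> point set" where "ray v \<equiv> drawn_ray {} v (partner M v)"

abbreviation others :: "point \<Rightarrow> point set" where
  "others v \<equiv> \<Union>e \<in> M - {{v, partner M v}}. convex hull e"

lemma ray_h:
  assumes "k \<in> EH"
  shows "ray (left_x k, low_y k) = {..left_x k} \<times> {low_y k}" "ray (right_x k, low_y k) = {right_x k..} \<times> {low_y k}"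
  unfolding partners_h[OF assms] drawn_ray_left[OF EH_form(1)[OF assms]] drawn_ray_right[OF EH_form(1)[OF assms]] by auto

lemma ray_v:
  assumes "j \<in> EV"
  shows "ray (left_x j, low_y j) = {left_x j} \<times> {..low_y j}" "ray (left_x j, high_y j) = {left_x j} \<times> {high_y j..}"
  unfolding partners_v[OF assms] drawn_ray_down[OF EV_form(1)[OF assms]] drawn_ray_up[OF EV_form(1)[OF assms]] by auto

lemma own_edge_h: "k \<in> EH \<Longrightarrow> {(left_x k, low_y k), (right_x k, low_y k)} = k"
  and own_edge_v: "j \<in> EV \<Longrightarrow> {(left_x j, low_y j), (left_x j, high_y j)} = j"
  using EH_form(2) EV_form(2) by auto

lemma ray_h_cases:
  assumes "k \<in> EH" "v \<in> k"
  shows "{v, partner M v} = k \<and> (v = (left_x k, low_y k) \<and> ray v = {..left_x k} \<times> {low_y k} \<or>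
    v = (right_x k, low_y k) \<and> ray v = {right_x k..} \<times> {low_y k})"
proof -
  have "v = (left_x k, low_y k) \<or> v = (right_x k, low_y k)" using own_edge_h[OF assms(1)] assms(2) by blast
  moreover have "{(right_x k, low_y k), (left_x k, low_y k)} = k" using own_edge_h[OF assms(1)] by (simp add: insert_commute)
  ultimately show ?thesis using ray_h[OF assms(1)] partners_h[OF assms(1)] own_edge_h[OF assms(1)]
    by (elim disjE) simp_all
qed

lemma ray_v_cases:
  assumes "j \<in> EV" "v \<in> j"
  shows "{v, partner M v} = j \<and> (v = (left_x j, low_y j) \<and> ray v = {left_x j} \<times> {..low_y j} \<or>
    v = (left_x j, high_y j) \<and> ray v = {left_x j} \<times> {high_y j..})"
proof -
  have "v = (left_x j, low_y j) \<or> v = (left_x j, high_y j)" using own_edge_v[OF assms(1)] assms(2) by blast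
  moreover have "{(left_x j, high_y j), (left_x j, low_y j)} = j" using own_edge_v[OF assms(1)] by (simp add: insert_commute)
  ultimately show ?thesis using ray_v[OF assms(1)] partners_v[OF assms(1)] own_edge_v[OF assms(1)]
    by (elim disjE) simp_all
qed

lemma rays_disjoint_h:
  assumes "u \<in> \<Union>EH" "v \<in> \<Union>EH" "u \<noteq> v"
  shows "ray u \<inter> ray v = {}"
proof -
  obtain k i where ki: "k \<in> EH" "u \<in> k" "i \<in> EH" "v \<in> i" using assms by blast
  then have "low_y i \<noteq> low_y k \<or> i = k" using inj_low by (auto dest: inj_onD)
  then show ?thesis
    using ray_h_cases[OF ki(1,2)] ray_h_cases[OF ki(3,4)] assms(3) EH_form(1)[OF ki(1)] by auto
qed

lemma rays_disjoint_v:
  assumes "u \<in> \<Union>EV" "v \<in> \<Union>EV" "u \<noteq> v"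
  shows "ray u \<inter> ray v = {}"
proof -
  obtain k i where ki: "k \<in> EV" "u \<in> k" "i \<in> EV" "v \<in> i" using assms by blast
  then have "left_x i \<noteq> left_x k \<or> i = k" using inj_left by (auto dest: inj_onD)
  then show ?thesis
    using ray_v_cases[OF ki(1,2)] ray_v_cases[OF ki(3,4)] assms(3) EV_form(1)[OF ki(1)] by auto
qed

text \<open>Reconciles the obstacles in the drawing process, which exclude just the own segment,
  with those in \<open>hh\<close>: another horizontal segment lies at a different height.\<close>

lemma others_on_h_line:
  assumes k: "k \<in> EH" and z: "snd z = low_y k"
  shows "z \<in> (\<Union>e \<in> M - {k}. convex hull e) \<longleftrightarrow> z \<in> SV"
proof
  assume "z \<in> (\<Union>e \<in> M - {k}. convex hull e)"
  then obtain e where e: "e \<in> M" "e \<noteq> k" "z \<in> convex hull e" by blast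
  have "e \<notin> EH"
  proof
    assume "e \<in> EH"
    then have "low_y e = low_y k" using e(3) z EH_hull by auto
    then show False using inj_low k \<open>e \<in> EH\<close> e(2) by (auto dest: inj_onD)
  qed
  then have "e \<in> EV" using e(1) M_split(1) by blast
  then show "z \<in> SV" unfolding SV_def using e(3) by blast
next
  assume "z \<in> SV"
  then show "z \<in> (\<Union>e \<in> M - {k}. convex hull e)" unfolding SV_def using k EV_M M_split(2) by blast
qed

text \<open>Another vertical segment has a different abscissa, and a horizontal segment is part of
  its extension, so the segments add nothing to \<open>HX\<close> on this line.\<close>

lemma others_on_v_line:
  assumes j: "j \<in> EV" and z: "fst z = left_x j"
  shows "z \<in> (\<Union>e \<in> M - {j}. convex hull e) \<union> HX \<longleftrightarrow> z \<in> HX"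
proof -
  have "z \<in> HX" if z': "z \<in> (\<Union>e \<in> M - {j}. convex hull e)"
  proof -
    obtain e where e: "e \<in> M" "e \<noteq> j" "z \<in> convex hull e" using z' by blast
    have "e \<notin> EV"
    proof
      assume "e \<in> EV"
      then have "left_x e = left_x j" using e(3) z EV_hull by auto
      then show False using inj_left j \<open>e \<in> EV\<close> e(2) by (auto dest: inj_onD)
    qed
    then have eH: "e \<in> EH" using e(1) M_split(1) by blast
    then have "fst z \<in> {left_x e..right_x e}" "snd z = low_y e" using e(3) EH_hull by auto
    then have "fst z \<in> hh e" unfolding hh_def by (intro prolong_segment)
    then show ?thesis using eH \<open>snd z = low_y e\<close> unfolding HX_def by (cases z) auto
  qed
  then show ?thesis by blast
qed

abbreviation LH :: "point set" where
  "LH \<equiv> \<Union>v\<in>\<Union>EH. drawn_ray (others v \<union> frontier C) v (partner M v)"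

lemma drawn_h:
  assumes k: "k \<in> EH" and v: "v \<in> k"
  shows "drawn_ray (others v \<union> frontier C) v (partner M v) = drawn_ray (SV \<union> frontier C) v (partner M v)"
proof (rule drawn_ray_cong)
  fix z assume z: "z \<in> ray v"
  have "{v, partner M v} = k" using ray_h_cases[OF k v] by (rule conjunct1)
  moreover have "snd z = low_y k"
    using z ray_h_cases[OF k v] by (elim conjE disjE) (simp_all only: mem_Times_iff singleton_iff)
  ultimately show "z \<in> others v \<union> frontier C \<longleftrightarrow> z \<in> SV \<union> frontier C"
    using others_on_h_line[OF k, of z] by simp
qed

lemma HX_eq: "(\<Union>k\<in>EH. convex hull k) \<union> LH = HX"
proof -
  have edge: "(\<Union>v\<in>k. drawn_ray (others v \<union> frontier C) v (partner M v)) \<union> convex hull k = hh k \<times> {low_y k}"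
    if k: "k \<in> EH" for k
  proof -
    have "(\<Union>v\<in>k. drawn_ray (others v \<union> frontier C) v (partner M v)) =
      (\<Union>v\<in>{(left_x k, low_y k), (right_x k, low_y k)}. drawn_ray (SV \<union> frontier C) v (partner M v))"
      using own_edge_h[OF k] drawn_h[OF k] by simp
    also have "\<dots> = drawn_ray (SV \<union> frontier C) (left_x k, low_y k) (right_x k, low_y k) \<union>
        drawn_ray (SV \<union> frontier C) (right_x k, low_y k) (left_x k, low_y k)"
      by (simp add: partners_h[OF k])
    finally show ?thesis
      unfolding hh_def prolong_eq_drawn_h[OF EH_form(1)[OF k]] EH_hull[OF k] by blast
  qed
  have "(\<Union>k\<in>EH. convex hull k) \<union> LH =
      (\<Union>k\<in>EH. (\<Union>v\<in>k. drawn_ray (others v \<union> frontier C) v (partner M v)) \<union> convex hull k)" by blast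
  also have "\<dots> = HX" unfolding HX_def using edge by simp
  finally show ?thesis .
qed

abbreviation LV :: "point set" where
  "LV \<equiv> \<Union>v\<in>\<Union>EV. drawn_ray (others v \<union> LH \<union> frontier C) v (partner M v)"

lemma drawn_v:
  assumes j: "j \<in> EV" and v: "v \<in> j"
  shows "drawn_ray (others v \<union> LH \<union> frontier C) v (partner M v) = drawn_ray (HX \<union> frontier C) v (partner M v)"
proof (rule drawn_ray_cong)
  fix z assume z: "z \<in> ray v"
  have "{v, partner M v} = j" using ray_v_cases[OF j v] by (rule conjunct1)
  then have others: "others v = (\<Union>e \<in> M - {j}. convex hull e)" by simp
  have line: "fst z = left_x j"
    using z ray_v_cases[OF j v] by (elim conjE disjE) (simp_all only: mem_Times_iff singleton_iff)
  have sub: "(\<Union>k\<in>EH. convex hull k) \<subseteq> (\<Union>e \<in> M - {j}. convex hull e)"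
    using EH_M M_split(2) j by blast
  have "z \<in> A \<union> R \<union> F \<longleftrightarrow> z \<in> X \<union> F"
    if "z \<in> A \<union> X \<longleftrightarrow> z \<in> X" "H \<subseteq> A" "H \<union> R = X" for A R F X H :: "point set" using that by blast
  from this[OF others_on_v_line[OF j line] sub HX_eq]
  show "z \<in> others v \<union> LH \<union> frontier C \<longleftrightarrow> z \<in> HX \<union> frontier C" unfolding others .
qed

lemma VX_eq: "(\<Union>j\<in>EV. convex hull j) \<union> LV = VX"
proof -
  have edge: "(\<Union>v\<in>j. drawn_ray (others v \<union> LH \<union> frontier C) v (partner M v)) \<union> convex hull j = {left_x j} \<times> vv j"
    if j: "j \<in> EV" for j
  proof -
    have "(\<Union>v\<in>j. drawn_ray (others v \<union> LH \<union> frontier C) v (partner M v)) =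
      (\<Union>v\<in>{(left_x j, low_y j), (left_x j, high_y j)}. drawn_ray (HX \<union> frontier C) v (partner M v))"
      using own_edge_v[OF j] drawn_v[OF j] by simp
    also have "\<dots> = drawn_ray (HX \<union> frontier C) (left_x j, low_y j) (left_x j, high_y j) \<union>
        drawn_ray (HX \<union> frontier C) (left_x j, high_y j) (left_x j, low_y j)"
      by (simp add: partners_v[OF j])
    finally show ?thesis
      unfolding vv_def prolong_eq_drawn_v[OF EV_form(1)[OF j]] EV_hull[OF j] by blast
  qed
  have "(\<Union>j\<in>EV. convex hull j) \<union> LV =
      (\<Union>j\<in>EV. (\<Union>v\<in>j. drawn_ray (others v \<union> LH \<union> frontier C) v (partner M v)) \<union> convex hull j)" by blast
  also have "\<dots> = VX" unfolding VX_def using edge by simp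
  finally show ?thesis .
qed

lemma finite_vertices: "finite (\<Union>EH)" "finite (\<Union>EV)"
  using finite_subset[OF _ finite_P] edge_subset EH_M EV_M by (meson Union_least)+

lemma extension_L: "extension C M arr.L"
proof -
  obtain hs where hs: "set hs = \<Union>EH" "distinct hs" using finite_distinct_list[OF finite_vertices(1)] by blast
  obtain vs where vs: "set vs = \<Union>EV" "distinct vs" using finite_distinct_list[OF finite_vertices(2)] by blast
  have disj: "\<Union>EH \<inter> \<Union>EV = {}" using edges_disjoint EH_M EV_M M_split(2) by blast
  have "draw_rays C M {} hs = LH"
    using draw_rays_disjoint[of hs M C "{}"] rays_disjoint_h hs by simp
  then have "draw_rays C M {} (hs @ vs) = LH \<union> LV"
    using draw_rays_disjoint[of vs M C LH] rays_disjoint_v vs by (simp add: draw_rays_append)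
  moreover have "(\<Union>e\<in>M. convex hull e) = (\<Union>k\<in>EH. convex hull k) \<union> (\<Union>j\<in>EV. convex hull j)"
    using M_split(1) by blast
  moreover have "arr.L = HX \<union> VX" unfolding arr.L_def HX_def VX_def ..
  ultimately have "arr.L = (\<Union>e\<in>M. convex hull e) \<union> draw_rays C M {} (hs @ vs)"
    using HX_eq VX_eq by auto
  moreover have "distinct (hs @ vs)" using hs vs disj by auto
  moreover have "set (hs @ vs) = \<Union>M" using hs vs M_split(1) by auto
  ultimately show ?thesis unfolding extension_def by blast
qed

section \<open>Splitting the endpoints and assembling the two trees\<close>

lemma edge_lower_upper:
  assumes "e \<in> M"
  shows "e = {(left_x e, low_y e), (right_x e, high_y e)}" "(left_x e, low_y e) \<noteq> (right_x e, high_y e)"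
  using edge_form[OF assms] by auto

text \<open>For either orientation the marked endpoint is the coordinatewise minimum, so one formula
  covers both.\<close>

lemma S_eq: "arr.S = (\<lambda>e. (left_x e, low_y e)) ` M"
  unfolding arr.S_def using M_split(1) by blast

lemma T_eq: "arr.T = (\<lambda>e. (right_x e, high_y e)) ` M"
proof -
  have "(\<lambda>e. (right_x e, high_y e)) ` M = (\<lambda>e. (right_x e, high_y e)) ` EH \<union> (\<lambda>e. (right_x e, high_y e)) ` EV"
    using M_split(1) by blast
  also have "\<dots> = arr.T" unfolding arr.T_def using EH_form(3) EV_form(3) by (intro arg_cong2[of _ _ _ _ "(\<union>)"] image_cong) auto
  finally show ?thesis by simp
qed

lemma ST_union: "arr.S \<union> arr.T = \<Union>M"
  unfolding S_eq T_eq using edge_lower_upper(1) by blast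

lemma ST_disjoint: "arr.S \<inter> arr.T = {}"
proof -
  have "(left_x e, low_y e) \<noteq> (right_x f, high_y f)" if ef: "e \<in> M" "f \<in> M" for e f
  proof
    assume eq: "(left_x e, low_y e) = (right_x f, high_y f)"
    have "(left_x e, low_y e) \<in> e" "(right_x f, high_y f) \<in> f"
      using edge_lower_upper(1)[OF ef(1)] edge_lower_upper(1)[OF ef(2)] by blast+
    then have "e = f" using edges_disjoint[OF ef] eq by simp
    then show False using edge_lower_upper(2)[OF ef(1)] eq by simp
  qed
  then show ?thesis unfolding S_eq T_eq by blast
qed

lemma two_trees:
  assumes "M \<noteq> {}"
  shows "\<exists>S T. edge_partition_into_two_trees (dual_multigraph C M arr.L) S T \<and>
    (\<forall>v w. {v, w} \<in> M \<longrightarrow> (v \<in> edges S \<and> w \<in> edges T) \<or> (v \<in> edges T \<and> w \<in> edges S))"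
proof -
  interpret convex_cells C arr.L
  proof
    \<comment> \<open>A segment not contained in the frontier supplies an interior point; here at
      least one edge is required.\<close>
    show "interior C \<noteq> {}" using assms hull_interior by blast
  qed (use convex_C arr.closed_L arr.finite_connected_cover in auto)
  have fin: "finite arr.S" "finite arr.T" unfolding S_eq T_eq using finite_M by auto
  let ?G = "\<lambda>E. \<lparr>verts = cells C arr.L, edges = E, ends = (\<lambda>v. {c \<in> cells C arr.L. v \<in> frontier c})\<rparr>"
  have "is_tree (?G arr.S)" by (rule dual_part_tree[OF fin(1) arr.S_subset_L arr.tree_like_S])
  moreover have "is_tree (?G arr.T)" by (rule dual_part_tree[OF fin(2) arr.T_subset_L arr.tree_like_T])
  ultimately have "edge_partition_into_two_trees (dual_multigraph C M arr.L) (?G arr.S) (?G arr.T)"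
    unfolding edge_partition_into_two_trees_def dual_multigraph_def subgraph_def
    using ST_union ST_disjoint by auto
  moreover have "v \<in> arr.S \<and> w \<in> arr.T \<or> v \<in> arr.T \<and> w \<in> arr.S" if vw: "{v, w} \<in> M" for v w
  proof -
    define e where "e = {v, w}"
    have "(left_x e, low_y e) \<in> arr.S" "(right_x e, high_y e) \<in> arr.T" unfolding S_eq T_eq using vw e_def by blast+
    moreover have "{v, w} = {(left_x e, low_y e), (right_x e, high_y e)}"
      using edge_lower_upper(1)[of e] vw e_def by simp
    ultimately show ?thesis by (auto simp: doubleton_eq_iff)
  qed
  ultimately show ?thesis by (intro exI[of _ "?G arr.S"] exI[of _ "?G arr.T"]) simp
qed

end

text \<open>Without segments \<open>C\<close> may have empty interior, so this case stands apart.
  The only cell is \<open>C\<close>, and the graph with one vertex and no edge serves as both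
  trees.\<close>

lemma two_trees_no_edges:
  assumes "convex C" "C \<noteq> {}"
  shows "extension C {} {} \<and> (\<exists>S T. edge_partition_into_two_trees (dual_multigraph C {} {}) S T)"
proof
  show "extension C {} {}" unfolding extension_def by (intro exI[of _ "[]"]) simp
  have "connected C" using assms(1) by (rule convex_connected)
  then have cells: "cells C {} = {C}"
    unfolding cells_def using assms(2) by (simp add: components_eq_sing_iff)
  have "is_tree (dual_multigraph C {} {})"
    unfolding is_tree_def wf_multigraph_def connected_graph_def is_cycle_def dual_multigraph_def cells by simp
  then show "\<exists>S T. edge_partition_into_two_trees (dual_multigraph C {} {}) S T"
    unfolding edge_partition_into_two_trees_def subgraph_def
    by (intro exI[of _ "dual_multigraph C {} {}"]) (auto simp: dual_multigraph_def)
qed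

theorem theorem11:
  fixes P :: "point set" and M :: "point set set" and C :: "point set"
  assumes "perfect_matching P M"
    and "general_position P"
    and "axis_parallel M"
    and "convex C" and "C \<noteq> {}"
    and "\<forall>e\<in>M. convex hull e \<subseteq> C"
    and "\<forall>e\<in>M. \<not> convex hull e \<subseteq> frontier C"
  shows "\<exists>L. extension C M L \<and>
           (\<exists>S T. edge_partition_into_two_trees (dual_multigraph C M L) S T \<and>
              (\<forall>v w. {v, w} \<in> M \<longrightarrow>
                 (v \<in> edges S \<and> w \<in> edges T) \<or> (v \<in> edges T \<and> w \<in> edges S)))"
proof (cases "M = {}")
  case True
  then show ?thesis using two_trees_no_edges[OF assms(4,5)] by (intro exI[of _ "{}"]) simp
next
  case False
  interpret axis_matching P M C using assms by unfold_locales auto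
  show ?thesis using extension_L two_trees[OF False] by blast
qed

end
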